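(* Let $\mathcal{A}$ be a unital $C^*$-algebra, let $\mathcal{B}$ be a von Neumann algebra, let $Z\in\mathcal{A}$, let $J\in\mathcal{A}^+$, and let $\Phi:\mathcal{A}\to\mathcal{B}$ be a positive linear map. Suppose that there are continuous nonnegative functions $f,g$ on $[0,\infty)$ with $f(t)g(t)=t^2$ for all $t\ge0$ such that $f(|Z|)\le J$ and $g(|Z^*|)\le J$. Then there exists a partial isometry $V\in\mathcal{B}$ such that $$|\Phi(Z)|\le \Phi(J)\,\#\,V\Phi(J)V^*.$$
   Context: $\mathcal{A}^+$ denotes the cone of positive elements of $\mathcal{A}$, and $|X|=(X^*X)^{1/2}$. A linear map $\Phi:\mathcal{A}\to\mathcal{B}$ is positive if it maps positive elements to positive elements. Functions of positive elements are defined by the continuous functional calculus. For positive operators $A,B$, $A\#B$ denotes the operator geometric mean: $A\#B=A^{1/2}(A^{-1/2}BA^{-1/2})^{1/2}A^{1/2}$ if $A,B$ are invertible, and $A\#B$ is the strong operator limit of $(A+\varepsilon I)\#(B+\varepsilon I)$ as $\varepsilon\downarrow0$ in general; equivalently, $A\#B$ is the largest self-adjoint operator $X$ such that $\begin{pmatrix} A & X \\ X & B \end{pmatrix}\ge0$. *)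

theory Defs
  imports "HOL-Analysis.Analysis" "HOL-Computational_Algebra.Polynomial"
begin

section \<open>Complex vector spaces and complex Hilbert spaces\<close>

class scaleC =
  fixes scaleC :: "complex \<Rightarrow> 'a \<Rightarrow> 'a" (infixr \<open>*\<^sub>C\<close> 75)

class complex_vector = real_vector + scaleC +
  assumes scaleC_add_right: "c *\<^sub>C (x + y) = c *\<^sub>C x + c *\<^sub>C y"
    and scaleC_add_left: "(c + d) *\<^sub>C x = c *\<^sub>C x + d *\<^sub>C x"
    and scaleC_scaleC: "c *\<^sub>C d *\<^sub>C x = (c * d) *\<^sub>C x"
    and scaleC_one: "1 *\<^sub>C x = x"
    and scaleR_scaleC: "r *\<^sub>R x = complex_of_real r *\<^sub>C x"

lemma (in complex_vector) scaleC_zero_right: "c *\<^sub>C 0 = 0"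
  by (metis add_cancel_right_right scaleC_add_right)

lemma (in complex_vector) scaleC_minus_right: "c *\<^sub>C (- x) = - (c *\<^sub>C x)"
  by (rule minus_unique[symmetric]) (simp add: scaleC_zero_right flip: scaleC_add_right)

lemma (in complex_vector) scaleC_diff_right: "c *\<^sub>C (x - y) = c *\<^sub>C x - c *\<^sub>C y"
  by (metis scaleC_add_right scaleC_minus_right diff_conv_add_uminus)

definition clinear :: "('a::complex_vector \<Rightarrow> 'b::complex_vector) \<Rightarrow> bool" where
  "clinear T \<longleftrightarrow> (\<forall>x y. T (x + y) = T x + T y) \<and> (\<forall>c x. T (c *\<^sub>C x) = c *\<^sub>C T x)"

text \<open>The complex inner product is linear in its second argument. Positive definiteness and the
  relation to the norm are inherited from the real inner product, which is its real part.\<close>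

class complex_hilbert_space = complex_vector + real_inner + banach +
  fixes cinner :: "'a \<Rightarrow> 'a \<Rightarrow> complex"
  assumes cinner_add_right: "cinner x (y + z) = cinner x y + cinner x z"
    and cinner_scaleC_right: "cinner x (c *\<^sub>C y) = c * cinner x y"
    and cinner_commute: "cinner x y = cnj (cinner y x)"
    and Re_cinner: "Re (cinner x y) = inner x y"

section \<open>Unital C*-algebras\<close>

text \<open>The superclass \<open>real_normed_algebra\<close> with a separate \<open>monoid_mult\<close> is used instead of
  \<open>real_normed_algebra_1\<close> so that the zero algebra is not excluded.\<close>

class cstar_algebra = complex_vector + real_normed_algebra + banach + monoid_mult +
  fixes star :: "'a \<Rightarrow> 'a"
  assumes scaleC_mult_left: "(c *\<^sub>C x) * y = c *\<^sub>C (x * y)"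
    and scaleC_mult_right: "x * (c *\<^sub>C y) = c *\<^sub>C (x * y)"
    and norm_scaleC: "norm (c *\<^sub>C x) = cmod c * norm x"
    and star_add: "star (x + y) = star x + star y"
    and star_scaleC: "star (c *\<^sub>C x) = cnj c *\<^sub>C star x"
    and star_mult: "star (x * y) = star y * star x"
    and star_star: "star (star x) = x"
    and cstar_identity: "norm (star x * x) = (norm x)\<^sup>2"

definition cstar_invertible :: "'a::cstar_algebra \<Rightarrow> bool" where
  "cstar_invertible a \<longleftrightarrow> (\<exists>b. a * b = 1 \<and> b * a = 1)"

definition spectrum :: "'a::cstar_algebra \<Rightarrow> complex set" where
  "spectrum a = {c. \<not> cstar_invertible (a - c *\<^sub>C 1)}"

definition cstar_positive :: "'a::cstar_algebra \<Rightarrow> bool" where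
  "cstar_positive a \<longleftrightarrow> star a = a \<and> spectrum a \<subseteq> \<real>\<^sub>\<ge>\<^sub>0"

definition cstar_le :: "'a::cstar_algebra \<Rightarrow> 'a \<Rightarrow> bool" (infix \<open>\<preceq>\<close> 50) where
  "a \<preceq> b \<longleftrightarrow> cstar_positive (b - a)"

definition cstar_poly :: "real poly \<Rightarrow> 'a::cstar_algebra \<Rightarrow> 'a" where
  "cstar_poly p a = (\<Sum>i\<le>degree p. coeff p i *\<^sub>R a ^ i)"

text \<open>Continuous functional calculus for a self-adjoint \<open>a\<close> and a real function \<open>f\<close> continuous on the
  spectrum of \<open>a\<close>: \<open>f(a)\<close> is the norm limit of \<open>p\<^sub>n(a)\<close> for polynomials \<open>p\<^sub>n\<close> converging to \<open>f\<close>
  uniformly on the spectrum. Existence is the Weierstrass theorem, and the limit does not depend on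
  the sequence since the norm of \<open>p(a)\<close> is the supremum of \<open>\<bar>p\<bar>\<close> on the spectrum.\<close>

definition cfc :: "(real \<Rightarrow> real) \<Rightarrow> 'a::cstar_algebra \<Rightarrow> 'a" where
  "cfc f a = (THE b. \<exists>p. uniform_limit {t. complex_of_real t \<in> spectrum a} (\<lambda>n. poly (p n)) f sequentially
                       \<and> (\<lambda>n. cstar_poly (p n) a) \<longlonglongrightarrow> b)"

definition cstar_abs :: "'a::cstar_algebra \<Rightarrow> 'a" where
  "cstar_abs x = cfc sqrt (star x * x)"

definition positive_map :: "('a::cstar_algebra \<Rightarrow> 'b::cstar_algebra) \<Rightarrow> bool" where
  "positive_map \<Phi> \<longleftrightarrow> (\<forall>a. cstar_positive a \<longrightarrow> cstar_positive (\<Phi> a))"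

definition projection :: "'a::cstar_algebra \<Rightarrow> bool" where
  "projection p \<longleftrightarrow> star p = p \<and> p * p = p"

definition partial_isometry :: "'a::cstar_algebra \<Rightarrow> bool" where
  "partial_isometry v \<longleftrightarrow> projection (star v * v)"

section \<open>The C*-algebra of bounded operators on a complex Hilbert space\<close>

lemma (in complex_hilbert_space) inner_scaleC_left: "inner (c *\<^sub>C x) y = inner x (cnj c *\<^sub>C y)"
proof -
  have "cinner (c *\<^sub>C x) y = cnj (c * cinner y x)"
    by (metis cinner_commute cinner_scaleC_right)
  also have "\<dots> = cinner x (cnj c *\<^sub>C y)"
    by (metis cinner_commute cinner_scaleC_right complex_cnj_mult)
  finally show ?thesis by (metis Re_cinner)
qed

lemma inner_right_eqI:
  fixes x y :: "'a::real_inner"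
  assumes "\<And>z. inner x z = inner y z"
  shows "x = y"
  using assms by (metis vector_eq_rdot inner_commute)

lemma norm_scaleC_hilbert: "norm (c *\<^sub>C x) = cmod c * norm (x::'h::complex_hilbert_space)"
proof -
  have "inner (c *\<^sub>C x) (c *\<^sub>C x) = inner x ((cnj c * c) *\<^sub>C x)"
    by (simp add: inner_scaleC_left scaleC_scaleC)
  also have "cnj c * c = complex_of_real ((cmod c)\<^sup>2)"
    by (metis complex_norm_square mult.commute)
  also have "inner x (complex_of_real ((cmod c)\<^sup>2) *\<^sub>C x) = (cmod c)\<^sup>2 * inner x x"
    by (simp del: of_real_power flip: scaleR_scaleC)
  finally have "(norm (c *\<^sub>C x))\<^sup>2 = (cmod c * norm x)\<^sup>2"
    by (simp add: power2_norm_eq_inner power_mult_distrib)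
  then show ?thesis by simp
qed

lemma riesz_representation:
  fixes \<phi> :: "'h::{real_inner, complete_space} \<Rightarrow> real"
  assumes "bounded_linear \<phi>"
  shows "\<exists>z. \<forall>x. inner z x = \<phi> x"
proof -
  interpret \<phi>: bounded_linear \<phi> by fact
  define F where "F x = (norm x)\<^sup>2 - 2 * \<phi> x" for x
  obtain K where K: "\<And>x. norm (\<phi> x) \<le> norm x * K" using \<phi>.bounded by blast
  have lb: "- K\<^sup>2 \<le> F x" for x
  proof -
    have "0 \<le> (norm x - K)\<^sup>2" by simp
    then show ?thesis using K[of x] by (simp add: F_def power2_eq_square algebra_simps)
  qed
  define m where "m = Inf (range F)"
  have bdd: "bdd_below (range F)" using lb by (auto simp: bdd_below_def)
  have m: "m \<le> F x" for x unfolding m_def using bdd by (simp add: cInf_lower)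
  have "\<exists>x. F x < m + inverse (Suc n)" for n
    using cInf_lessD[of "range F" "m + inverse (Suc n)"] by (auto simp: m_def)
  then obtain X where X: "\<And>n. F (X n) < m + inverse (Suc n)" by metis
  have par: "(norm (x - y))\<^sup>2 = 2 * F x + 2 * F y - 4 * F ((1/2) *\<^sub>R (x + y))" for x y
    by (simp add: F_def \<phi>.scaleR \<phi>.add power2_norm_eq_inner inner_add_left inner_add_right
          inner_diff_left inner_diff_right inner_commute algebra_simps)
  have dX: "(norm (X i - X j))\<^sup>2 \<le> 2 * inverse (Suc i) + 2 * inverse (Suc j)" for i j
    using par[of "X i" "X j"] X[of i] X[of j] m[of "(1/2) *\<^sub>R (X i + X j)"] by linarith
  have "Cauchy X"
  proof (rule metric_CauchyI)
    fix e :: real assume e: "0 < e"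
    then obtain N where N: "inverse (real (Suc N)) < e\<^sup>2 / 4"
      using reals_Archimedean[of "e\<^sup>2 / 4"] by auto
    show "\<exists>M. \<forall>i\<ge>M. \<forall>j\<ge>M. dist (X i) (X j) < e"
    proof (intro exI allI impI)
      fix i j assume ij: "N \<le> i" "N \<le> j"
      have "inverse (real (Suc i)) \<le> inverse (real (Suc N))" "inverse (real (Suc j)) \<le> inverse (real (Suc N))"
        using ij by (auto intro!: le_imp_inverse_le)
      then have "(norm (X i - X j))\<^sup>2 < e\<^sup>2" using dX[of i j] N by linarith
      then show "dist (X i) (X j) < e" using e by (simp add: dist_norm power2_less_imp_less)
    qed
  qed
  then obtain z where z: "X \<longlonglongrightarrow> z" using Cauchy_convergent_iff convergent_def by blast
  have "(\<lambda>n. F (X n)) \<longlonglongrightarrow> F z" unfolding F_def by (intro tendsto_intros z \<phi>.tendsto)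
  moreover have "(\<lambda>n. m + inverse (Suc n)) \<longlonglongrightarrow> m + 0"
    by (intro tendsto_intros LIMSEQ_inverse_real_of_nat)
  ultimately have "F z \<le> m + 0"
    by (rule LIMSEQ_le) (use X less_imp_le in blast)
  then have min: "F z \<le> F x" for x using m[of x] by linarith
  have "inner z x = \<phi> x" for x
  proof -
    have quad: "0 \<le> t\<^sup>2 * (norm x)\<^sup>2 + 2 * t * (inner z x - \<phi> x)" for t
    proof -
      have "F (z + t *\<^sub>R x) = F z + (t\<^sup>2 * (norm x)\<^sup>2 + 2 * t * (inner z x - \<phi> x))"
        unfolding F_def \<phi>.scaleR \<phi>.add power2_norm_eq_inner inner_add_left inner_add_right
        by (simp add: inner_commute power2_eq_square algebra_simps)
      then show ?thesis using min[of "z + t *\<^sub>R x"] by linarith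
    qed
    define d where "d = inner z x - \<phi> x"
    define s where "s = (norm x)\<^sup>2 + 1"
    have s: "s > 0" by (simp add: s_def add_nonneg_pos)
    have "0 \<le> (- d / s)\<^sup>2 * (norm x)\<^sup>2 + 2 * (- d / s) * d" using quad unfolding d_def by blast
    also have "\<dots> \<le> (- d / s)\<^sup>2 * s + 2 * (- d / s) * d" by (simp add: s_def mult_left_mono)
    also have "\<dots> = - (d\<^sup>2 / s)" using s by (simp add: power2_eq_square field_simps)
    finally have "d\<^sup>2 \<le> 0" using s by (simp add: field_simps)
    then show ?thesis by (simp add: d_def)
  qed
  then show ?thesis by blast
qed

typedef (overloaded) 'h bounded_op =
    "{T :: 'h::complex_hilbert_space \<Rightarrow>\<^sub>L 'h. clinear (blinfun_apply T)}"
  morphisms blinfun_of_op Abs_bounded_op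
  by (rule exI[of _ 0]) (simp add: clinear_def scaleC_zero_right)

setup_lifting type_definition_bounded_op

abbreviation op_apply :: "'h::complex_hilbert_space bounded_op \<Rightarrow> 'h \<Rightarrow> 'h" where
  "op_apply T \<equiv> blinfun_apply (blinfun_of_op T)"

lemma op_eqI: "(\<And>x. op_apply S x = op_apply T x) \<Longrightarrow> S = T"
  by (metis blinfun_eqI blinfun_of_op_inject)

lemma op_inner_eqI:
  "(\<And>x y. inner (op_apply S x) y = inner (op_apply T x) y) \<Longrightarrow> S = T"
  by (rule op_eqI) (rule inner_right_eqI)

lemma op_apply_scaleC: "op_apply T (c *\<^sub>C x) = c *\<^sub>C op_apply T x"
  using blinfun_of_op[of T] by (simp add: clinear_def)

instantiation bounded_op :: (complex_hilbert_space) real_normed_vector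
begin

lift_definition zero_bounded_op :: "'a bounded_op" is 0
  by (simp add: clinear_def scaleC_zero_right)

lift_definition plus_bounded_op :: "'a bounded_op \<Rightarrow> 'a bounded_op \<Rightarrow> 'a bounded_op" is "(+)"
  by (simp add: clinear_def blinfun.bilinear_simps scaleC_add_right)

lift_definition scaleR_bounded_op :: "real \<Rightarrow> 'a bounded_op \<Rightarrow> 'a bounded_op" is "(*\<^sub>R)"
  by (simp add: clinear_def blinfun.bilinear_simps scaleR_scaleC scaleC_add_right scaleC_scaleC
      mult.commute)

lift_definition uminus_bounded_op :: "'a bounded_op \<Rightarrow> 'a bounded_op" is uminus
  by (simp add: clinear_def blinfun.bilinear_simps scaleC_minus_right)

lift_definition minus_bounded_op :: "'a bounded_op \<Rightarrow> 'a bounded_op \<Rightarrow> 'a bounded_op" is "(-)"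
  by (simp add: clinear_def blinfun.bilinear_simps scaleC_diff_right)

lift_definition norm_bounded_op :: "'a bounded_op \<Rightarrow> real" is norm .

definition dist_bounded_op :: "'a bounded_op \<Rightarrow> 'a bounded_op \<Rightarrow> real" where
  "dist_bounded_op S T = norm (S - T)"

definition uniformity_bounded_op :: "('a bounded_op \<times> 'a bounded_op) filter" where
  "uniformity_bounded_op = (INF e\<in>{0<..}. principal {(S, T). dist S T < e})"

definition open_bounded_op :: "'a bounded_op set \<Rightarrow> bool" where
  "open_bounded_op U = (\<forall>S\<in>U. \<forall>\<^sub>F (S', T) in uniformity. S' = S \<longrightarrow> T \<in> U)"

definition sgn_bounded_op :: "'a bounded_op \<Rightarrow> 'a bounded_op" where
  "sgn_bounded_op T = inverse (norm T) *\<^sub>R T"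

instance
proof
  fix S T U :: "'a bounded_op" and r s :: real
  show "S + T + U = S + (T + U)" "S + T = T + S" "0 + S = S"
    by (transfer; simp)+
  show "- S + S = 0" "S - T = S + - T" by (transfer; simp)+
  show "r *\<^sub>R (S + T) = r *\<^sub>R S + r *\<^sub>R T" "(r + s) *\<^sub>R S = r *\<^sub>R S + s *\<^sub>R S"
    "r *\<^sub>R s *\<^sub>R S = (r * s) *\<^sub>R S" "1 *\<^sub>R S = S"
    by (transfer; simp add: scaleR_add_left scaleR_add_right)+
  show "norm S = 0 \<longleftrightarrow> S = 0" "norm (S + T) \<le> norm S + norm T" "norm (r *\<^sub>R S) = \<bar>r\<bar> * norm S"
    by (transfer; simp add: norm_triangle_ineq)+
qed (simp_all add: dist_bounded_op_def uniformity_bounded_op_def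
      open_bounded_op_def sgn_bounded_op_def)

end

lemma dist_blinfun_of_op: "dist (blinfun_of_op S) (blinfun_of_op T) = dist S T"
  by (simp add: dist_norm norm_bounded_op.rep_eq minus_bounded_op.rep_eq)

lemma bounded_linear_scaleC_hilbert: "bounded_linear ((*\<^sub>C) c :: 'h \<Rightarrow> 'h::complex_hilbert_space)"
  by (rule bounded_linear_intro[where K = "cmod c"])
    (simp_all add: scaleC_add_right scaleR_scaleC scaleC_scaleC mult.commute norm_scaleC_hilbert)

instance bounded_op :: (complex_hilbert_space) banach
proof
  fix X :: "nat \<Rightarrow> 'a bounded_op" assume "Cauchy X"
  then have "Cauchy (\<lambda>n. blinfun_of_op (X n))" by (simp add: Cauchy_def dist_blinfun_of_op)
  then obtain L where L: "(\<lambda>n. blinfun_of_op (X n)) \<longlonglongrightarrow> L"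
    by (auto dest!: Cauchy_convergent simp: convergent_def)
  have lim: "(\<lambda>n. op_apply (X n) x) \<longlonglongrightarrow> L x" for x
    by (rule blinfun.tendsto[OF L tendsto_const])
  have "L (c *\<^sub>C x) = c *\<^sub>C L x" for c x
    using lim[of "c *\<^sub>C x"] bounded_linear.tendsto[OF bounded_linear_scaleC_hilbert lim[of x], of c]
    unfolding op_apply_scaleC by (rule LIMSEQ_unique)
  then have "blinfun_of_op (Abs_bounded_op L) = L"
    by (simp add: Abs_bounded_op_inverse clinear_def blinfun.bilinear_simps)
  then have "X \<longlonglongrightarrow> Abs_bounded_op L"
    using L by (metis (no_types, lifting) dist_blinfun_of_op lim_sequentially)
  then show "convergent X" by (auto simp: convergent_def)
qed

instantiation bounded_op :: (complex_hilbert_space) complex_vector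
begin

lift_definition scaleC_bounded_op :: "complex \<Rightarrow> 'a bounded_op \<Rightarrow> 'a bounded_op" is
  "\<lambda>c T. Blinfun ((*\<^sub>C) c) o\<^sub>L T"
  by (simp add: clinear_def bounded_linear_Blinfun_apply bounded_linear_scaleC_hilbert
      scaleC_add_right scaleC_scaleC mult.commute)

lemma op_apply_of_scaleC: "op_apply (c *\<^sub>C T) x = c *\<^sub>C op_apply T x" for T :: "'a bounded_op"
  by (simp add: scaleC_bounded_op.rep_eq bounded_linear_Blinfun_apply bounded_linear_scaleC_hilbert)

instance
proof
  fix S T :: "'a bounded_op" and c d :: complex and r :: real
  show "c *\<^sub>C (S + T) = c *\<^sub>C S + c *\<^sub>C T" "(c + d) *\<^sub>C S = c *\<^sub>C S + d *\<^sub>C S"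
    "c *\<^sub>C d *\<^sub>C S = (c * d) *\<^sub>C S" "1 *\<^sub>C S = S"
    by (rule op_eqI; simp add: op_apply_of_scaleC plus_bounded_op.rep_eq blinfun.bilinear_simps
        scaleC_add_right scaleC_add_left scaleC_scaleC scaleC_one)+
  show "r *\<^sub>R S = complex_of_real r *\<^sub>C S"
    by (rule op_eqI)
      (simp add: op_apply_of_scaleC scaleR_bounded_op.rep_eq blinfun.bilinear_simps scaleR_scaleC)
qed

end

lemma op_adjoint_exists:
  fixes T :: "'h::complex_hilbert_space bounded_op"
  shows "\<exists>S. \<forall>x y. inner (op_apply S x) y = inner x (op_apply T y)"
proof -
  have "\<exists>z. \<forall>y. inner z y = inner x (op_apply T y)" for x
    by (rule riesz_representation)
      (rule bounded_linear_compose[OF bounded_linear_inner_right blinfun.bounded_linear_right])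
  then obtain S where S: "\<And>x y. inner (S x) y = inner x (op_apply T y)" by metis
  have scale: "S (c *\<^sub>C x) = c *\<^sub>C S x" for c x
    by (rule inner_right_eqI) (simp add: S inner_scaleC_left op_apply_scaleC)
  have add: "S (x + y) = S x + S y" for x y
    by (rule inner_right_eqI) (simp add: S inner_add_left)
  have "bounded_linear S"
  proof (rule bounded_linear_intro[where K = "norm T"])
    fix x
    have "norm (S x) * norm (S x) = inner x (op_apply T (S x))"
      by (metis S power2_eq_square power2_norm_eq_inner)
    also have "\<dots> \<le> norm x * norm (op_apply T (S x))" by (rule norm_cauchy_schwarz)
    also have "\<dots> \<le> norm x * (norm T * norm (S x))"
      by (intro mult_left_mono) (simp_all add: norm_bounded_op.rep_eq norm_blinfun)
    finally have "norm (S x) * norm (S x) \<le> (norm x * norm T) * norm (S x)" by (simp add: mult.assoc)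
    then show "norm (S x) \<le> norm x * norm T"
      by (cases "S x = 0") (auto simp: norm_bounded_op.rep_eq)
  qed (simp_all add: add scale scaleR_scaleC)
  then have "op_apply (Abs_bounded_op (Blinfun S)) = S"
    by (subst Abs_bounded_op_inverse) (simp_all add: bounded_linear_Blinfun_apply clinear_def add scale)
  then show ?thesis using S by metis
qed

instantiation bounded_op :: (complex_hilbert_space) cstar_algebra
begin

lift_definition one_bounded_op :: "'a bounded_op" is id_blinfun
  by (simp add: clinear_def)

lift_definition times_bounded_op :: "'a bounded_op \<Rightarrow> 'a bounded_op \<Rightarrow> 'a bounded_op" is "(o\<^sub>L)"
  by (simp add: clinear_def)

definition star_bounded_op :: "'a bounded_op \<Rightarrow> 'a bounded_op" where
  "star_bounded_op T = (THE S. \<forall>x y. cinner (op_apply S x) y = cinner x (op_apply T y))"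

lemma inner_star: "inner (op_apply (star T) x) y = inner x (op_apply T y)" for T :: "'a bounded_op"
proof -
  obtain S where S: "\<And>x y. inner (op_apply S x) y = inner x (op_apply T y)"
    using op_adjoint_exists[of T] by blast
  have Im: "Im (cinner u v) = inner u ((- \<i>) *\<^sub>C v)" for u v :: 'a
    by (metis Re_cinner cinner_scaleC_right Im_i_times mult_minus_left uminus_complex.sel(1)
        Re_i_times minus_minus)
  have cS: "cinner (op_apply S x) y = cinner x (op_apply T y)" for x y
    by (rule complex_eqI) (simp_all add: Re_cinner Im S op_apply_scaleC)
  have "star T = S"
    unfolding star_bounded_op_def
  proof (rule the_equality)
    fix S' assume "\<forall>x y. cinner (op_apply S' x) y = cinner x (op_apply T y)"
    then have "inner (op_apply S' x) y = inner (op_apply S x) y" for x y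
      by (metis Re_cinner cS)
    then show "S' = S" by (rule op_inner_eqI)
  qed (simp add: cS)
  then show ?thesis using S by simp
qed

instance
proof
  fix S T U :: "'a bounded_op" and r :: real and c :: complex
  show "S * T * U = S * (T * U)" "(S + T) * U = S * U + T * U" "S * (T + U) = S * T + S * U"
    "1 * S = S" "S * 1 = S"
    by (rule op_eqI; simp add: times_bounded_op.rep_eq plus_bounded_op.rep_eq one_bounded_op.rep_eq
        blinfun.bilinear_simps)+
  show "r *\<^sub>R S * T = r *\<^sub>R (S * T)" "S * r *\<^sub>R T = r *\<^sub>R (S * T)"
    by (rule op_eqI; simp add: times_bounded_op.rep_eq scaleR_bounded_op.rep_eq blinfun.bilinear_simps)+
  show mult_ineq: "norm (S * T) \<le> norm S * norm T" for S T :: "'a bounded_op"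
    by transfer (rule norm_blinfun_compose)
  show "c *\<^sub>C S * T = c *\<^sub>C (S * T)" "S * c *\<^sub>C T = c *\<^sub>C (S * T)"
    by (rule op_eqI; simp add: times_bounded_op.rep_eq op_apply_of_scaleC op_apply_scaleC)+
  show "norm (c *\<^sub>C S) = cmod c * norm S"
  proof -
    have le: "norm (c *\<^sub>C S) \<le> cmod c * norm S" for c and S :: "'a bounded_op"
      unfolding norm_bounded_op.rep_eq
    proof (rule norm_blinfun_bound)
      show "norm (op_apply (c *\<^sub>C S) x) \<le> cmod c * norm (blinfun_of_op S) * norm x" for x
        using mult_left_mono[OF norm_blinfun[of "blinfun_of_op S" x], of "cmod c"]
        by (simp add: op_apply_of_scaleC norm_scaleC_hilbert mult.assoc)
    qed simp
    show ?thesis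
    proof (cases "c = 0")
      case True
      then show ?thesis using le[of c S] by simp
    next
      case False
      have "norm S = norm (inverse c *\<^sub>C c *\<^sub>C S)" using False by (simp add: scaleC_scaleC scaleC_one)
      also have "\<dots> \<le> inverse (cmod c) * norm (c *\<^sub>C S)" using le[of "inverse c"] by (simp add: norm_inverse)
      finally have "cmod c * norm S \<le> norm (c *\<^sub>C S)" using False by (simp add: field_simps)
      with le[of c S] show ?thesis by simp
    qed
  qed
  show "star (S + T) = star S + star T"
    by (rule op_inner_eqI)
      (simp add: inner_star plus_bounded_op.rep_eq blinfun.bilinear_simps inner_add_left inner_add_right)
  show "star (c *\<^sub>C S) = cnj c *\<^sub>C star S"
    by (rule op_inner_eqI)
      (simp add: inner_star op_apply_of_scaleC op_apply_scaleC inner_scaleC_left)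
  show "star (S * T) = star T * star S"
    by (rule op_inner_eqI) (simp add: inner_star times_bounded_op.rep_eq)
  show star_star: "star (star S) = S" for S :: "'a bounded_op"
    by (rule op_inner_eqI) (metis inner_star inner_commute)
  have le: "(norm S)\<^sup>2 \<le> norm (star S * S)" for S :: "'a bounded_op"
  proof -
    have "norm S \<le> sqrt (norm (star S * S))"
      unfolding norm_bounded_op.rep_eq[of S]
    proof (rule norm_blinfun_bound)
      fix x
      have "(norm (op_apply S x))\<^sup>2 = inner (op_apply (star S * S) x) x"
        by (simp add: power2_norm_eq_inner times_bounded_op.rep_eq inner_star)
      also have "\<dots> \<le> norm (op_apply (star S * S) x) * norm x" by (rule norm_cauchy_schwarz)
      also have "\<dots> \<le> norm (star S * S) * norm x * norm x"
        by (intro mult_right_mono) (simp_all add: norm_bounded_op.rep_eq norm_blinfun)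
      also have "\<dots> = (sqrt (norm (star S * S)) * norm x)\<^sup>2"
        by (simp add: power_mult_distrib) (simp add: power2_eq_square)
      finally have "(norm (op_apply S x))\<^sup>2 \<le> (sqrt (norm (star S * S)) * norm x)\<^sup>2" .
      then show "norm (op_apply S x) \<le> sqrt (norm (star S * S)) * norm x"
        by (rule power2_le_imp_le) simp
    qed simp
    then show ?thesis using power_mono[of "norm S" "sqrt (norm (star S * S))" 2] by simp
  qed
  have star_le: "norm S \<le> norm (star S)" for S :: "'a bounded_op"
  proof (cases "norm S = 0")
    case False
    have "norm S * norm S \<le> norm (star S) * norm S"
      using le[of S] mult_ineq[of "star S" S] by (simp add: power2_eq_square)
    then show ?thesis using False by simp
  qed simp
  have "norm (star S) = norm S" using star_le[of S] star_le[of "star S"] by (simp add: star_star)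
  then show "norm (star S * S) = (norm S)\<^sup>2"
    using le[of S] mult_ineq[of "star S" S] by (simp add: power2_eq_square)
qed

end

section \<open>Von Neumann algebras and the operator geometric mean\<close>

definition op_sot :: "'h::complex_hilbert_space bounded_op topology" where
  "op_sot = pullback_topology UNIV blinfun_of_op strong_operator_topology"

text \<open>Concrete von Neumann algebras contain the identity operator. For a *-subalgebra, closedness in
  the strong and in the weak operator topology coincide. Positivity, functional calculus and absolute
  value of elements of \<open>M\<close> are those of the ambient operator algebra; by spectral permanence they
  agree with the ones formed inside \<open>M\<close>.\<close>

definition von_neumann_algebra :: "'h::complex_hilbert_space bounded_op set \<Rightarrow> bool" where
  "von_neumann_algebra M \<longleftrightarrow>
     1 \<in> M \<and> (\<forall>S\<in>M. \<forall>T\<in>M. S + T \<in> M \<and> S * T \<in> M) \<and> (\<forall>c. \<forall>T\<in>M. c *\<^sub>C T \<in> M) \<and>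
     (\<forall>T\<in>M. star T \<in> M) \<and> closedin op_sot M"

definition geometric_mean_invertible ::
    "'h::complex_hilbert_space bounded_op \<Rightarrow> 'h bounded_op \<Rightarrow> 'h bounded_op" where
  "geometric_mean_invertible A B =
     (let R = cfc sqrt A; R' = cfc (\<lambda>t. 1 / sqrt t) A in R * cfc sqrt (R' * B * R') * R)"

text \<open>The strong operator topology is Hausdorff, so the limit is unique.\<close>

definition geometric_mean ::
    "'h::complex_hilbert_space bounded_op \<Rightarrow> 'h bounded_op \<Rightarrow> 'h bounded_op" (infixl \<open>#\<^sub>g\<close> 70) where
  "A #\<^sub>g B =
     (if cstar_invertible A \<and> cstar_invertible B then geometric_mean_invertible A B
      else THE X. limitin op_sot
        (\<lambda>\<epsilon>. geometric_mean_invertible (A + \<epsilon> *\<^sub>R 1) (B + \<epsilon> *\<^sub>R 1)) X (at_right 0))"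

end

theory Submission
  imports Defs "HOL-Computational_Algebra.Fundamental_Theorem_Algebra"
begin

text \<open>Write \<open>A = \<Phi>(J)\<close> and \<open>W = \<Phi>(Z)\<close>. The heart of the matter is the inequality
  \<open>2 Re \<langle>W x, y\<rangle> \<le> \<langle>A x, x\<rangle> + \<langle>A y, y\<rangle>\<close> for all vectors \<open>x, y\<close>, that is, positivity of the operator
  matrix with diagonal \<open>A, A\<close> and off-diagonal entry \<open>W\<close>. A positive map need not be 2-positive, so
  this cannot be obtained by applying \<open>\<Phi>\<close> to the corresponding matrix over the algebra. The two
  diagonal entries are equal, however, and such a matrix is a limit of sums of elementary tensors of
  positive elements.

  In detail, the hypotheses on \<open>f\<close> and \<open>g\<close> imply that \<open>K = (J + \<delta>)\<^bsup>-1/2\<^esup> Z (J + \<delta>)\<^bsup>-1/2\<^esup>\<close> is a contraction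
  (\<open>norm_sandwich_le_one\<close>). A strict contraction, such as \<open>(1 - \<delta>) K\<close>, has a positive operator-valued Poisson kernel: there are
  positive \<open>A\<^sub>1, \<dots>, A\<^sub>N\<close> with average at most \<open>1\<close> and unimodular numbers \<open>w\<^sub>k\<close> such that the average of
  the \<open>w\<^sub>k A\<^sub>k\<close> is close to it (\<open>contraction_average\<close>). Each \<open>\<Phi>((J + \<delta>)\<^bsup>1/2\<^esup> A\<^sub>k (J + \<delta>)\<^bsup>1/2\<^esup>)\<close> is a positive
  operator and satisfies the arithmetic-geometric mean inequality for its quadratic form. Averaging
  and letting \<open>\<delta> \<rightarrow> 0\<close> gives the inequality (\<open>positive_map_block_positive\<close>).

  Let \<open>W = U |W|\<close> be the polar decomposition, with \<open>U\<close> in the von Neumann algebra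
  (\<open>von_neumann_polar_decomposition\<close>). Since \<open>|W| = U\<^sup>* W\<close>, replacing \<open>y\<close> by \<open>U y\<close> shows that the
  matrix with diagonal \<open>A, U\<^sup>* A U\<close> and off-diagonal entry \<open>|W|\<close> is positive. The geometric mean is the
  largest self-adjoint off-diagonal entry of this kind (\<open>geometric_mean_greatest\<close>), so
  \<open>|W| \<le> A # U\<^sup>* A U\<close>, and \<open>V = U\<^sup>*\<close> is the required partial isometry.

  The C*-algebraic background is developed from the axioms: the norm of a self-adjoint element is its
  spectral radius, which yields the continuous functional calculus, and positivity of \<open>x\<^sup>* x\<close>.\<close>

section \<open>Invertibility and spectra in C*-algebras\<close>

lemma scaleC_zero_left [simp]: "0 *\<^sub>C (x::'a::complex_vector) = 0"
  using scaleR_scaleC[of 0 x] by simp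

lemma scaleC_minus_left: "(- c) *\<^sub>C (x::'a::complex_vector) = - (c *\<^sub>C x)"
proof -
  have "(- c) *\<^sub>C x + c *\<^sub>C x = 0" by (simp flip: scaleC_add_left)
  then show ?thesis by (simp add: eq_neg_iff_add_eq_0)
qed

lemma scaleC_diff_left: "(c - d) *\<^sub>C (x::'a::complex_vector) = c *\<^sub>C x - d *\<^sub>C x"
  using scaleC_add_left[of c "- d" x] by (simp add: scaleC_minus_left)

lemma scaleC_sum_right: "c *\<^sub>C (\<Sum>i\<in>A. f i) = (\<Sum>i\<in>A. c *\<^sub>C (f i :: 'a::complex_vector))"
  by (induction A rule: infinite_finite_induct) (simp_all add: scaleC_zero_right scaleC_add_right)

lemma scaleC_sum_left: "(\<Sum>i\<in>A. f i) *\<^sub>C x = (\<Sum>i\<in>A. f i *\<^sub>C (x :: 'a::complex_vector))"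
  by (induction A rule: infinite_finite_induct) (simp_all add: scaleC_add_left)

lemma clinear_simps:
  assumes "clinear T"
  shows "T (x + y) = T x + T y" "T (c *\<^sub>C x) = c *\<^sub>C T x" "T (r *\<^sub>R x) = r *\<^sub>R T x"
    "T 0 = 0" "T (- x) = - T x" "T (x - y) = T x - T y"
proof -
  show a: "T (x + y) = T x + T y" for x y using assms by (simp add: clinear_def)
  show s: "T (c *\<^sub>C x) = c *\<^sub>C T x" for c x using assms by (simp add: clinear_def)
  show "T (r *\<^sub>R x) = r *\<^sub>R T x" by (simp add: scaleR_scaleC s)
  show "T 0 = 0" using s[of 0 0] by simp
  show m: "T (- x) = - T x" for x
    using s[of "- 1" x] by (simp add: scaleC_minus_left scaleC_one)
  show "T (x - y) = T x - T y" using a[of x "- y"] m[of y] by simp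
qed

lemma clinear_sum:
  assumes "clinear T"
  shows "T (\<Sum>i\<in>A. f i) = (\<Sum>i\<in>A. T (f i))"
  by (induction A rule: infinite_finite_induct) (simp_all add: clinear_simps[OF assms])

lemma star_zero [simp]: "star (0::'a::cstar_algebra) = 0"
  using star_add[of 0 "0::'a"] by simp

lemma star_minus [simp]: "star (- x) = - star (x::'a::cstar_algebra)"
  using star_add[of x "- x"] by (simp add: eq_neg_iff_add_eq_0 add.commute)

lemma star_diff: "star (x - y) = star x - star (y::'a::cstar_algebra)"
  using star_add[of x "- y"] by simp

lemma star_one [simp]: "star (1::'a::cstar_algebra) = 1"
  by (metis mult.left_neutral mult.right_neutral star_mult star_star)

lemma star_scaleR [simp]: "star (r *\<^sub>R x) = r *\<^sub>R star (x::'a::cstar_algebra)"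
  by (simp add: scaleR_scaleC star_scaleC)

lemma star_power: "star (x ^ n) = star (x::'a::cstar_algebra) ^ n"
  by (induction n) (simp_all add: star_mult power_commutes)

lemma star_sum: "star (\<Sum>i\<in>A. f i) = (\<Sum>i\<in>A. star (f i :: 'a::cstar_algebra))"
  by (induction A rule: infinite_finite_induct) (simp_all add: star_add)

lemma norm_star [simp]: "norm (star x) = norm (x::'a::cstar_algebra)"
proof -
  have "norm x \<le> norm (star x)" for x :: 'a
  proof (cases "norm x = 0")
    case False
    have "norm x * norm x \<le> norm (star x) * norm x"
      using cstar_identity[of x] norm_mult_ineq[of "star x" x] by (simp add: power2_eq_square)
    then show ?thesis using False by simp
  qed simp
  from this[of x] this[of "star x"] show ?thesis by (simp add: star_star)
qed

lemma norm_self_adjoint_sq: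
  assumes "star a = (a::'a::cstar_algebra)" shows "norm (a * a) = (norm a)\<^sup>2"
  using cstar_identity[of a] assms by simp

lemma norm_one_le: "norm (1::'a::cstar_algebra) \<le> 1"
proof -
  have "norm (1::'a) = (norm (1::'a))\<^sup>2" using cstar_identity[of "1::'a"] by simp
  then have "norm (1::'a) = 0 \<or> norm (1::'a) = 1" by (simp add: power2_eq_square)
  then show ?thesis by auto
qed

lemma norm_power_le: "norm ((x::'a::cstar_algebra) ^ n) \<le> norm x ^ n"
proof (induction n)
  case (Suc n)
  have "norm (x ^ Suc n) \<le> norm x * norm (x ^ n)" by (simp add: norm_mult_ineq)
  also have "\<dots> \<le> norm x * norm x ^ n" using Suc by (simp add: mult_left_mono)
  finally show ?case by simp
qed (simp add: norm_one_le)

lemma bounded_linear_star: "bounded_linear (star :: 'a::cstar_algebra \<Rightarrow> 'a)"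
  by (rule bounded_linear_intro[where K = 1]) (simp_all add: star_add)

lemmas tendsto_star = bounded_linear.tendsto[OF bounded_linear_star]

definition cstar_inverse :: "'a::cstar_algebra \<Rightarrow> 'a" where
  "cstar_inverse a = (THE b. a * b = 1 \<and> b * a = 1)"

lemma inverse_unique_cstar:
  fixes a :: "'a::monoid_mult"
  assumes "b * a = 1" "a * c = 1" shows "b = c"
  using assms by (metis mult.assoc mult.left_neutral mult.right_neutral)

lemma cstar_inverse:
  assumes "cstar_invertible a"
  shows "a * cstar_inverse a = 1" "cstar_inverse a * a = 1"
proof -
  obtain b where b: "a * b = 1" "b * a = 1" using assms by (auto simp: cstar_invertible_def)
  have "cstar_inverse a = b"
    unfolding cstar_inverse_def using b by (blast intro: the_equality inverse_unique_cstar)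
  then show "a * cstar_inverse a = 1" "cstar_inverse a * a = 1" using b by simp_all
qed

lemma cstar_invertibleI: "a * b = 1 \<Longrightarrow> b * a = 1 \<Longrightarrow> cstar_invertible a"
  by (auto simp: cstar_invertible_def)

lemma cstar_invertible_mult:
  assumes "cstar_invertible a" "cstar_invertible b"
  shows "cstar_invertible (a * b)"
proof (rule cstar_invertibleI)
  note i = cstar_inverse[OF assms(1)] cstar_inverse[OF assms(2)]
  show "a * b * (cstar_inverse b * cstar_inverse a) = 1"
    using i by (metis mult.assoc mult.right_neutral)
  show "cstar_inverse b * cstar_inverse a * (a * b) = 1"
    using i by (metis mult.assoc mult.right_neutral)
qed

lemma scaleC_mult_scaleC:
  "(c *\<^sub>C x) * (d *\<^sub>C y) = (c * d) *\<^sub>C (x * (y::'a::cstar_algebra))"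
  by (simp add: scaleC_mult_left scaleC_mult_right scaleC_scaleC mult.commute)

lemma cstar_invertible_scaleC_iff:
  assumes "c \<noteq> 0" shows "cstar_invertible (c *\<^sub>C a) \<longleftrightarrow> cstar_invertible (a::'a::cstar_algebra)"
proof -
  have *: "cstar_invertible (c *\<^sub>C a)" if "cstar_invertible a" "c \<noteq> 0" for c and a :: 'a
    using that cstar_inverse[of a]
    by (intro cstar_invertibleI[of _ "inverse c *\<^sub>C cstar_inverse a"])
      (simp_all add: scaleC_mult_scaleC scaleC_one)
  show ?thesis
    using *[of a c] *[of "c *\<^sub>C a" "inverse c"] assms by (auto simp: scaleC_scaleC scaleC_one)
qed

lemma cstar_invertible_minus_iff:
  "cstar_invertible (- a) \<longleftrightarrow> cstar_invertible (a::'a::cstar_algebra)"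
  using cstar_invertible_scaleC_iff[of "- 1" a] by (simp add: scaleC_minus_left scaleC_one)

lemma one_minus_mult_power_sum:
  fixes x :: "'a::cstar_algebra"
  shows "(1 - x) * (\<Sum>i<n. x ^ i) = 1 - x ^ n" "(\<Sum>i<n. x ^ i) * (1 - x) = 1 - x ^ n"
proof (induction n)
  case (Suc n)
  have c: "x ^ n * x = x * x ^ n" by (rule power_commutes)
  show "(1 - x) * (\<Sum>i<Suc n. x ^ i) = 1 - x ^ Suc n"
    using Suc(1) by (simp add: distrib_left left_diff_distrib)
  show "(\<Sum>i<Suc n. x ^ i) * (1 - x) = 1 - x ^ Suc n"
    by (simp only: sum.lessThan_Suc distrib_right Suc(2)) (simp add: right_diff_distrib c)
qed simp_all

text \<open>The inverse is the limit of the Neumann series.\<close>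

lemma cstar_invertible_one_minus:
  fixes x :: "'a::cstar_algebra"
  assumes "norm x < 1" shows "cstar_invertible (1 - x)"
proof -
  have "summable (\<lambda>n. x ^ n)"
    by (rule summable_comparison_test[OF _ summable_geometric[of "norm x"]])
      (use assms norm_power_le in auto)
  then obtain s where s: "(\<lambda>n. \<Sum>i<n. x ^ i) \<longlonglongrightarrow> s" by (auto simp: summable_def sums_def)
  have "(\<lambda>n. x ^ n) \<longlonglongrightarrow> 0"
    by (rule Lim_null_comparison[OF always_eventually[OF allI[OF norm_power_le]]])
      (use assms in \<open>simp add: LIMSEQ_power_zero\<close>)
  then have lim: "(\<lambda>n. 1 - x ^ n) \<longlonglongrightarrow> 1" using tendsto_diff[OF tendsto_const] by fastforce
  have "(1 - x) * s = 1"
    using tendsto_mult[OF tendsto_const s, of "1 - x"] lim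
    unfolding one_minus_mult_power_sum by (rule LIMSEQ_unique)
  moreover have "s * (1 - x) = 1"
    using tendsto_mult[OF s tendsto_const, of "1 - x"] lim
    unfolding one_minus_mult_power_sum by (rule LIMSEQ_unique)
  ultimately show ?thesis by (rule cstar_invertibleI)
qed

lemma cstar_invertible_perturb:
  fixes a b :: "'a::cstar_algebra"
  assumes "cstar_invertible a" "norm (cstar_inverse a) * norm (a - b) < 1"
  shows "cstar_invertible b"
proof -
  have "norm (cstar_inverse a * (a - b)) < 1"
    using norm_mult_ineq assms(2) by (rule le_less_trans)
  then have "cstar_invertible (a * (1 - cstar_inverse a * (a - b)))"
    using assms(1) cstar_invertible_mult cstar_invertible_one_minus by blast
  also have "a * (1 - cstar_inverse a * (a - b)) = b"
    using cstar_inverse[OF assms(1)] by (simp add: algebra_simps flip: mult.assoc)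
  finally show ?thesis .
qed

lemma cmod_spectrum_le:
  assumes "c \<in> spectrum (a::'a::cstar_algebra)" shows "cmod c \<le> norm a"
proof (rule ccontr)
  assume c: "\<not> cmod c \<le> norm a"
  then have c0: "c \<noteq> 0" by auto
  have "norm (inverse c *\<^sub>C a) < 1"
    using c by (simp add: norm_scaleC norm_inverse mult.commute divide_less_eq flip: divide_inverse)
  then have "cstar_invertible ((- c) *\<^sub>C (1 - inverse c *\<^sub>C a))"
    using c0 by (simp add: cstar_invertible_scaleC_iff cstar_invertible_one_minus)
  also have "(- c) *\<^sub>C (1 - inverse c *\<^sub>C a) = a - c *\<^sub>C 1"
    using c0 by (simp add: scaleC_diff_right scaleC_scaleC scaleC_minus_left scaleC_one)
  finally show False using assms by (simp add: spectrum_def)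
qed

lemma closed_spectrum: "closed (spectrum (a::'a::cstar_algebra))"
  unfolding closed_def open_dist
proof (intro ballI)
  fix c assume "c \<in> - spectrum a"
  then have inv: "cstar_invertible (a - c *\<^sub>C 1)" by (simp add: spectrum_def)
  define k where "k = norm (cstar_inverse (a - c *\<^sub>C 1)) + 1"
  have k: "k > 0" unfolding k_def by (simp add: add_nonneg_pos)
  have "d \<in> - spectrum a" if "dist d c < inverse k" for d
  proof -
    have "norm ((a - c *\<^sub>C 1) - (a - d *\<^sub>C 1)) = norm ((d - c) *\<^sub>C (1::'a))"
      by (simp add: scaleC_diff_left)
    also have "\<dots> \<le> cmod (d - c)" by (simp add: norm_scaleC norm_one_le mult_left_le)
    also have "\<dots> < inverse k" using that by (simp add: dist_norm)
    finally have "norm ((a - c *\<^sub>C 1) - (a - d *\<^sub>C 1)) < inverse k" .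
    then have "k * norm ((a - c *\<^sub>C 1) - (a - d *\<^sub>C 1)) < 1" using k by (simp add: field_simps)
    moreover have "norm (cstar_inverse (a - c *\<^sub>C 1)) * norm ((a - c *\<^sub>C 1) - (a - d *\<^sub>C 1))
        \<le> k * norm ((a - c *\<^sub>C 1) - (a - d *\<^sub>C 1))"
      by (rule mult_right_mono) (simp_all add: k_def)
    ultimately show ?thesis using cstar_invertible_perturb[OF inv] by (fastforce simp: spectrum_def)
  qed
  then show "\<exists>e>0. \<forall>d. dist d c < e \<longrightarrow> d \<in> - spectrum a" using k by (intro exI[of _ "inverse k"]) auto
qed

text \<open>A relation between the inverses of \<open>x y - c\<close> and \<open>y x - c\<close> shows that \<open>x y\<close> and \<open>y x\<close> have the
  same nonzero spectrum.\<close>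

lemma spectrum_mult_commute:
  fixes x y :: "'a::cstar_algebra"
  assumes "c \<in> spectrum (x * y)" "c \<noteq> 0" shows "c \<in> spectrum (y * x)"
proof (rule ccontr)
  assume "c \<notin> spectrum (y * x)"
  then have inv: "cstar_invertible (y * x - c *\<^sub>C 1)" by (simp add: spectrum_def)
  define u where "u = cstar_inverse (y * x - c *\<^sub>C 1)"
  have u1: "y * (x * u) = 1 + c *\<^sub>C u" and u2: "u * (y * x) = 1 + c *\<^sub>C u"
    using cstar_inverse[OF inv, folded u_def]
    by (simp_all add: algebra_simps scaleC_mult_left scaleC_mult_right)
  \<comment> \<open>With \<open>u = (y x - c)\<inverse>\<close>, the inverse of \<open>x y - c\<close> is \<open>(x u y - 1) / c\<close>.\<close>
  define v where "v = inverse c *\<^sub>C (x * u * y - 1)"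
  have m: "x * y * (x * u * y) = x * y + c *\<^sub>C (x * u * y)"
  proof -
    have "x * y * (x * u * y) = x * (y * (x * u)) * y" by (simp add: mult.assoc)
    then show ?thesis by (simp add: u1 algebra_simps scaleC_mult_left scaleC_mult_right)
  qed
  have m': "x * u * y * (x * y) = x * y + c *\<^sub>C (x * u * y)"
  proof -
    have "x * u * y * (x * y) = x * (u * (y * x)) * y" by (simp add: mult.assoc)
    then show ?thesis by (simp add: u2 algebra_simps scaleC_mult_left scaleC_mult_right)
  qed
  have "(x * y - c *\<^sub>C 1) * v = 1" "v * (x * y - c *\<^sub>C 1) = 1"
    using assms(2)
    by (simp_all add: v_def scaleC_mult_left scaleC_mult_right left_diff_distrib right_diff_distrib
        m m' scaleC_diff_right scaleC_scaleC scaleC_one scaleC_add_right)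
  then show False using assms(1) by (auto simp: spectrum_def cstar_invertible_def)
qed

lemma sum_roots_of_unity:
  fixes m :: int and N :: nat
  assumes "N > 0"
  shows "(\<Sum>k<N. cis (2 * pi * real k * real_of_int m / real N)) = (if int N dvd m then of_nat N else 0)"
proof -
  define w where "w = cis (2 * pi * real_of_int m / real N)"
  have w: "cis (2 * pi * real k * real_of_int m / real N) = w ^ k" for k
    unfolding w_def by (subst Complex.DeMoivre) (simp add: mult_ac)
  have wN: "w ^ N = 1"
  proof -
    have "real N * (2 * pi * real_of_int m / real N) = 2 * pi * real_of_int m" using assms by simp
    then show ?thesis by (simp only: w_def Complex.DeMoivre) simp
  qed
  show ?thesis
  proof (cases "int N dvd m")
    case True
    then obtain j where "m = int N * j" by blast
    then have "2 * pi * real_of_int m / real N = 2 * pi * real_of_int j" using assms by simp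
    then have "w = 1" by (simp only: w_def) simp
    then show ?thesis using True unfolding w by simp
  next
    case False
    have "w \<noteq> 1"
    proof
      assume "w = 1"
      then have "cos (2 * pi * real_of_int m / real N) = 1" by (simp add: w_def complex_eq_iff)
      then obtain j :: int where "2 * pi * real_of_int m / real N = of_int j * 2 * pi"
        using cos_one_2pi_int by blast
      then have "real_of_int m = real_of_int (int N * j)" using assms by (simp add: field_simps)
      then have "m = int N * j" by (simp only: of_int_eq_iff)
      then show False using False by simp
    qed
    then show ?thesis using False wN unfolding w by (simp add: geometric_sum)
  qed
qed

text \<open>The inverses satisfy \<open>y\<inverse> - x\<inverse> = y\<inverse> (x - y) x\<inverse>\<close>, and the closeness of \<open>x\<close> and \<open>y\<close> gives
  \<open>\<parallel>y\<inverse>\<parallel> \<le> 2 \<parallel>x\<inverse>\<parallel>\<close>.\<close>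

lemma cstar_inverse_diff_le:
  fixes x y :: "'a::cstar_algebra"
  assumes "cstar_invertible x" "cstar_invertible y" "norm (cstar_inverse x) * norm (x - y) \<le> 1/2"
  shows "norm (cstar_inverse y - cstar_inverse x) \<le> 2 * (norm (cstar_inverse x))\<^sup>2 * norm (x - y)"
proof -
  let ?X = "cstar_inverse x" and ?Y = "cstar_inverse y"
  have eq: "?Y - ?X = ?Y * (x - y) * ?X"
    using cstar_inverse[OF assms(1)] cstar_inverse[OF assms(2)]
    by (simp add: algebra_simps)
  have le: "norm (?Y - ?X) \<le> norm ?Y * (norm ?X * norm (x - y))"
    unfolding eq using norm_mult_ineq[of "?Y * (x - y)" ?X]
      mult_right_mono[OF norm_mult_ineq[of ?Y "x - y"], of "norm ?X"] by (simp add: mult_ac)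
  also have "\<dots> \<le> norm ?Y * (1/2)" using assms(3) by (intro mult_left_mono) auto
  finally have "norm (?Y - ?X) \<le> norm ?Y / 2" by simp
  then have "norm ?Y \<le> 2 * norm ?X" using norm_triangle_sub[of ?Y ?X] by linarith
  then have "norm ?Y * (norm ?X * norm (x - y)) \<le> (2 * norm ?X) * (norm ?X * norm (x - y))"
    by (intro mult_right_mono) auto
  with le show ?thesis by (simp add: power2_eq_square mult_ac)
qed

lemma continuous_on_cstar_inverse:
  "continuous_on {x::'a::cstar_algebra. cstar_invertible x} cstar_inverse"
  unfolding continuous_on_def
proof
  fix x :: 'a assume "x \<in> {x. cstar_invertible x}"
  then have x: "cstar_invertible x" by simp
  let ?F = "at x within {x. cstar_invertible x}" and ?k = "norm (cstar_inverse x)"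
  have t: "((\<lambda>y. norm (x - y)) \<longlongrightarrow> 0) ?F"
    by (rule tendsto_eq_intros | simp)+
  have "((\<lambda>y. ?k * norm (x - y)) \<longlongrightarrow> 0) ?F" using tendsto_mult_right_zero[OF t] .
  then have "\<forall>\<^sub>F y in ?F. ?k * norm (x - y) < 1/2" by (rule order_tendstoD) simp
  moreover have "\<forall>\<^sub>F y in ?F. cstar_invertible y"
    by (simp add: eventually_at_filter)
  ultimately have "\<forall>\<^sub>F y in ?F. norm (cstar_inverse y - cstar_inverse x) \<le> 2 * ?k\<^sup>2 * norm (x - y)"
    by eventually_elim (use x in \<open>simp add: cstar_inverse_diff_le\<close>)
  then have "((\<lambda>y. cstar_inverse y - cstar_inverse x) \<longlongrightarrow> 0) ?F"
    by (rule Lim_null_comparison) (rule tendsto_mult_right_zero[OF t])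
  then show "(cstar_inverse \<longlongrightarrow> cstar_inverse x) ?F" by (simp add: LIM_zero_iff)
qed

lemma norm_self_adjoint_power2:
  fixes a :: "'a::cstar_algebra"
  assumes "star a = a" shows "norm (a ^ (2 ^ m)) = norm a ^ (2 ^ m)"
proof (induction m)
  case (Suc m)
  have "norm (a ^ (2 ^ Suc m)) = norm (a ^ (2 ^ m) * a ^ (2 ^ m))" by (simp flip: power_add add: mult_2)
  also have "\<dots> = (norm (a ^ (2 ^ m)))\<^sup>2" by (rule norm_self_adjoint_sq) (simp add: star_power assms)
  finally show ?case by (simp add: Suc flip: power_mult) (simp add: mult.commute)
qed simp

text \<open>Averaging the resolvents \<open>(1 - \<omega> z a)\<inverse>\<close> over the \<open>N\<close>-th roots of unity \<open>\<omega>\<close> gives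
  \<open>(1 - z\<^sup>N a\<^sup>N)\<inverse>\<close>: multiplied by \<open>1 - z\<^sup>N a\<^sup>N\<close>, each resolvent becomes a finite geometric sum in \<open>\<omega>\<close>,
  and only its constant term survives the averaging.\<close>

lemma resolvent_average:
  fixes a :: "'a::cstar_algebra"
  assumes "N > 0" and inv: "\<And>k. k < N \<Longrightarrow> cstar_invertible (1 - (cis (2 * pi * real k / real N) * z) *\<^sub>C a)"
  shows "((1 / real N) *\<^sub>R (\<Sum>k<N. cstar_inverse (1 - (cis (2 * pi * real k / real N) * z) *\<^sub>C a)))
           * (1 - (z *\<^sub>C a) ^ N) = 1"
proof -
  define b where "b = z *\<^sub>C a"
  define w where "w k = cis (2 * pi * real k / real N)" for k
  have pow: "(c *\<^sub>C x) ^ n = c ^ n *\<^sub>C x ^ n" for c n and x :: 'a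
    by (induction n) (simp_all add: scaleC_one scaleC_mult_scaleC)
  have wb: "(w k * z) *\<^sub>C a = w k *\<^sub>C b" for k by (simp add: b_def scaleC_scaleC)
  have wN: "w k ^ N = 1" for k
  proof -
    have "real N * (2 * pi * real k / real N) = 2 * pi * real k" using assms by simp
    then show ?thesis by (simp only: w_def Complex.DeMoivre) simp
  qed
  have sw: "(\<Sum>k<N. w k ^ n) = (if n = 0 then of_nat N else 0)" if "n < N" for n
  proof -
    have "int N dvd int n \<longleftrightarrow> n = 0" using that by (auto dest: nat_dvd_not_less)
    moreover have "w k ^ n = cis (2 * pi * real k * real_of_int (int n) / real N)" for k
      unfolding w_def by (subst Complex.DeMoivre) (simp add: mult_ac)
    ultimately show ?thesis using sum_roots_of_unity[OF assms(1), of "int n"] by simp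
  qed
  have S: "cstar_inverse (1 - w k *\<^sub>C b) * (1 - b ^ N) = (\<Sum>n<N. (w k *\<^sub>C b) ^ n)" if "k < N" for k
  proof -
    have i: "cstar_inverse (1 - w k *\<^sub>C b) * (1 - w k *\<^sub>C b) = 1"
      using cstar_inverse(2) inv[OF that, folded w_def] by (simp add: wb)
    have "1 - b ^ N = 1 - (w k *\<^sub>C b) ^ N" by (simp add: pow wN scaleC_one)
    also have "\<dots> = (1 - w k *\<^sub>C b) * (\<Sum>n<N. (w k *\<^sub>C b) ^ n)"
      by (simp add: one_minus_mult_power_sum)
    finally show ?thesis by (simp add: i flip: mult.assoc)
  qed
  have "(\<Sum>k<N. cstar_inverse (1 - w k *\<^sub>C b)) * (1 - b ^ N) = (\<Sum>k<N. \<Sum>n<N. (w k *\<^sub>C b) ^ n)"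
    by (simp add: sum_distrib_right S)
  also have "\<dots> = (\<Sum>n<N. (\<Sum>k<N. w k ^ n) *\<^sub>C b ^ n)"
    by (subst sum.swap) (simp add: pow scaleC_sum_left)
  also have "\<dots> = (\<Sum>n<N. if n = 0 then of_nat N *\<^sub>C (1::'a) else 0)"
    by (rule sum.cong) (auto simp: sw)
  also have "\<dots> = of_nat N *\<^sub>C 1" using assms(1) by simp
  finally have "(\<Sum>k<N. cstar_inverse (1 - w k *\<^sub>C b)) * (1 - b ^ N) = real N *\<^sub>R 1"
    by (simp add: scaleR_scaleC)
  then show ?thesis using assms(1) by (simp add: wb[unfolded w_def] w_def b_def)
qed

text \<open>The norm of a self-adjoint element is its spectral radius. The argument avoids analytic functions
  with values in the algebra. Let \<open>b = a / \<parallel>a\<parallel>\<close>. If no spectral value had modulus \<open>\<parallel>a\<parallel>\<close>, then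
  \<open>z \<mapsto> (1 - z b)\<inverse>\<close> would be uniformly continuous on the closed unit disc. Its averages over roots of
  unity, the maps \<open>z \<mapsto> (1 - z\<^sup>N b\<^sup>N)\<inverse>\<close>, have the same modulus of continuity for every \<open>N\<close>. For a fixed
  \<open>t < 1\<close> close to \<open>1\<close> and large \<open>N\<close> their value at \<open>t\<close> is close to \<open>1\<close>, hence so is their value at
  \<open>1\<close>, and \<open>b\<^sup>N\<close> is small. But \<open>\<parallel>b\<^sup>N\<parallel> = 1\<close> if \<open>N\<close> is a power of \<open>2\<close>.\<close>

lemma self_adjoint_spectral_radius:
  fixes a :: "'a::cstar_algebra"
  assumes sa: "star a = a" and nz: "a \<noteq> 0"
  shows "\<exists>c\<in>spectrum a. cmod c = norm a"
proof (rule ccontr)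
  assume contra: "\<not> ?thesis"
  define b where "b = inverse (norm a) *\<^sub>R a"
  have nb: "norm b = 1" using nz by (simp add: b_def)
  have sb: "star b = b" by (simp add: b_def sa)
  have inv: "cstar_invertible (1 - z *\<^sub>C b)" if z: "cmod z \<le> 1" for z
  proof (cases "cmod z < 1")
    case True
    then show ?thesis by (intro cstar_invertible_one_minus) (simp add: norm_scaleC nb)
  next
    case False
    then have z1: "cmod z = 1" and z0: "z \<noteq> 0" using z by auto
    define c where "c = complex_of_real (norm a) * inverse z"
    have "cmod c = norm a" by (simp add: c_def norm_mult norm_inverse z1)
    then have "cstar_invertible (a - c *\<^sub>C 1)" using contra by (auto simp: spectrum_def)
    then have "cstar_invertible ((- z * complex_of_real (inverse (norm a))) *\<^sub>C (a - c *\<^sub>C 1))"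
      using z0 nz by (simp add: cstar_invertible_scaleC_iff)
    also have "(- z * complex_of_real (inverse (norm a))) *\<^sub>C (a - c *\<^sub>C 1) = 1 - z *\<^sub>C b"
    proof -
      have "(- z * complex_of_real (inverse (norm a))) * c = - 1"
      proof -
        have f: "complex_of_real (inverse (norm a)) * (complex_of_real (norm a) * y) = y" for y
        proof -
          have "complex_of_real (inverse (norm a)) * complex_of_real (norm a) = 1"
            using nz by (simp flip: of_real_mult)
          then show ?thesis by (metis mult.assoc mult_1)
        qed
        show ?thesis unfolding c_def mult.assoc f using z0 by simp
      qed
      then show ?thesis
        unfolding scaleC_diff_right scaleC_scaleC
        by (simp add: b_def scaleR_scaleC scaleC_scaleC scaleC_minus_left scaleC_one)
    qed
    finally show ?thesis .
  qed
  define R where "R z = cstar_inverse (1 - z *\<^sub>C b)" for z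
  have "continuous_on (cball 0 1) (\<lambda>z. 1 - z *\<^sub>C b)"
  proof -
    have "bounded_linear (\<lambda>z. z *\<^sub>C b)"
      by (rule bounded_linear_intro[where K = "norm b"])
        (simp_all add: scaleC_add_left norm_scaleC scaleR_scaleC scaleC_scaleC scaleR_conv_of_real)
    then show ?thesis by (rule continuous_on_diff[OF continuous_on_const linear_continuous_on])
  qed
  then have contR: "continuous_on (cball 0 1) R"
    unfolding R_def by (rule continuous_on_compose2[OF continuous_on_cstar_inverse]) (auto simp: inv)
  have "uniformly_continuous_on (cball 0 1) R"
    by (rule compact_uniformly_continuous[OF contR]) simp
  then obtain d where d: "d > 0"
    "\<And>z z'. z \<in> cball 0 1 \<Longrightarrow> z' \<in> cball 0 1 \<Longrightarrow> dist z' z < d \<Longrightarrow> dist (R z') (R z) < 1/8"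
    unfolding uniformly_continuous_on_def by (meson zero_less_divide_1_iff zero_less_numeral)
  have "compact (R ` cball 0 1)" by (rule compact_continuous_image[OF contR]) simp
  then obtain C where C: "C > 0" "\<And>z. z \<in> cball 0 1 \<Longrightarrow> norm (R z) \<le> C"
    using compact_imp_bounded[THEN bounded_pos[THEN iffD1]] by (metis image_eqI)
  define t where "t = max 0 (1 - d / 2)"
  have t: "0 \<le> t" "t < 1" "1 - t < d" using d(1) by (auto simp: t_def)
  obtain N0 where N0: "t ^ N0 < 1 / (8 * C)"
    using real_arch_pow_inv[of "1 / (8 * C)" t] C(1) t(2) by auto
  \<comment> \<open>A power of two beyond \<open>N0\<close>, where \<open>\<parallel>b\<^sup>N\<parallel> = \<parallel>b\<parallel>\<^sup>N\<close> is available.\<close>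
  define N where "N = (2::nat) ^ N0"
  have N: "N > 0" "N0 \<le> N" by (simp_all add: N_def less_imp_le)
  have tN: "t ^ N < 1 / (8 * C)" using power_decreasing[OF N(2) t(1)] t(2) N0 by simp
  have nbN: "norm (b ^ N) = 1" using norm_self_adjoint_power2[OF sb, of N0] by (simp add: N_def nb)
  define w where "w k = cis (2 * pi * real k / real N)" for k
  have cw: "cmod (w k) = 1" for k by (simp add: w_def)
  define M where "M z = (1 / real N) *\<^sub>R (\<Sum>k<N. R (w k * z))" for z
  have M: "M z * (1 - (z *\<^sub>C b) ^ N) = 1" if "cmod z \<le> 1" for z
    unfolding M_def R_def w_def
    by (rule resolvent_average[OF N(1)], rule inv) (use that in \<open>simp add: norm_mult\<close>)
  have Mt: "norm (M (of_real t)) \<le> C"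
  proof -
    have "norm (\<Sum>k<N. R (w k * of_real t)) \<le> (\<Sum>k<N. C)"
      using t by (intro sum_norm_le C(2)) (simp add: norm_mult cw)
    then have "norm (\<Sum>k<N. R (w k * of_real t)) \<le> C * real N" by (simp add: mult.commute)
    then show ?thesis using N(1) by (simp add: M_def pos_divide_le_eq)
  qed
  have Md: "norm (M 1 - M (of_real t)) \<le> 1/8"
  proof -
    have "norm (\<Sum>k<N. R (w k * 1) - R (w k * of_real t)) \<le> (\<Sum>k<N. 1/8)"
    proof (rule sum_norm_le)
      fix k
      have "cmod (w k - w k * of_real t) = \<bar>1 - t\<bar>"
        by (metis cw mult.right_neutral mult_1 norm_mult norm_of_real of_real_1 of_real_diff right_diff_distrib)
      then have "dist (R (w k * 1)) (R (w k * of_real t)) < 1/8"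
        using t by (intro d(2)) (simp_all add: norm_mult cw dist_norm)
      then show "norm (R (w k * 1) - R (w k * of_real t)) \<le> 1/8" by (simp add: dist_norm)
    qed
    then have "norm ((\<Sum>k<N. R (w k * 1)) - (\<Sum>k<N. R (w k * of_real t))) \<le> real N / 8"
      by (simp add: sum_subtractf)
    then show ?thesis using N(1) unfolding M_def by (simp add: pos_divide_le_eq flip: scaleR_diff_right)
  qed
  have "M (of_real t) - 1 = M (of_real t) * (of_real t *\<^sub>C b) ^ N"
    using M[of "of_real t"] t by (simp add: right_diff_distrib algebra_simps)
  moreover have "norm ((of_real t *\<^sub>C b) ^ N) \<le> t ^ N"
    using norm_power_le[of "of_real t *\<^sub>C b" N] t by (simp add: norm_scaleC nb)
  ultimately have "norm (M (of_real t) - 1) \<le> C * t ^ N"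
    using norm_mult_ineq[of "M (of_real t)" "(of_real t *\<^sub>C b) ^ N"] mult_mono[OF Mt] C(1) by fastforce
  also have "\<dots> \<le> 1/8" using tN C(1) by (simp add: field_simps)
  finally have "norm (M 1 - 1) \<le> 1/4" using Md norm_triangle_ineq[of "M 1 - M (of_real t)" "M (of_real t) - 1"] by simp
  moreover have "(M 1 - 1) * (1 - b ^ N) = b ^ N"
    using M[of 1] by (simp add: left_diff_distrib scaleC_one)
  moreover have "norm (1 - b ^ N) \<le> 2"
    using norm_triangle_ineq4[of 1 "b ^ N"] norm_one_le[where 'a='a] nbN by simp
  ultimately have "norm (b ^ N) \<le> 1/4 * 2"
    using norm_mult_ineq[of "M 1 - 1" "1 - b ^ N"] mult_mono[of "norm (M 1 - 1)" "1/4" "norm (1 - b ^ N)" 2] by simp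
  then show False using nbN by simp
qed

lemma self_adjoint_spectrum_real:
  fixes a :: "'a::cstar_algebra"
  assumes sa: "star a = a" and c: "c \<in> spectrum a"
  shows "Im c = 0"
proof -
  \<comment> \<open>Shifting by \<open>i t\<close> bounds \<open>(Im c + t)\<^sup>2\<close> by \<open>\<parallel>a\<parallel>\<^sup>2 + t\<^sup>2\<close> for every real \<open>t\<close>.\<close>
  have it2: "(\<i> * complex_of_real t) * (\<i> * complex_of_real t) = - (of_real t * of_real t)" for t
    by (simp add: complex_eq_iff)
  have bound: "2 * Im c * t \<le> (norm a)\<^sup>2" for t :: real
  proof -
    define b where "b = a + (\<i> * of_real t) *\<^sub>C 1"
    have "c + \<i> * of_real t \<in> spectrum b"
      using c by (simp add: spectrum_def b_def scaleC_add_left algebra_simps)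
    then have "(cmod (c + \<i> * of_real t))\<^sup>2 \<le> (norm b)\<^sup>2"
      using cmod_spectrum_le by (intro power_mono) auto
    also have "\<dots> = norm (star b * b)" by (simp add: cstar_identity)
    also have "star b * b = a * a + (t\<^sup>2) *\<^sub>R 1"
      by (simp add: b_def star_add star_scaleC sa distrib_left distrib_right scaleC_mult_left
          scaleC_mult_right scaleC_scaleC scaleR_scaleC scaleC_minus_left power2_eq_square
          scaleC_diff_right scaleC_add_right left_diff_distrib it2)
    also have "norm \<dots> \<le> (norm a)\<^sup>2 + t\<^sup>2"
    proof -
      have "norm (a * a + (t\<^sup>2) *\<^sub>R 1) \<le> norm (a * a) + t\<^sup>2 * norm (1::'a)"
        by (rule order_trans[OF norm_triangle_ineq]) simp
      also have "\<dots> \<le> norm (a * a) + t\<^sup>2" by (simp add: mult_left_le norm_one_le)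
      finally show ?thesis using norm_self_adjoint_sq[OF sa] by simp
    qed
    finally have "(Re c)\<^sup>2 + (Im c + t)\<^sup>2 \<le> (norm a)\<^sup>2 + t\<^sup>2" by (simp add: cmod_power2)
    moreover have "(Im c + t)\<^sup>2 = (Im c)\<^sup>2 + 2 * Im c * t + t\<^sup>2" by (simp add: power2_sum)
    ultimately show ?thesis using zero_le_power2[of "Re c"] zero_le_power2[of "Im c"] by linarith
  qed
  show ?thesis
  proof (rule ccontr)
    assume "Im c \<noteq> 0"
    then have "2 * Im c * (((norm a)\<^sup>2 + 1) / (2 * Im c)) = (norm a)\<^sup>2 + 1" by simp
    then show False using bound[of "((norm a)\<^sup>2 + 1) / (2 * Im c)"] by linarith
  qed
qed

section \<open>The continuous functional calculus\<close>

definition real_spectrum :: "'a::cstar_algebra \<Rightarrow> real set" where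
  "real_spectrum a = {t. complex_of_real t \<in> spectrum a}"

lemma abs_real_spectrum_le: "t \<in> real_spectrum (a::'a::cstar_algebra) \<Longrightarrow> \<bar>t\<bar> \<le> norm a"
  using cmod_spectrum_le[of "complex_of_real t" a] by (simp add: real_spectrum_def)

lemma compact_real_spectrum: "compact (real_spectrum (a::'a::cstar_algebra))"
proof -
  have "closed (of_real -` spectrum a :: real set)"
    by (rule continuous_closed_vimage[OF closed_spectrum]) (simp add: isCont_def tendsto_of_real)
  moreover have "of_real -` spectrum a = real_spectrum a" by (auto simp: real_spectrum_def)
  moreover have "bounded (real_spectrum a)"
    unfolding bounded_iff using abs_real_spectrum_le by fastforce
  ultimately show ?thesis by (simp add: compact_eq_bounded_closed)
qed

lemma spectrum_self_adjoint:
  assumes "star a = (a::'a::cstar_algebra)" "c \<in> spectrum a"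
  shows "c = complex_of_real (Re c)" "Re c \<in> real_spectrum a"
proof -
  show "c = complex_of_real (Re c)"
    using self_adjoint_spectrum_real[OF assms] by (simp add: complex_eq_iff)
  then show "Re c \<in> real_spectrum a" using assms(2) by (simp add: real_spectrum_def)
qed

lemma cstar_positive_iff:
  "cstar_positive a \<longleftrightarrow> star a = (a::'a::cstar_algebra) \<and> (\<forall>t\<in>real_spectrum a. 0 \<le> t)"
proof (cases "star a = a")
  case True
  have "spectrum a \<subseteq> \<real>\<^sub>\<ge>\<^sub>0 \<longleftrightarrow> (\<forall>t\<in>real_spectrum a. 0 \<le> t)"
  proof
    assume "spectrum a \<subseteq> \<real>\<^sub>\<ge>\<^sub>0"
    then show "\<forall>t\<in>real_spectrum a. 0 \<le> t" by (force simp: real_spectrum_def)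
  next
    assume nn: "\<forall>t\<in>real_spectrum a. 0 \<le> t"
    show "spectrum a \<subseteq> \<real>\<^sub>\<ge>\<^sub>0"
    proof
      fix c assume "c \<in> spectrum a"
      from spectrum_self_adjoint[OF True this] nn show "c \<in> \<real>\<^sub>\<ge>\<^sub>0"
        by (metis nonneg_Reals_of_real_iff)
    qed
  qed
  then show ?thesis by (simp add: cstar_positive_def True)
qed (simp add: cstar_positive_def)

lemma real_spectrum_norm_attained:
  assumes "star a = (a::'a::cstar_algebra)" "a \<noteq> 0"
  shows "\<exists>t\<in>real_spectrum a. \<bar>t\<bar> = norm a"
  using self_adjoint_spectral_radius[OF assms] spectrum_self_adjoint[OF assms(1)]
  by (metis norm_of_real real_norm_def)

lemma norm_le_of_real_spectrum:
  assumes "star a = (a::'a::cstar_algebra)" "0 \<le> s" "\<And>t. t \<in> real_spectrum a \<Longrightarrow> \<bar>t\<bar> \<le> s"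
  shows "norm a \<le> s"
  using real_spectrum_norm_attained[OF assms(1)] assms(2,3) by (cases "a = 0") force+

lemma real_spectrum_nonempty:
  assumes "star a = (a::'a::cstar_algebra)" "(1::'a) \<noteq> 0"
  shows "real_spectrum a \<noteq> {}"
proof (cases "a = 0")
  case True
  have "0 \<in> real_spectrum a"
    using assms(2) True by (auto simp: real_spectrum_def spectrum_def cstar_invertible_def)
  then show ?thesis by blast
next
  case False
  then show ?thesis using real_spectrum_norm_attained[OF assms(1)] by blast
qed

subsection \<open>Polynomials\<close>

definition cstar_cpoly :: "complex poly \<Rightarrow> 'a::cstar_algebra \<Rightarrow> 'a" where
  "cstar_cpoly p a = (\<Sum>i\<le>degree p. coeff p i *\<^sub>C a ^ i)"

lemma cstar_cpoly_eq:
  assumes "degree p \<le> n" shows "cstar_cpoly p a = (\<Sum>i\<le>n. coeff p i *\<^sub>C (a::'a::cstar_algebra) ^ i)"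
  unfolding cstar_cpoly_def
  by (rule sum.mono_neutral_left) (use assms in \<open>auto simp: coeff_eq_0\<close>)

lemma cstar_cpoly_add: "cstar_cpoly (p + q) a = cstar_cpoly p a + cstar_cpoly q (a::'a::cstar_algebra)"
proof -
  let ?n = "max (degree p) (degree q)"
  show ?thesis
    by (simp add: cstar_cpoly_eq[of _ ?n] degree_add_le_max scaleC_add_left sum.distrib)
qed

lemma cstar_cpoly_smult: "cstar_cpoly (smult c p) a = c *\<^sub>C cstar_cpoly p (a::'a::cstar_algebra)"
  using degree_smult_le[of c p]
  by (simp add: cstar_cpoly_eq[of _ "degree p"] scaleC_sum_right scaleC_scaleC)

lemma cstar_cpoly_0 [simp]: "cstar_cpoly 0 (a::'a::cstar_algebra) = 0"
  by (simp add: cstar_cpoly_def)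

lemma cstar_cpoly_pCons:
  "cstar_cpoly (pCons c p) a = c *\<^sub>C 1 + a * cstar_cpoly p (a::'a::cstar_algebra)"
proof -
  have "cstar_cpoly (pCons c p) a = (\<Sum>i\<le>Suc (degree p). coeff (pCons c p) i *\<^sub>C a ^ i)"
    by (rule cstar_cpoly_eq) (rule degree_pCons_le)
  then show ?thesis
    by (simp add: sum.atMost_Suc_shift cstar_cpoly_def sum_distrib_left scaleC_mult_right
        del: sum.atMost_Suc)
qed

lemma cstar_cpoly_mult: "cstar_cpoly (p * q) a = cstar_cpoly p a * cstar_cpoly q (a::'a::cstar_algebra)"
  by (induction p)
    (simp_all add: cstar_cpoly_pCons cstar_cpoly_add cstar_cpoly_smult scaleC_mult_left
      distrib_right mult.assoc)

lemma cstar_poly_0 [simp]: "cstar_poly 0 (a::'a::cstar_algebra) = 0"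
  by (simp add: cstar_poly_def)

lemma cstar_poly_pCons:
  "cstar_poly (pCons c p) a = c *\<^sub>R 1 + a * cstar_poly p (a::'a::cstar_algebra)"
proof (cases "p = 0")
  case False
  then show ?thesis
    by (simp add: cstar_poly_def sum.atMost_Suc_shift sum_distrib_left del: sum.atMost_Suc)
qed (simp add: cstar_poly_def)

lemma cstar_poly_add: "cstar_poly (p + q) a = cstar_poly p a + cstar_poly q (a::'a::cstar_algebra)"
  by (induction p q rule: poly_induct2) (simp_all add: cstar_poly_pCons scaleR_add_left distrib_left)

lemma cstar_poly_smult: "cstar_poly (smult c p) a = c *\<^sub>R cstar_poly p (a::'a::cstar_algebra)"
  by (induction p) (simp_all add: cstar_poly_pCons scaleR_add_right)

lemma cstar_poly_diff: "cstar_poly (p - q) a = cstar_poly p a - cstar_poly q (a::'a::cstar_algebra)"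
  using cstar_poly_add[of p "smult (- 1) q" a] cstar_poly_smult[of "- 1" q a] by simp

lemma cstar_poly_mult: "cstar_poly (p * q) a = cstar_poly p a * cstar_poly q (a::'a::cstar_algebra)"
  by (induction p)
    (simp_all add: cstar_poly_pCons cstar_poly_add cstar_poly_smult distrib_right mult.assoc)

lemma cstar_poly_complex:
  "cstar_poly p a = cstar_cpoly (map_poly complex_of_real p) (a::'a::cstar_algebra)"
  by (induction p) (simp_all add: cstar_poly_pCons cstar_cpoly_pCons map_poly_pCons scaleR_scaleC)

lemma poly_map_poly_of_real: "poly (map_poly complex_of_real p) (complex_of_real t) = complex_of_real (poly p t)"
  by (induction p) (simp_all add: map_poly_pCons)

lemma star_cstar_poly:
  assumes "star a = (a::'a::cstar_algebra)" shows "star (cstar_poly p a) = cstar_poly p a"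
  by (simp add: cstar_poly_def star_sum star_power assms)

lemma cstar_poly_intertwine:
  assumes "x * a = b * (x::'a::cstar_algebra)"
  shows "x * cstar_poly p a = cstar_poly p b * x"
proof -
  have "x * a ^ i = b ^ i * x" for i
  proof (induction i)
    case (Suc i)
    have "x * a ^ Suc i = b * (x * a ^ i)" by (simp add: assms flip: mult.assoc)
    then show ?case by (simp add: Suc mult.assoc)
  qed simp
  then show ?thesis by (simp add: cstar_poly_def sum_distrib_left sum_distrib_right)
qed

text \<open>Over the complex numbers a polynomial splits into linear factors \<open>x - z\<close>, so its value at \<open>a\<close>
  is a product of invertible elements \<open>a - z\<close> if no root lies in the spectrum.\<close>

lemma cstar_invertible_cpoly:
  fixes a :: "'a::cstar_algebra"
  assumes "q \<noteq> 0" "\<And>z. z \<in> spectrum a \<Longrightarrow> poly q z \<noteq> 0"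
  shows "cstar_invertible (cstar_cpoly q a)"
  using assms
proof (induction "degree q" arbitrary: q rule: less_induct)
  case less
  show ?case
  proof (cases "degree q = 0")
    case True
    then obtain c where q: "q = [:c:]" by (rule degree_eq_zeroE)
    then have "c \<noteq> 0" using less.prems(1) by simp
    moreover have "cstar_invertible (1::'a)" by (rule cstar_invertibleI[of _ 1]) simp_all
    ultimately show ?thesis by (simp add: q cstar_cpoly_pCons cstar_invertible_scaleC_iff)
  next
    case False
    then obtain z where z: "poly q z = 0"
      using fundamental_theorem_of_algebra constant_degree by metis
    then obtain r where r: "q = [:- z, 1:] * r" by (auto simp: poly_eq_0_iff_dvd)
    have r0: "r \<noteq> 0" using r less.prems(1) by auto
    have "z \<notin> spectrum a" using less.prems(2) z by blast
    then have "cstar_invertible (a - z *\<^sub>C 1)" by (simp add: spectrum_def)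
    moreover have "cstar_invertible (cstar_cpoly r a)"
    proof (rule less.hyps[OF _ r0])
      show "degree r < degree q" unfolding r using r0 by (subst degree_mult_eq) auto
      show "poly r w \<noteq> 0" if "w \<in> spectrum a" for w using less.prems(2)[OF that] by (auto simp: r)
    qed
    moreover have "cstar_cpoly q a = (a - z *\<^sub>C 1) * cstar_cpoly r a"
      unfolding r cstar_cpoly_mult
      by (simp add: cstar_cpoly_pCons scaleC_minus_left scaleC_one)
    ultimately show ?thesis by (simp add: cstar_invertible_mult)
  qed
qed

text \<open>If \<open>t\<close> is not a value of \<open>p\<close> on the spectrum, then \<open>p - t\<close> has no root there, so \<open>p(a) - t\<close> is
  invertible. A constant polynomial \<open>p = t\<close> is the exception: there nonemptiness of the spectrum is
  needed.\<close>

lemma real_spectrum_poly: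
  fixes a :: "'a::cstar_algebra"
  assumes sa: "star a = a" and t: "t \<in> real_spectrum (cstar_poly p a)"
  shows "t \<in> poly p ` real_spectrum a"
proof (rule ccontr)
  assume contra: "\<not> ?thesis"
  have ninv: "\<not> cstar_invertible (cstar_poly (p - [:t:]) a)"
    using t by (simp add: real_spectrum_def spectrum_def cstar_poly_diff cstar_poly_pCons scaleR_scaleC)
  show False
  proof (cases "p = [:t:]")
    case True
    have "(1::'a) \<noteq> 0"
    proof
      assume "(1::'a) = 0"
      then have "x = y" for x y :: 'a by (metis mult_zero_left mult_1)
      then show False using ninv by (auto simp: cstar_invertible_def)
    qed
    then show False using contra real_spectrum_nonempty[OF sa] True by auto
  next
    case False
    have "cstar_invertible (cstar_cpoly (map_poly complex_of_real (p - [:t:])) a)"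
    proof (rule cstar_invertible_cpoly)
      show "map_poly complex_of_real (p - [:t:]) \<noteq> 0"
        using False by (subst map_poly_eq_0_iff) auto
      fix z assume z: "z \<in> spectrum a"
      have "poly (p - [:t:]) (Re z) \<noteq> 0" using contra spectrum_self_adjoint(2)[OF sa z] by force
      then show "poly (map_poly complex_of_real (p - [:t:])) z \<noteq> 0"
        using spectrum_self_adjoint(1)[OF sa z] poly_map_poly_of_real[of "p - [:t:]" "Re z"]
        by (metis of_real_eq_0_iff)
    qed
    then show False using ninv by (simp add: cstar_poly_complex)
  qed
qed

lemma norm_cstar_poly_le:
  fixes a :: "'a::cstar_algebra"
  assumes "star a = a" "0 \<le> s" "\<And>t. t \<in> real_spectrum a \<Longrightarrow> \<bar>poly p t\<bar> \<le> s"
  shows "norm (cstar_poly p a) \<le> s"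
  using real_spectrum_poly[OF assms(1)] assms
  by (intro norm_le_of_real_spectrum star_cstar_poly) auto

subsection \<open>Continuous functions\<close>

lemma poly_uniform_approximation:
  fixes f :: "real \<Rightarrow> real"
  assumes "compact S" "continuous_on S f"
  shows "\<exists>p. uniform_limit S (\<lambda>n. poly (p n)) f sequentially"
proof -
  have "\<exists>p. \<forall>x\<in>S. \<bar>f x - poly p x\<bar> < e" if e: "e > 0" for e
  proof -
    obtain g where g: "real_polynomial_function g" "\<And>x. x \<in> S \<Longrightarrow> \<bar>f x - g x\<bar> < e"
      using Stone_Weierstrass_real_polynomial_function[OF assms e] by metis
    then obtain a n where "g = (\<lambda>x. \<Sum>i\<le>n. a i * x ^ i)"
      using real_polynomial_function_iff_sum by blast
    then have "g = poly (\<Sum>i\<le>n. monom (a i) i)"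
      by (auto simp: poly_sum poly_monom)
    then show ?thesis using g(2) by blast
  qed
  then have "\<forall>n. \<exists>p. \<forall>x\<in>S. \<bar>f x - poly p x\<bar> < inverse (real (Suc n))" by simp
  then obtain p where p: "\<And>n x. x \<in> S \<Longrightarrow> \<bar>f x - poly (p n) x\<bar> < inverse (real (Suc n))"
    by metis
  have "uniform_limit S (\<lambda>n. poly (p n)) f sequentially"
  proof (rule uniform_limitI)
    fix e :: real assume "e > 0"
    then have "\<forall>\<^sub>F n in sequentially. inverse (real (Suc n)) < e"
      using LIMSEQ_inverse_real_of_nat order_tendstoD(2) by blast
    then show "\<forall>\<^sub>F n in sequentially. \<forall>x\<in>S. dist (poly (p n) x) (f x) < e"
      by eventually_elim (metis p dist_real_def abs_minus_commute less_trans)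
  qed
  then show ?thesis by blast
qed

text \<open>Polynomials that converge uniformly on the spectrum have values that form a Cauchy sequence, by
  the estimate of \<open>\<parallel>p(a)\<parallel>\<close> through the spectrum. The same estimate, applied to the differences of two
  approximating sequences, shows that the limit depends on \<open>f\<close> only; this makes the description of
  \<open>f(a)\<close> in the definition unique.\<close>

lemma cfc_limit:
  fixes a :: "'a::cstar_algebra"
  assumes sa: "star a = a" and p: "uniform_limit (real_spectrum a) (\<lambda>n. poly (p n)) f sequentially"
  shows "(\<lambda>n. cstar_poly (p n) a) \<longlonglongrightarrow> cfc f a"
proof -
  have small: "\<forall>\<^sub>F n in sequentially. norm (cstar_poly (q n) a) \<le> e"
    if "uniform_limit (real_spectrum a) (\<lambda>n. poly (q n)) (\<lambda>_. 0) sequentially" "e > 0" for q and e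
    using uniform_limitD[OF that]
    by eventually_elim (rule norm_cstar_poly_le[OF sa], use \<open>e > 0\<close> in \<open>auto intro: less_imp_le\<close>)
  have "Cauchy (\<lambda>n. cstar_poly (p n) a)"
  proof (rule metric_CauchyI)
    fix e :: real assume e: "e > 0"
    then obtain N where N: "\<And>n t. n \<ge> N \<Longrightarrow> t \<in> real_spectrum a \<Longrightarrow> dist (poly (p n) t) (f t) < e / 3"
      using uniform_limitD[OF p, of "e / 3"] by (auto simp: eventually_sequentially)
    have "dist (cstar_poly (p m) a) (cstar_poly (p n) a) < e" if "m \<ge> N" "n \<ge> N" for m n
    proof -
      have "norm (cstar_poly (p m - p n) a) \<le> 2 * e / 3"
      proof (rule norm_cstar_poly_le[OF sa])
        fix t assume "t \<in> real_spectrum a"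
        then show "\<bar>poly (p m - p n) t\<bar> \<le> 2 * e / 3"
          using N[OF that(1), of t] N[OF that(2), of t] by (simp add: dist_real_def) argo
      qed (use e in simp)
      then show ?thesis using e by (simp add: cstar_poly_diff dist_norm)
    qed
    then show "\<exists>N. \<forall>m\<ge>N. \<forall>n\<ge>N. dist (cstar_poly (p m) a) (cstar_poly (p n) a) < e" by blast
  qed
  then obtain b where b: "(\<lambda>n. cstar_poly (p n) a) \<longlonglongrightarrow> b"
    using Cauchy_convergent_iff convergent_def by blast
  have "cfc f a = b"
    unfolding cfc_def real_spectrum_def[symmetric]
  proof (rule the_equality)
    show "\<exists>p. uniform_limit (real_spectrum a) (\<lambda>n. poly (p n)) f sequentially \<and> (\<lambda>n. cstar_poly (p n) a) \<longlonglongrightarrow> b"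
      using p b by blast
  next
    fix c assume "\<exists>q. uniform_limit (real_spectrum a) (\<lambda>n. poly (q n)) f sequentially \<and> (\<lambda>n. cstar_poly (q n) a) \<longlonglongrightarrow> c"
    then obtain q where q: "uniform_limit (real_spectrum a) (\<lambda>n. poly (q n)) f sequentially"
      and c: "(\<lambda>n. cstar_poly (q n) a) \<longlonglongrightarrow> c" by blast
    have "uniform_limit (real_spectrum a) (\<lambda>n. poly (q n - p n)) (\<lambda>_. 0) sequentially"
      using uniform_limit_minus[OF q p] by (simp add: poly_diff[abs_def])
    then have "\<forall>\<^sub>F n in sequentially. norm (cstar_poly (q n - p n) a) < e" if "e > 0" for e
      using small[of "\<lambda>n. q n - p n" "e / 2"] that by (auto elim: eventually_mono)
    then have "(\<lambda>n. cstar_poly (q n - p n) a) \<longlonglongrightarrow> 0" by (simp add: tendsto_iff)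
    moreover have "(\<lambda>n. cstar_poly (q n - p n) a) \<longlonglongrightarrow> c - b"
      unfolding cstar_poly_diff by (intro tendsto_diff b c)
    ultimately show "c = b" using LIMSEQ_unique by fastforce
  qed
  then show ?thesis using b by simp
qed

lemma cfc_approx:
  fixes a :: "'a::cstar_algebra"
  assumes "star a = a" "continuous_on (real_spectrum a) f"
  obtains p where "uniform_limit (real_spectrum a) (\<lambda>n. poly (p n)) f sequentially"
    "(\<lambda>n. cstar_poly (p n) a) \<longlonglongrightarrow> cfc f a"
  using poly_uniform_approximation[OF compact_real_spectrum assms(2)] cfc_limit[OF assms(1)] by blast

lemma cfc_cong:
  fixes a :: "'a::cstar_algebra"
  assumes "\<And>t. t \<in> real_spectrum a \<Longrightarrow> f t = g t" shows "cfc f a = cfc g a"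
proof -
  have "uniform_limit (real_spectrum a) p f sequentially \<longleftrightarrow> uniform_limit (real_spectrum a) p g sequentially" for p
    using assms by (intro uniform_limit_cong') auto
  then show ?thesis unfolding cfc_def real_spectrum_def[symmetric] by simp
qed

lemma cfc_poly: 
  fixes a :: "'a::cstar_algebra"
  assumes "star a = a" shows "cfc (poly p) a = cstar_poly p a"
  using cfc_limit[OF assms, of "\<lambda>_. p" "poly p"] LIMSEQ_unique tendsto_const
  by (metis uniform_limit_const)

lemma cfc_const:
  fixes a :: "'a::cstar_algebra"
  assumes "star a = a" shows "cfc (\<lambda>_. c) a = c *\<^sub>R 1"
proof -
  have "poly [:c:] = (\<lambda>_. c)" by auto
  then show ?thesis using cfc_poly[OF assms, of "[:c:]"] by (simp add: cstar_poly_pCons)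
qed

lemma cfc_ident:
  fixes a :: "'a::cstar_algebra"
  assumes "star a = a" shows "cfc (\<lambda>t. t) a = a"
proof -
  have "poly [:0, 1:] = (\<lambda>t::real. t)" by auto
  then show ?thesis using cfc_poly[OF assms, of "[:0, 1:]"] by (simp add: cstar_poly_pCons)
qed

lemma star_cfc:
  fixes a :: "'a::cstar_algebra"
  assumes sa: "star a = a" and f: "continuous_on (real_spectrum a) f"
  shows "star (cfc f a) = cfc f a"
proof -
  obtain p where "(\<lambda>n. cstar_poly (p n) a) \<longlonglongrightarrow> cfc f a" using cfc_approx[OF assms] by blast
  then show ?thesis using tendsto_star LIMSEQ_unique by (metis (no_types, lifting) LIMSEQ_unique ext star_cstar_poly[OF sa])
qed

lemma cfc_add:
  fixes a :: "'a::cstar_algebra"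
  assumes sa: "star a = a" and f: "continuous_on (real_spectrum a) f" and g: "continuous_on (real_spectrum a) g"
  shows "cfc (\<lambda>t. f t + g t) a = cfc f a + cfc g a"
proof -
  obtain p where p: "uniform_limit (real_spectrum a) (\<lambda>n. poly (p n)) f sequentially"
    "(\<lambda>n. cstar_poly (p n) a) \<longlonglongrightarrow> cfc f a" using cfc_approx[OF sa f] by blast
  obtain q where q: "uniform_limit (real_spectrum a) (\<lambda>n. poly (q n)) g sequentially"
    "(\<lambda>n. cstar_poly (q n) a) \<longlonglongrightarrow> cfc g a" using cfc_approx[OF sa g] by blast
  have "uniform_limit (real_spectrum a) (\<lambda>n. poly (p n + q n)) (\<lambda>t. f t + g t) sequentially"
    using uniform_limit_add[OF p(1) q(1)] by (simp add: poly_add[abs_def])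
  then have "(\<lambda>n. cstar_poly (p n) a + cstar_poly (q n) a) \<longlonglongrightarrow> cfc (\<lambda>t. f t + g t) a"
    using cfc_limit[OF sa, of "\<lambda>n. p n + q n"] by (simp add: cstar_poly_add)
  then show ?thesis using tendsto_add[OF p(2) q(2)] LIMSEQ_unique by blast
qed

lemma cfc_mult:
  fixes a :: "'a::cstar_algebra"
  assumes sa: "star a = a" and f: "continuous_on (real_spectrum a) f" and g: "continuous_on (real_spectrum a) g"
  shows "cfc (\<lambda>t. f t * g t) a = cfc f a * cfc g a"
proof -
  obtain p where p: "uniform_limit (real_spectrum a) (\<lambda>n. poly (p n)) f sequentially"
    "(\<lambda>n. cstar_poly (p n) a) \<longlonglongrightarrow> cfc f a" using cfc_approx[OF sa f] by blast
  obtain q where q: "uniform_limit (real_spectrum a) (\<lambda>n. poly (q n)) g sequentially"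
    "(\<lambda>n. cstar_poly (q n) a) \<longlonglongrightarrow> cfc g a" using cfc_approx[OF sa g] by blast
  have "bounded (f ` real_spectrum a)" "bounded (g ` real_spectrum a)"
    using f g compact_real_spectrum compact_continuous_image compact_imp_bounded by blast+
  then have "uniform_limit (real_spectrum a) (\<lambda>n. poly (p n * q n)) (\<lambda>t. f t * g t) sequentially"
    using uniform_lim_mult[OF p(1) q(1)] by (simp add: poly_mult[abs_def])
  then have "(\<lambda>n. cstar_poly (p n) a * cstar_poly (q n) a) \<longlonglongrightarrow> cfc (\<lambda>t. f t * g t) a"
    using cfc_limit[OF sa, of "\<lambda>n. p n * q n"] by (simp add: cstar_poly_mult)
  then show ?thesis using tendsto_mult[OF p(2) q(2)] LIMSEQ_unique by blast
qed

lemma cfc_scaleR: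
  fixes a :: "'a::cstar_algebra"
  assumes sa: "star a = a" and f: "continuous_on (real_spectrum a) f"
  shows "cfc (\<lambda>t. c * f t) a = c *\<^sub>R cfc f a"
  using cfc_mult[OF sa continuous_on_const f, of c] by (simp add: cfc_const[OF sa])

lemma cfc_diff:
  fixes a :: "'a::cstar_algebra"
  assumes sa: "star a = a" and f: "continuous_on (real_spectrum a) f" and g: "continuous_on (real_spectrum a) g"
  shows "cfc (\<lambda>t. f t - g t) a = cfc f a - cfc g a"
  using cfc_add[OF sa f, of "\<lambda>t. (- 1) * g t"] cfc_scaleR[OF sa g, of "- 1"] g
  by (simp add: continuous_on_minus)

text \<open>Uniform approximation on the union of both spectra reduces the claim to polynomials.\<close>

lemma cfc_intertwine:
  fixes a b x :: "'a::cstar_algebra"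
  assumes "star a = a" "star b = b" "x * a = b * x" "continuous_on (real_spectrum a \<union> real_spectrum b) f"
  shows "x * cfc f a = cfc f b * x"
proof -
  obtain p where p: "uniform_limit (real_spectrum a \<union> real_spectrum b) (\<lambda>n. poly (p n)) f sequentially"
    using poly_uniform_approximation[OF compact_Un[OF compact_real_spectrum compact_real_spectrum] assms(4)] by blast
  have "(\<lambda>n. cstar_poly (p n) a) \<longlonglongrightarrow> cfc f a" "(\<lambda>n. cstar_poly (p n) b) \<longlonglongrightarrow> cfc f b"
    using uniform_limit_on_subset[OF p] by (auto intro!: cfc_limit assms)
  then have "(\<lambda>n. x * cstar_poly (p n) a) \<longlonglongrightarrow> x * cfc f a" "(\<lambda>n. cstar_poly (p n) b * x) \<longlonglongrightarrow> cfc f b * x"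
    by (auto intro: tendsto_intros)
  then show ?thesis unfolding cstar_poly_intertwine[OF assms(3)] using LIMSEQ_unique by blast
qed

text \<open>If \<open>t\<close> is not a value of \<open>f\<close> on the spectrum, then \<open>1 / (f - t)\<close> is continuous there and
  provides the inverse of \<open>f(a) - t\<close>.\<close>

lemma real_spectrum_cfc:
  fixes a :: "'a::cstar_algebra"
  assumes sa: "star a = a" and f: "continuous_on (real_spectrum a) f"
  shows "real_spectrum (cfc f a) \<subseteq> f ` real_spectrum a"
proof (rule ccontr)
  assume "\<not> ?thesis"
  then obtain t where t: "t \<in> real_spectrum (cfc f a)" "\<And>s. s \<in> real_spectrum a \<Longrightarrow> f s \<noteq> t" by blast
  define h where "h s = 1 / (f s - t)" for s
  have cont: "continuous_on (real_spectrum a) (\<lambda>s. f s - t)" "continuous_on (real_spectrum a) h"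
    unfolding h_def using t(2) by (auto intro!: continuous_intros f)
  have "cfc (\<lambda>s. (f s - t) * h s) a = 1"
    using cfc_cong[of a "\<lambda>s. (f s - t) * h s" "\<lambda>_. 1"] t(2) cfc_const[OF sa, of 1] by (simp add: h_def)
  moreover have "cfc (\<lambda>s. (f s - t) * h s) a = cfc (\<lambda>s. f s - t) a * cfc h a"
    by (rule cfc_mult[OF sa cont])
  moreover have "cfc (\<lambda>s. h s * (f s - t)) a = cfc h a * cfc (\<lambda>s. f s - t) a"
    by (rule cfc_mult[OF sa cont(2,1)])
  moreover have "cfc (\<lambda>s. f s - t) a = cfc f a - complex_of_real t *\<^sub>C 1"
    using cfc_diff[OF sa f continuous_on_const, of t] by (simp add: cfc_const[OF sa] scaleR_scaleC)
  ultimately have "cstar_invertible (cfc f a - complex_of_real t *\<^sub>C 1)"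
    by (intro cstar_invertibleI[of _ "cfc h a"]) (simp_all add: mult.commute)
  then show False using t(1) by (simp add: real_spectrum_def spectrum_def)
qed

lemma norm_cfc_le:
  fixes a :: "'a::cstar_algebra"
  assumes "star a = a" "continuous_on (real_spectrum a) f"
    and "0 \<le> s" "\<And>t. t \<in> real_spectrum a \<Longrightarrow> \<bar>f t\<bar> \<le> s"
  shows "norm (cfc f a) \<le> s"
  using real_spectrum_cfc[OF assms(1,2)] assms by (intro norm_le_of_real_spectrum star_cfc) auto

lemma cfc_positive:
  fixes a :: "'a::cstar_algebra"
  assumes "star a = a" "continuous_on (real_spectrum a) f" "\<And>t. t \<in> real_spectrum a \<Longrightarrow> 0 \<le> f t"
  shows "cstar_positive (cfc f a)"
  using real_spectrum_cfc[OF assms(1,2)] star_cfc[OF assms(1,2)] assms(3)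
  by (auto simp: cstar_positive_iff)

text \<open>For polynomials \<open>p\<close> the identity \<open>p(g(a)) = (p \<circ> g)(a)\<close> is multiplicativity of the calculus; the
  general case follows by approximating \<open>f\<close> uniformly on the image of the spectrum, which contains the
  spectrum of \<open>g(a)\<close>.\<close>

lemma cfc_compose:
  fixes a :: "'a::cstar_algebra"
  assumes sa: "star a = a" and g: "continuous_on (real_spectrum a) g"
    and f: "continuous_on (g ` real_spectrum a) f"
  shows "cfc f (cfc g a) = cfc (\<lambda>t. f (g t)) a"
proof -
  obtain p where p: "uniform_limit (g ` real_spectrum a) (\<lambda>n. poly (p n)) f sequentially"
    using poly_uniform_approximation[OF compact_continuous_image[OF g compact_real_spectrum] f] by blast
  have 1: "(\<lambda>n. cstar_poly (p n) (cfc g a)) \<longlonglongrightarrow> cfc f (cfc g a)"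
    using uniform_limit_on_subset[OF p real_spectrum_cfc[OF sa g]] by (rule cfc_limit[OF star_cfc[OF sa g]])
  have cont: "continuous_on (real_spectrum a) (\<lambda>t. poly q (g t))" for q
    by (intro continuous_intros g)
  have fg: "continuous_on (real_spectrum a) (\<lambda>t. f (g t))"
    using continuous_on_compose[OF g f] by (simp add: o_def)
  have poly: "cstar_poly q (cfc g a) = cfc (\<lambda>t. poly q (g t)) a" for q
  proof (induction q)
    case 0
    then show ?case using cfc_const[OF sa, of 0] by simp
  next
    case (pCons c q)
    have "cfc (\<lambda>t. poly (pCons c q) (g t)) a = cfc (\<lambda>t. c + g t * poly q (g t)) a" by simp
    also have "\<dots> = cfc (\<lambda>_. c) a + cfc (\<lambda>t. g t * poly q (g t)) a"
      by (rule cfc_add[OF sa]) (auto intro!: continuous_intros g)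
    also have "\<dots> = c *\<^sub>R 1 + cfc g a * cfc (\<lambda>t. poly q (g t)) a"
      by (simp only: cfc_const[OF sa] cfc_mult[OF sa g cont])
    finally show ?case by (simp add: cstar_poly_pCons pCons)
  qed
  have "(\<lambda>n. cstar_poly (p n) (cfc g a) - cfc (\<lambda>t. f (g t)) a) \<longlonglongrightarrow> 0"
    unfolding tendsto_iff
  proof (intro allI impI)
    fix e :: real assume e: "e > 0"
    from uniform_limitD[OF p half_gt_zero[OF e]]
    show "\<forall>\<^sub>F n in sequentially. dist (cstar_poly (p n) (cfc g a) - cfc (\<lambda>t. f (g t)) a) 0 < e"
    proof eventually_elim
      case (elim n)
      have "norm (cfc (\<lambda>t. poly (p n) (g t) - f (g t)) a) \<le> e / 2"
        using elim e
        by (intro norm_cfc_le[OF sa continuous_on_diff[OF cont fg]]) (auto simp: dist_real_def less_imp_le)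
      then show ?case using e by (simp add: poly cfc_diff[OF sa cont fg])
    qed
  qed
  then have "(\<lambda>n. cstar_poly (p n) (cfc g a)) \<longlonglongrightarrow> cfc (\<lambda>t. f (g t)) a" by (simp add: LIM_zero_iff)
  with 1 show ?thesis by (rule LIMSEQ_unique)
qed

section \<open>Positive elements\<close>

lemma cstar_positive_star: "cstar_positive a \<Longrightarrow> star a = (a::'a::cstar_algebra)"
  by (simp add: cstar_positive_def)

lemma real_spectrum_reflect:
  fixes a :: "'a::cstar_algebra"
  shows "s - t \<in> real_spectrum (s *\<^sub>R 1 - a) \<longleftrightarrow> t \<in> real_spectrum a"
proof -
  have "s *\<^sub>R 1 - a - complex_of_real (s - t) *\<^sub>C 1 = - (a - complex_of_real t *\<^sub>C 1)"
    by (simp add: scaleR_scaleC scaleC_diff_left)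
  then show ?thesis by (simp only: real_spectrum_def spectrum_def mem_Collect_eq cstar_invertible_minus_iff)
qed

text \<open>For \<open>s \<ge> \<parallel>a\<parallel>\<close> the spectrum lies in \<open>[-s, s]\<close>, and it is nonnegative if and only if its distance
  from \<open>s\<close> is at most \<open>s\<close>. The norm condition, unlike the spectral one, is visibly stable under sums.\<close>

lemma cstar_positive_iff_norm:
  fixes a :: "'a::cstar_algebra"
  assumes sa: "star a = a" and s: "norm a \<le> s"
  shows "cstar_positive a \<longleftrightarrow> norm (s *\<^sub>R 1 - a) \<le> s"
proof
  assume "cstar_positive a"
  then have nn: "\<And>t. t \<in> real_spectrum a \<Longrightarrow> 0 \<le> t" by (simp add: cstar_positive_iff)
  show "norm (s *\<^sub>R 1 - a) \<le> s"
  proof (rule norm_le_of_real_spectrum)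
    show "star (s *\<^sub>R 1 - a) = s *\<^sub>R 1 - a" by (simp add: star_diff sa)
    show "0 \<le> s" using s norm_ge_zero order_trans by blast
    fix t assume "t \<in> real_spectrum (s *\<^sub>R 1 - a)"
    then have "s - t \<in> real_spectrum a" using real_spectrum_reflect[of s "s - t" a] by simp
    then show "\<bar>t\<bar> \<le> s" using nn abs_real_spectrum_le s by fastforce
  qed
next
  assume n: "norm (s *\<^sub>R 1 - a) \<le> s"
  have "0 \<le> t" if "t \<in> real_spectrum a" for t
    using abs_real_spectrum_le[of "s - t" "s *\<^sub>R 1 - a"] n that by (simp add: real_spectrum_reflect)
  then show "cstar_positive a" by (simp add: cstar_positive_iff sa)
qed

lemma cstar_positive_add:
  fixes a b :: "'a::cstar_algebra"
  assumes a: "cstar_positive a" and b: "cstar_positive b" shows "cstar_positive (a + b)"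
proof -
  note sa = cstar_positive_star[OF a] cstar_positive_star[OF b]
  have "norm ((norm a + norm b) *\<^sub>R 1 - (a + b)) = norm ((norm a *\<^sub>R 1 - a) + (norm b *\<^sub>R 1 - b))"
    by (simp add: scaleR_add_left algebra_simps)
  also have "\<dots> \<le> norm a + norm b"
    using a b sa by (intro order_trans[OF norm_triangle_ineq] add_mono) (simp_all flip: cstar_positive_iff_norm)
  finally show ?thesis
    using cstar_positive_iff_norm[of "a + b" "norm a + norm b"] sa norm_triangle_ineq[of a b]
    by (simp add: star_add)
qed

lemma cstar_positive_sq:
  fixes a :: "'a::cstar_algebra"
  assumes sa: "star a = a" shows "cstar_positive (a * a)"
proof -
  have "a * a = cfc (\<lambda>t. t * t) a"
    using cfc_mult[OF sa, of "\<lambda>t. t" "\<lambda>t. t"] by (simp add: cfc_ident[OF sa])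
  then show ?thesis by (simp add: cfc_positive[OF sa] continuous_intros)
qed

lemma cstar_positive_scaleR:
  fixes a :: "'a::cstar_algebra"
  assumes a: "cstar_positive a" and c: "0 \<le> c" shows "cstar_positive (c *\<^sub>R a)"
proof -
  note sa = cstar_positive_star[OF a]
  have "c *\<^sub>R a = cfc (\<lambda>t. c * t) a"
    using cfc_scaleR[OF sa, of "\<lambda>t. t"] by (simp add: cfc_ident[OF sa])
  moreover have "cstar_positive (cfc (\<lambda>t. c * t) a)"
    by (rule cfc_positive[OF sa])
      (use a c in \<open>auto simp: cstar_positive_iff intro: continuous_intros\<close>)
  ultimately show ?thesis by simp
qed

lemma cstar_positive_one [simp]: "cstar_positive (1::'a::cstar_algebra)"
  using cstar_positive_sq[of "1::'a"] by simp

lemma cstar_positive_norm_diff: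
  fixes a :: "'a::cstar_algebra"
  assumes sa: "star a = a" and s: "norm a \<le> s" shows "cstar_positive (s *\<^sub>R 1 - a)"
proof -
  have "0 \<le> t" if "t \<in> real_spectrum (s *\<^sub>R 1 - a)" for t
    using abs_real_spectrum_le[of "s - t" a] that real_spectrum_reflect[of s "s - t" a] s by simp
  then show ?thesis by (simp add: cstar_positive_iff star_diff sa)
qed

lemma cstar_positive_antisym:
  fixes a :: "'a::cstar_algebra"
  assumes "cstar_positive a" "cstar_positive (- a)" shows "a = 0"
proof -
  have "t = 0" if "t \<in> real_spectrum a" for t
  proof -
    have "0 - t \<in> real_spectrum (0 *\<^sub>R 1 - a)" using that by (simp only: real_spectrum_reflect)
    then show ?thesis using assms that by (force simp: cstar_positive_iff)
  qed
  then have "norm a \<le> 0" using assms(1) by (intro norm_le_of_real_spectrum) (auto simp: cstar_positive_iff)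
  then show ?thesis by simp
qed

lemma self_adjoint_sq_eq_0:
  fixes a :: "'a::cstar_algebra"
  assumes "star a = a" "a * a = 0" shows "a = 0"
  using norm_self_adjoint_sq[OF assms(1)] assms(2) by simp

lemma cstar_positive_if_negative_part_0:
  fixes a :: "'a::cstar_algebra"
  assumes sa: "star a = a" and m0: "cfc (\<lambda>t. max (- t) 0) a = 0"
  shows "cstar_positive a"
proof -
  define m :: "real \<Rightarrow> real" where "m t = max (- t) 0" for t
  have cm: "continuous_on S m" for S unfolding m_def[abs_def] by (intro continuous_intros)
  have ctm: "continuous_on S (\<lambda>t. t + m t)" for S by (intro continuous_intros cm)
  have "cfc (\<lambda>t. (t + m t) - m t) a = a" using cfc_ident[OF sa] by simp
  then have "a = cfc (\<lambda>t. (t + m t) - m t) a" by (rule sym)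
  also have "\<dots> = cfc (\<lambda>t. t + m t) a"
    using cfc_diff[OF sa ctm cm] unfolding m0[folded m_def] by simp
  also have "cstar_positive \<dots>"
    by (rule cfc_positive[OF sa ctm]) (auto simp: m_def)
  finally show ?thesis .
qed

text \<open>With \<open>a = x\<^sup>* x\<close> and \<open>y = x (a\<^sup>-)\<^bsup>1/2\<^esup>\<close> one has \<open>y\<^sup>* y = - (a\<^sup>-)\<^sup>2\<close>. Now \<open>y\<^sup>* y + y y\<^sup>*\<close> is a sum
  of squares of self-adjoint elements and \<open>y\<^sup>* y\<close>, \<open>y y\<^sup>*\<close> have the same nonzero spectrum, so \<open>y\<^sup>* y\<close>
  is both positive and negative, whence \<open>a\<^sup>- = 0\<close>.\<close>

theorem cstar_positive_star_mult: "cstar_positive (star x * (x::'a::cstar_algebra))"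
proof -
  define a where "a = star x * x"
  have sa: "star a = a" by (simp add: a_def star_mult star_star)
  define m :: "real \<Rightarrow> real" where "m t = max (- t) 0" for t
  define h where "h t = sqrt (m t)" for t
  have cm: "continuous_on S m" for S unfolding m_def[abs_def] by (intro continuous_intros)
  have ch: "continuous_on S h" for S unfolding h_def[abs_def] by (intro continuous_intros cm)
  define y where "y = x * cfc h a"
  have "star y * y = cfc h a * a * cfc h a"
    by (simp add: y_def a_def star_mult star_cfc[OF sa ch, unfolded a_def] mult.assoc)
  also have "\<dots> = cfc h a * cfc (\<lambda>t. t) a * cfc h a" by (simp only: cfc_ident[OF sa])
  also have "\<dots> = cfc (\<lambda>t. h t * t * h t) a"
    using cfc_mult[OF sa ch, of "\<lambda>t. t"] cfc_mult[OF sa _ ch, of "\<lambda>t. h t * t"]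
    by (simp add: continuous_intros ch)
  also have "\<dots> = cfc (\<lambda>t. (- 1) * (m t * m t)) a"
  proof (rule cfc_cong)
    fix t :: real
    have "h t * h t = m t" by (simp add: h_def m_def flip: real_sqrt_mult)
    then have "h t * t * h t = t * m t" by (metis mult.assoc mult.commute)
    also have "\<dots> = (- 1) * (m t * m t)" by (simp add: m_def max_def)
    finally show "h t * t * h t = (- 1) * (m t * m t)" .
  qed
  also have "\<dots> = - (cfc m a * cfc m a)"
    using cfc_scaleR[OF sa, of "\<lambda>t. m t * m t" "- 1"] cfc_mult[OF sa cm cm] by (simp add: continuous_intros cm)
  finally have yy: "star y * y = - (cfc m a * cfc m a)" .
  have neg: "cstar_positive (- (star y * y))"
    unfolding yy by (simp add: cstar_positive_sq star_cfc[OF sa cm])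
  define u where "u = y + star y"
  define v where "v = \<i> *\<^sub>C (y - star y)"
  have "star u = u" by (simp add: u_def star_add star_star add.commute)
  moreover have "star v = v"
    by (simp add: v_def star_scaleC star_diff star_star scaleC_minus_left scaleC_diff_right)
  ultimately have "cstar_positive ((1/2) *\<^sub>R (u * u + v * v) + (- (star y * y)))"
    by (intro cstar_positive_add cstar_positive_scaleR cstar_positive_sq neg) auto
  also have "u * u + v * v = 2 *\<^sub>R (star y * y + y * star y)"
    by (simp add: u_def v_def scaleC_mult_scaleC scaleC_minus_left scaleC_one algebra_simps scaleR_2)
  finally have pos': "cstar_positive (y * star y)" by simp
  have "0 \<le> t" if t: "t \<in> real_spectrum (star y * y)" for t
  proof (cases "t = 0")
    case False
    then have "t \<in> real_spectrum (y * star y)"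
      using t spectrum_mult_commute unfolding real_spectrum_def by fastforce
    then show ?thesis using pos' by (simp add: cstar_positive_iff)
  qed simp
  then have "cstar_positive (star y * y)" by (simp add: cstar_positive_iff star_mult star_star)
  then have "star y * y = 0" using neg by (rule cstar_positive_antisym)
  then have m0: "cfc m a = 0" 
    using yy by (intro self_adjoint_sq_eq_0[OF star_cfc[OF sa cm]]) simp
  have "cstar_positive a" by (rule cstar_positive_if_negative_part_0[OF sa]) (use m0 in \<open>simp add: m_def[abs_def]\<close>)
  then show ?thesis by (simp add: a_def)
qed

lemma sqrt_positive:
  fixes a :: "'a::cstar_algebra"
  assumes a: "cstar_positive a"
  shows "cfc sqrt a * cfc sqrt a = a" "cstar_positive (cfc sqrt a)" "star (cfc sqrt a) = cfc sqrt a"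
proof -
  note sa = cstar_positive_star[OF a]
  have c: "continuous_on S sqrt" for S by (intro continuous_intros)
  have "cfc sqrt a * cfc sqrt a = cfc (\<lambda>t. sqrt t * sqrt t) a" by (rule cfc_mult[OF sa c c, symmetric])
  also have "\<dots> = cfc (\<lambda>t. t) a" using a by (intro cfc_cong) (auto simp: cstar_positive_iff)
  finally show "cfc sqrt a * cfc sqrt a = a" by (simp add: cfc_ident[OF sa])
  show "cstar_positive (cfc sqrt a)"
    using a by (intro cfc_positive[OF sa c]) (auto simp: cstar_positive_iff)
  then show "star (cfc sqrt a) = cfc sqrt a" by (rule cstar_positive_star)
qed

text \<open>The element is \<open>y\<^sup>* y\<close> for \<open>y = a\<^bsup>1/2\<^esup> b\<close>.\<close>

lemma cstar_positive_conjugate: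
  fixes a b :: "'a::cstar_algebra"
  assumes "cstar_positive a" shows "cstar_positive (star b * a * b)"
proof -
  have "star b * a * b = star (cfc sqrt a * b) * (cfc sqrt a * b)"
    using sqrt_positive[OF assms] by (simp add: star_mult mult.assoc) (simp flip: mult.assoc)
  then show ?thesis by (simp only: cstar_positive_star_mult)
qed

lemma cstar_positive_contraction_iff:
  fixes x :: "'a::cstar_algebra"
  shows "cstar_positive (1 - star x * x) \<longleftrightarrow> norm x \<le> 1"
proof
  assume "norm x \<le> 1"
  then have "norm (star x * x) \<le> 1" by (simp add: cstar_identity power_le_one)
  then show "cstar_positive (1 - star x * x)"
    using cstar_positive_norm_diff[of "star x * x" 1] by (simp add: star_mult star_star)
next
  assume p: "cstar_positive (1 - star x * x)"
  have "norm (star x * x) \<le> 1"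
  proof (rule norm_le_of_real_spectrum)
    show "star (star x * x) = star x * x" by (simp add: star_mult star_star)
    fix t assume t: "t \<in> real_spectrum (star x * x)"
    have "1 - t \<in> real_spectrum (1 *\<^sub>R 1 - star x * x)" using t by (simp only: real_spectrum_reflect)
    then have "t \<le> 1" using p by (force simp: cstar_positive_iff)
    moreover have "0 \<le> t" using cstar_positive_star_mult[of x] t by (simp add: cstar_positive_iff)
    ultimately show "\<bar>t\<bar> \<le> 1" by simp
  qed simp
  then show "norm x \<le> 1" by (simp add: cstar_identity power_le_one_iff abs_square_le_1)
qed

lemma cstar_abs_props:
  fixes x :: "'a::cstar_algebra"
  shows "cstar_positive (cstar_abs x)" "star (cstar_abs x) = cstar_abs x"
    "cstar_abs x * cstar_abs x = star x * x"
  using sqrt_positive[OF cstar_positive_star_mult[of x]] by (simp_all add: cstar_abs_def)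

lemma cfc_cstar_abs:
  fixes x :: "'a::cstar_algebra"
  assumes "continuous_on {0..} f"
  shows "cfc f (cstar_abs x) = cfc (\<lambda>t. f (sqrt t)) (star x * x)"
  unfolding cstar_abs_def using cstar_positive_star_mult[of x]
  by (intro cfc_compose continuous_on_subset[OF assms])
    (auto simp: cstar_positive_iff intro!: continuous_intros)

lemma cfc_inverse:
  fixes a :: "'a::cstar_algebra"
  assumes sa: "star a = a" and f: "continuous_on (real_spectrum a) f"
    and nz: "\<And>t. t \<in> real_spectrum a \<Longrightarrow> f t \<noteq> 0"
  shows "cfc f a * cfc (\<lambda>t. 1 / f t) a = 1" "cfc (\<lambda>t. 1 / f t) a * cfc f a = 1"
proof -
  have c: "continuous_on (real_spectrum a) (\<lambda>t. 1 / f t)"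
    using nz by (intro continuous_intros f) auto
  have "cfc (\<lambda>t. f t * (1 / f t)) a = 1" "cfc (\<lambda>t. 1 / f t * f t) a = 1"
    using cfc_const[OF sa, of 1] nz by (simp_all cong: cfc_cong)
  then show "cfc f a * cfc (\<lambda>t. 1 / f t) a = 1" "cfc (\<lambda>t. 1 / f t) a * cfc f a = 1"
    by (simp_all only: cfc_mult[OF sa f c] cfc_mult[OF sa c f])
qed

lemma real_spectrum_invertible:
  fixes a :: "'a::cstar_algebra"
  assumes "cstar_positive a" "cstar_invertible a" "t \<in> real_spectrum a"
  shows "0 < t"
proof -
  have "t \<noteq> 0" using assms(2,3) by (auto simp: real_spectrum_def spectrum_def)
  then show ?thesis using assms(1,3) by (force simp: cstar_positive_iff)
qed

lemma cstar_invertible_add_scaleR: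
  fixes a :: "'a::cstar_algebra"
  assumes a: "cstar_positive a" and e: "e > 0"
  shows "cstar_positive (a + e *\<^sub>R 1)" "cstar_invertible (a + e *\<^sub>R 1)"
proof -
  show "cstar_positive (a + e *\<^sub>R 1)"
    using e by (intro cstar_positive_add a cstar_positive_scaleR) auto
  have "- e \<notin> real_spectrum a" using a e by (force simp: cstar_positive_iff)
  then show "cstar_invertible (a + e *\<^sub>R 1)"
    by (simp add: real_spectrum_def spectrum_def scaleR_scaleC scaleC_minus_left)
qed

lemma inverse_sqrt_positive:
  fixes a :: "'a::cstar_algebra"
  assumes a: "cstar_positive a" and i: "cstar_invertible a"
  defines "r \<equiv> cfc (\<lambda>t. 1 / sqrt t) a"
  shows "cfc sqrt a * r = 1" "r * cfc sqrt a = 1" "star r = r" "cstar_positive r" "r * a * r = 1"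
proof -
  note sa = cstar_positive_star[OF a]
  have pos: "\<And>t. t \<in> real_spectrum a \<Longrightarrow> 0 < t" using real_spectrum_invertible[OF a i] .
  have c: "continuous_on (real_spectrum a) (\<lambda>t. 1 / sqrt t)"
    using pos by (intro continuous_intros) force
  show 1: "cfc sqrt a * r = 1" "r * cfc sqrt a = 1"
    unfolding r_def using pos by (intro cfc_inverse[OF sa]; force intro: continuous_intros)+
  show "cstar_positive r" unfolding r_def using pos by (intro cfc_positive[OF sa c]) (force simp: less_imp_le)
  then show "star r = r" by (rule cstar_positive_star)
  have "r * a * r = (r * cfc sqrt a) * (cfc sqrt a * r)"
    using sqrt_positive(1)[OF a] by (simp add: mult.assoc) (simp flip: mult.assoc)
  then show "r * a * r = 1" by (simp add: 1)
qed

section \<open>The contraction associated with the hypotheses\<close>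

text \<open>Here \<open>r\<close> plays the role of \<open>J\<^bsup>-1/2\<^esup>\<close>: conjugation by \<open>r\<close> turns \<open>h\<^sup>2 \<le> J\<close> into \<open>(h r)\<^sup>* (h r) \<le> 1\<close>.\<close>

lemma norm_mult_le_one_of_le:
  fixes h r J :: "'a::cstar_algebra"
  assumes h: "star h = h" and r: "star r = r" "r * J * r = 1" and le: "cstar_positive (J - h * h)"
  shows "norm (h * r) \<le> 1"
proof -
  have "star r * (J - h * h) * r = 1 - star (h * r) * (h * r)"
    by (simp add: star_mult h r(1) right_diff_distrib left_diff_distrib r(2)) (simp add: mult.assoc)
  then have "cstar_positive (1 - star (h * r) * (h * r))"
    using cstar_positive_conjugate[OF le, of r] by simp
  then show ?thesis by (simp add: cstar_positive_contraction_iff)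
qed

text \<open>Put \<open>p = f + \<delta>\<close>, \<open>q = g + \<delta>\<close>. Since \<open>Z h(|Z|) = h(|Z\<^sup>*|) Z\<close>, the element
  \<open>C = q(|Z\<^sup>*|)\<^bsup>-1/2\<^esup> Z p(|Z|)\<^bsup>-1/2\<^esup>\<close> equals \<open>(p q)\<^bsup>-1/2\<^esup>(|Z\<^sup>*|) Z\<close>, a contraction because
  \<open>p q \<ge> f g\<close> is the square function. The outer factors \<open>q(|Z\<^sup>*|)\<^bsup>1/2\<^esup>\<close> and \<open>p(|Z|)\<^bsup>1/2\<^esup>\<close> are
  absorbed by \<open>(J + \<delta>)\<^bsup>-1/2\<^esup>\<close> up to contractions.\<close>

lemma norm_sandwich_le_one:
  fixes Z J r :: "'a::cstar_algebra" and f g :: "real \<Rightarrow> real"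
  assumes f: "continuous_on {0..} f" "\<And>t. 0 \<le> t \<Longrightarrow> 0 \<le> f t"
    and g: "continuous_on {0..} g" "\<And>t. 0 \<le> t \<Longrightarrow> 0 \<le> g t"
    and fg: "\<And>t. 0 \<le> t \<Longrightarrow> f t * g t = t\<^sup>2"
    and fJ: "cfc f (cstar_abs Z) \<preceq> J" and gJ: "cfc g (cstar_abs (star Z)) \<preceq> J"
    and d: "0 < d" and r: "star r = r" "r * (J + d *\<^sub>R 1) * r = 1"
  shows "norm (r * Z * r) \<le> 1"
proof -
  define a where "a = star Z * Z"
  define b where "b = Z * star Z"
  have sa: "star a = a" "star b = b" by (simp_all add: a_def b_def star_mult star_star)
  have pa: "0 \<le> t" if "t \<in> real_spectrum a \<union> real_spectrum b" for t
    using that cstar_positive_star_mult[of Z] cstar_positive_star_mult[of "star Z"]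
    by (auto simp: a_def b_def cstar_positive_iff star_star)
  define p where "p t = sqrt (f (sqrt t) + d)" for t
  define q where "q t = sqrt (g (sqrt t) + d)" for t
  have p0: "p t > 0" if "0 \<le> t" for t using that f(2)[of "sqrt t"] d by (simp add: p_def add_nonneg_pos)
  have q0: "q t > 0" if "0 \<le> t" for t using that g(2)[of "sqrt t"] d by (simp add: q_def add_nonneg_pos)
  have csq: "continuous_on {0..} (\<lambda>t. f (sqrt t))" "continuous_on {0..} (\<lambda>t. g (sqrt t))"
    by (rule continuous_on_compose2[OF f(1)] continuous_on_compose2[OF g(1)];
        force intro: continuous_intros)+
  have cpq: "continuous_on {0..} p" "continuous_on {0..} q"
    unfolding p_def[abs_def] q_def[abs_def] by (intro continuous_intros csq)+
  have sub: "real_spectrum a \<subseteq> {0..}" "real_spectrum b \<subseteq> {0..}" "real_spectrum a \<union> real_spectrum b \<subseteq> {0..}"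
    using pa by auto
  have cip: "continuous_on {0..} (\<lambda>t. 1 / p t)" "continuous_on {0..} (\<lambda>t. 1 / q t)"
    using p0 q0 by (intro continuous_intros cpq; force)+
  define P where "P = cfc p a"
  define P' where "P' = cfc (\<lambda>t. 1 / p t) a"
  define Q where "Q = cfc q b"
  define Q' where "Q' = cfc (\<lambda>t. 1 / q t) b"
  have saPQ: "star P = P" "star Q = Q"
    unfolding P_def Q_def by (intro star_cfc sa continuous_on_subset[OF cpq(1) sub(1)] continuous_on_subset[OF cpq(2) sub(2)])+
  have inv: "P' * P = 1" "Q * Q' = 1"
    unfolding P_def P'_def Q_def Q'_def
    using p0 q0 pa
    by (intro cfc_inverse sa continuous_on_subset[OF cpq(1) sub(1)] continuous_on_subset[OF cpq(2) sub(2)]; force)+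
  define C where "C = Q' * Z * P'"
  define u where "u t = 1 / q t * (1 / p t)" for t
  have cu: "continuous_on (real_spectrum b) u"
    unfolding u_def[abs_def] by (intro continuous_on_mult continuous_on_subset[OF cip(1) sub(2)] continuous_on_subset[OF cip(2) sub(2)])
  have "Z * P' = cfc (\<lambda>t. 1 / p t) b * Z"
    unfolding P'_def
    by (rule cfc_intertwine[OF sa _ continuous_on_subset[OF cip(1) sub(3)]]) (simp add: a_def b_def mult.assoc)
  then have "C = Q' * cfc (\<lambda>t. 1 / p t) b * Z" by (simp add: C_def mult.assoc)
  also have "Q' * cfc (\<lambda>t. 1 / p t) b = cfc u b"
    unfolding Q'_def u_def[abs_def]
    by (rule cfc_mult[OF sa(2) continuous_on_subset[OF cip(2) sub(2)] continuous_on_subset[OF cip(1) sub(2)], symmetric])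
  finally have C: "C = cfc u b * Z" .
  have "star (star C) * star C = cfc u b * (Z * star Z) * cfc u b"
    by (simp add: C star_star star_mult star_cfc[OF sa(2) cu] mult.assoc)
  also have "\<dots> = cfc u b * b * cfc u b" unfolding b_def ..
  also have "\<dots> = cfc (\<lambda>t. u t * t * u t) b"
    using cfc_mult[OF sa(2) cu, of "\<lambda>t. t"] cfc_mult[OF sa(2) _ cu, of "\<lambda>t. u t * t"] cu
    by (simp add: continuous_intros cfc_ident[OF sa(2)])
  finally have "(norm C)\<^sup>2 = norm (cfc (\<lambda>t. u t * t * u t) b)"
    using cstar_identity[of "star C"] by simp
  also have "\<dots> \<le> 1"
  proof (rule norm_cfc_le[OF sa(2)])
    show "continuous_on (real_spectrum b) (\<lambda>t. u t * t * u t)" by (intro continuous_intros cu)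
    fix t assume "t \<in> real_spectrum b"
    then have t: "0 \<le> t" using pa by blast
    have "f (sqrt t) * g (sqrt t) = t" using fg[of "sqrt t"] t by simp
    then have "t \<le> (f (sqrt t) + d) * (g (sqrt t) + d)"
      using f(2)[of "sqrt t"] g(2)[of "sqrt t"] t d by (simp add: algebra_simps)
    also have "\<dots> = (p t * q t)\<^sup>2"
      using f(2)[of "sqrt t"] g(2)[of "sqrt t"] t d by (simp add: p_def q_def power_mult_distrib)
    finally have le: "t \<le> (p t * q t)\<^sup>2" .
    have pq: "0 < p t * q t" using p0[OF t] q0[OF t] by simp
    have "u t * t * u t = t / (p t * q t)\<^sup>2" by (simp add: u_def power2_eq_square)
    also have "\<dots> \<le> 1" using le pq by (simp add: divide_le_eq)
    finally show "\<bar>u t * t * u t\<bar> \<le> 1" using t by (simp add: mult.commute mult.left_commute abs_mult u_def)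
  qed simp
  finally have nC: "norm C \<le> 1" by (simp add: abs_square_le_1)
  have "P * P = cfc (\<lambda>t. f (sqrt t) + d) a"
  proof -
    have "P * P = cfc (\<lambda>t. p t * p t) a"
      unfolding P_def by (rule cfc_mult[OF sa(1), symmetric]; rule continuous_on_subset[OF cpq(1) sub(1)])
    also have "\<dots> = cfc (\<lambda>t. f (sqrt t) + d) a"
      using pa f(2) d by (intro cfc_cong) (simp add: p_def add_nonneg_nonneg)
    finally show ?thesis .
  qed
  also have "\<dots> = cfc f (cstar_abs Z) + d *\<^sub>R 1"
    unfolding cfc_cstar_abs[OF f(1)] a_def[symmetric]
    by (simp add: cfc_add[OF sa(1) continuous_on_subset[OF csq(1) sub(1)] continuous_on_const] cfc_const[OF sa(1)])
  finally have "cstar_positive ((J + d *\<^sub>R 1) - P * P)" using fJ by (simp add: cstar_le_def)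
  then have nP: "norm (P * r) \<le> 1" by (rule norm_mult_le_one_of_le[OF saPQ(1) r])
  have "Q * Q = cfc (\<lambda>t. g (sqrt t) + d) b"
  proof -
    have "Q * Q = cfc (\<lambda>t. q t * q t) b"
      unfolding Q_def by (rule cfc_mult[OF sa(2), symmetric]; rule continuous_on_subset[OF cpq(2) sub(2)])
    also have "\<dots> = cfc (\<lambda>t. g (sqrt t) + d) b"
      using pa g(2) d by (intro cfc_cong) (simp add: q_def add_nonneg_nonneg)
    finally show ?thesis .
  qed
  also have "\<dots> = cfc g (cstar_abs (star Z)) + d *\<^sub>R 1"
    unfolding cfc_cstar_abs[OF g(1)] star_star b_def[symmetric]
    by (simp add: cfc_add[OF sa(2) continuous_on_subset[OF csq(2) sub(2)] continuous_on_const] cfc_const[OF sa(2)])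
  finally have "cstar_positive ((J + d *\<^sub>R 1) - Q * Q)" using gJ by (simp add: cstar_le_def)
  then have "norm (Q * r) \<le> 1" by (rule norm_mult_le_one_of_le[OF saPQ(2) r])
  moreover have "star (Q * r) = r * Q" by (simp add: star_mult saPQ r(1))
  ultimately have nQ: "norm (r * Q) \<le> 1" by (metis norm_star)
  have "Q * C * P = (Q * Q') * Z * (P' * P)" by (simp add: C_def mult.assoc)
  then have Z: "Z = Q * C * P" by (simp add: inv)
  have "r * Z * r = (r * Q) * C * (P * r)" by (subst Z) (simp add: mult.assoc)
  also have "norm \<dots> \<le> norm (r * Q) * norm C * norm (P * r)"
    by (meson norm_mult_ineq mult_right_mono norm_ge_zero order_trans)
  also have "\<dots> \<le> 1" using nQ nC nP by (simp add: mult_le_one)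
  finally show ?thesis .
qed

section \<open>Positive maps and contractions\<close>

lemma op_apply_simps:
  "op_apply (S + T) x = op_apply S x + op_apply T x"
  "op_apply (S - T) x = op_apply S x - op_apply T x"
  "op_apply (- S) x = - op_apply S x"
  "op_apply (S * T) x = op_apply S (op_apply T x)"
  "op_apply (r *\<^sub>R S) x = r *\<^sub>R op_apply S x"
  "op_apply 1 x = x" "op_apply 0 x = 0"
  "op_apply S (x + y) = op_apply S x + op_apply S y"
  "op_apply S (x - y) = op_apply S x - op_apply S y"
  "op_apply S (- x) = - op_apply S x"
  "op_apply S (r *\<^sub>R x) = r *\<^sub>R op_apply S x"
  "op_apply S 0 = 0"
  by (simp_all add: plus_bounded_op.rep_eq minus_bounded_op.rep_eq uminus_bounded_op.rep_eq
      times_bounded_op.rep_eq scaleR_bounded_op.rep_eq one_bounded_op.rep_eq zero_bounded_op.rep_eq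
      blinfun.bilinear_simps)

lemma op_apply_sum: "op_apply (\<Sum>i\<in>A. f i) x = (\<Sum>i\<in>A. op_apply (f i) x)"
  by (induction A rule: infinite_finite_induct) (simp_all add: op_apply_simps)

lemma inner_self_adjoint:
  "star T = T \<Longrightarrow> inner (op_apply T x) y = inner x (op_apply T y)"
  by (metis inner_star)

lemma inner_positive:
  assumes "cstar_positive T" shows "0 \<le> inner (op_apply T x) x"
proof -
  define S where "S = cfc sqrt T"
  have S: "S * S = T" "star S = S" using sqrt_positive[OF assms] by (simp_all add: S_def)
  have "inner (op_apply T x) x = inner (op_apply S x) (op_apply S x)"
    unfolding S(1)[symmetric] by (simp add: op_apply_simps inner_self_adjoint[OF S(2)])
  then show ?thesis by simp
qed

text \<open>Expand the form of \<open>T\<close> at \<open>x - y\<close>.\<close>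

lemma inner_positive_AM_GM:
  assumes T: "cstar_positive T"
  shows "2 * inner (op_apply T x) y \<le> inner (op_apply T x) x + inner (op_apply T y) y"
proof -
  have "0 \<le> inner (op_apply T (x - y)) (x - y)" by (rule inner_positive[OF T])
  moreover have "inner (op_apply T y) x = inner (op_apply T x) y"
    using inner_self_adjoint[OF cstar_positive_star[OF T]] by (metis inner_commute)
  ultimately show ?thesis by (simp add: op_apply_simps inner_diff_left inner_diff_right)
qed

text \<open>The form of \<open>T\<close> takes the same value at \<open>x\<close> and at \<open>c x\<close>, so the phase of the off-diagonal entry
  does not matter.\<close>

lemma inner_positive_AM_GM_unimodular:
  assumes T: "cstar_positive T" and c: "cmod c = 1"
  shows "2 * inner (op_apply (c *\<^sub>C T) x) y \<le> inner (op_apply T x) x + inner (op_apply T y) y"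
proof -
  have "cnj c * c = 1" using c by (metis complex_norm_square mult.commute of_real_1 power_one)
  then have "inner (op_apply T (c *\<^sub>C x)) (c *\<^sub>C x) = inner (op_apply T x) x"
    by (simp add: op_apply_scaleC inner_scaleC_left scaleC_scaleC scaleC_one)
  then show ?thesis
    using inner_positive_AM_GM[OF T, of "c *\<^sub>C x" y] by (simp add: op_apply_of_scaleC op_apply_scaleC)
qed

lemma positive_map_star:
  assumes "clinear \<Phi>" "positive_map \<Phi>" "star a = a" shows "star (\<Phi> a) = \<Phi> a"
proof -
  have "cstar_positive (\<Phi> (norm a *\<^sub>R 1 - a))" "cstar_positive (\<Phi> 1)"
    using assms cstar_positive_norm_diff[of a "norm a"] by (auto simp: positive_map_def)
  then have "star (norm a *\<^sub>R \<Phi> 1 - \<Phi> a) = norm a *\<^sub>R \<Phi> 1 - \<Phi> a" "star (\<Phi> 1) = \<Phi> 1"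
    by (auto simp: clinear_simps[OF assms(1)] dest: cstar_positive_star)
  then show ?thesis by (simp add: star_diff)
qed

text \<open>Boundedness of the matrix coefficients of a positive map. For self-adjoint \<open>a\<close> the diagonal
  coefficients are controlled by \<open>- \<parallel>a\<parallel> \<le> a \<le> \<parallel>a\<parallel>\<close>; polarization passes to all coefficients, and the
  decomposition into real and imaginary part to all \<open>a\<close>.\<close>

lemma positive_map_coefficient_bounded:
  fixes \<Phi> :: "'a::cstar_algebra \<Rightarrow> 'h::complex_hilbert_space bounded_op"
  assumes lin: "clinear \<Phi>" and pos: "positive_map \<Phi>"
  shows "\<exists>C. \<forall>a. \<bar>inner (op_apply (\<Phi> a) x) y\<bar> \<le> C * norm a"
proof -
  define Q where "Q x = inner (op_apply (\<Phi> 1) x) x" for x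
  have diag: "\<bar>inner (op_apply (\<Phi> a) x) x\<bar> \<le> Q x * norm a" if sa: "star a = a" for a x
  proof -
    have "cstar_positive (norm a *\<^sub>R 1 - a)" "cstar_positive (norm a *\<^sub>R 1 - (- a))"
      using sa cstar_positive_norm_diff[of a "norm a"] cstar_positive_norm_diff[of "- a" "norm a"] by simp_all
    then have "cstar_positive (\<Phi> (norm a *\<^sub>R 1 - a))" "cstar_positive (\<Phi> (norm a *\<^sub>R 1 - (- a)))"
      using pos unfolding positive_map_def by blast+
    from this[THEN inner_positive, of x] show ?thesis
      by (simp add: Q_def clinear_simps[OF lin] op_apply_simps inner_diff_left inner_add_left abs_le_iff mult.commute)
  qed
  define B where "B x y = (Q (x + y) + Q (x - y)) / 4" for x y
  have sa_bound: "\<bar>inner (op_apply (\<Phi> a) x) y\<bar> \<le> B x y * norm a" if sa: "star a = a" for a x y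
  proof -
    have s: "inner (op_apply (\<Phi> a) y) x = inner (op_apply (\<Phi> a) x) y"
      using inner_self_adjoint[OF positive_map_star[OF lin pos sa]] by (metis inner_commute)
    have "4 * inner (op_apply (\<Phi> a) x) y
        = inner (op_apply (\<Phi> a) (x + y)) (x + y) - inner (op_apply (\<Phi> a) (x - y)) (x - y)"
      by (simp add: op_apply_simps inner_diff_left inner_diff_right inner_add_left inner_add_right s)
    then show ?thesis
      using diag[OF sa, of "x + y"] diag[OF sa, of "x - y"] by (simp add: B_def distrib_right)
  qed
  have "\<bar>inner (op_apply (\<Phi> a) x) y\<bar> \<le> (B x y + B x (- \<i> *\<^sub>C y)) * norm a" for a
  proof -
    define h where "h = (1/2) *\<^sub>R (a + star a)"
    define k where "k = (1/2) *\<^sub>R (- \<i> *\<^sub>C (a - star a))"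
    have "star h = h" by (simp add: h_def star_add star_star add.commute)
    moreover have "star k = k"
      by (simp add: k_def star_scaleC star_diff star_star scaleC_minus_left scaleC_diff_right)
    moreover have nh: "norm h \<le> norm a" using norm_triangle_ineq[of a "star a"] by (simp add: h_def)
    moreover have nk: "norm k \<le> norm a" using norm_triangle_ineq4[of a "star a"] by (simp add: k_def norm_scaleC)
    moreover have "a = h + \<i> *\<^sub>C k"
      by (simp add: h_def k_def scaleR_scaleC scaleC_scaleC scaleC_add_right scaleC_diff_right scaleC_minus_left)
        (simp flip: scaleC_add_left add: scaleC_one)
    then have "inner (op_apply (\<Phi> a) x) y
        = inner (op_apply (\<Phi> h) x) y + inner (op_apply (\<Phi> k) x) (- \<i> *\<^sub>C y)"
      by (simp add: clinear_simps[OF lin] op_apply_simps op_apply_of_scaleC inner_add_left inner_scaleC_left)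
    moreover have B0: "0 \<le> B x y" for x y
      unfolding B_def Q_def using pos by (auto intro!: inner_positive add_nonneg_nonneg simp: positive_map_def)
    ultimately show ?thesis
      using sa_bound[of h x y] sa_bound[of k x "- \<i> *\<^sub>C y"]
        mult_left_mono[OF nh B0[of x y]] mult_left_mono[OF nk B0[of x "- \<i> *\<^sub>C y"]]
      by (simp add: distrib_right)
  qed
  then show ?thesis by blast
qed

text \<open>A discrete Poisson kernel. For an \<open>N\<close>-th root of unity \<open>w\<close> put \<open>S\<^sub>w = \<Sum>\<^bsub>n<N\<^esub> w\<^sup>n K\<^sup>n\<close> and
  \<open>A\<^sub>w = S\<^sub>w\<^sup>* (1 - K\<^sup>* K) S\<^sub>w\<close>. The \<open>A\<^sub>w\<close> are positive if \<open>K\<close> is a contraction, their average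
  telescopes to \<open>1 - K\<^sup>*\<^sup>N K\<^sup>N\<close>, and their first Fourier coefficient is \<open>K\<close> up to an error of the
  order of \<open>K\<^sup>*\<^bsup>N-1\<^esup>\<close>. The numbers \<open>w\<close> of the statement are the conjugates of the roots of unity.\<close>

lemma contraction_average:
  fixes K :: "'a::cstar_algebra"
  assumes K: "norm K \<le> 1" and N: "N = Suc M"
  obtains A w where "\<And>k. cstar_positive (A k)" "\<And>k. cmod (w k) = 1"
    "(\<Sum>k<N. A k) = real N *\<^sub>R (1 - star K ^ N * K ^ N)"
    "(\<Sum>k<N. w k *\<^sub>C A k) = real N *\<^sub>R (K + star K ^ M * (1 - star K * K - K ^ Suc M))"
proof -
  have N0: "N > 0" using N by simp
  define L where "L = star K"
  define P where "P = 1 - L * K"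
  define w where "w k = cis (2 * pi * real k / real N)" for k
  define S where "S k = (\<Sum>n<N. (w k ^ n) *\<^sub>C K ^ n)" for k
  define A where "A k = star (S k) * P * S k" for k
  have posP: "cstar_positive P" using K by (simp add: P_def L_def cstar_positive_contraction_iff)
  have A1: "cstar_positive (A k)" for k unfolding A_def by (rule cstar_positive_conjugate[OF posP])
  define B where "B m n = L ^ m * P * K ^ n" for m n
  have cw: "cnj (w k) = cis (- (2 * pi * real k / real N))" for k by (simp add: w_def cis_cnj)
  have coef: "cnj (w k) ^ j * (cnj (w k ^ m) * w k ^ n)
      = cis (2 * pi * real k * real_of_int (int n - int m - int j) / real N)" for k m n j
  proof -
    have "cnj (w k) ^ j * (cnj (w k ^ m) * w k ^ n)
      = cis (real j * - (2 * pi * real k / real N)) * (cis (real m * - (2 * pi * real k / real N))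
         * cis (real n * (2 * pi * real k / real N)))"
    proof -
      have "cnj (w k) ^ j = cis (real j * - (2 * pi * real k / real N))"
        "cnj (w k ^ m) = cis (real m * - (2 * pi * real k / real N))"
        by (simp_all only: complex_cnj_power cw Complex.DeMoivre)
      moreover have "w k ^ n = cis (real n * (2 * pi * real k / real N))"
        by (simp only: w_def Complex.DeMoivre)
      ultimately show ?thesis by (simp only:)
    qed
    also have "\<dots> = cis (real j * - (2 * pi * real k / real N) + (real m * - (2 * pi * real k / real N)
         + real n * (2 * pi * real k / real N)))"
      by (simp only: cis_mult)
    also have "real j * - (2 * pi * real k / real N) + (real m * - (2 * pi * real k / real N)
         + real n * (2 * pi * real k / real N))
         = 2 * pi * real k * real_of_int (int n - int m - int j) / real N"
      using N0 by (simp add: field_simps)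
    finally show ?thesis .
  qed
  have expand: "A k = (\<Sum>m<N. \<Sum>n<N. (cnj (w k ^ m) * w k ^ n) *\<^sub>C B m n)" for k
  proof -
    have "star (S k) = (\<Sum>m<N. cnj (w k ^ m) *\<^sub>C L ^ m)"
      by (simp add: S_def star_sum star_scaleC star_power L_def)
    then have "A k = (\<Sum>m<N. cnj (w k ^ m) *\<^sub>C L ^ m) * P * (\<Sum>n<N. (w k ^ n) *\<^sub>C K ^ n)"
      by (simp add: A_def S_def)
    also have "\<dots> = (\<Sum>m<N. \<Sum>n<N. (cnj (w k ^ m) *\<^sub>C L ^ m) * P * ((w k ^ n) *\<^sub>C K ^ n))"
      by (simp only: sum_distrib_left sum_distrib_right) (rule sum.swap)
    finally show ?thesis
      by (simp only: B_def scaleC_mult_left scaleC_mult_right scaleC_scaleC mult.commute)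
  qed
  have fourier: "(\<Sum>k<N. (cnj (w k) ^ j) *\<^sub>C A k)
      = (\<Sum>m<N. \<Sum>n<N. (if int N dvd int n - int m - int j then of_nat N else 0) *\<^sub>C B m n)" for j
  proof -
    have "(\<Sum>k<N. (cnj (w k) ^ j) *\<^sub>C A k) = (\<Sum>k<N. \<Sum>m<N. \<Sum>n<N.
        cis (2 * pi * real k * real_of_int (int n - int m - int j) / real N) *\<^sub>C B m n)"
      unfolding expand scaleC_sum_right scaleC_scaleC coef ..
    also have "\<dots> = (\<Sum>m<N. \<Sum>n<N. (\<Sum>k<N.
        cis (2 * pi * real k * real_of_int (int n - int m - int j) / real N)) *\<^sub>C B m n)"
      unfolding scaleC_sum_left by (subst sum.swap, rule sum.cong[OF refl], rule sum.swap)
    finally show ?thesis unfolding sum_roots_of_unity[OF N0] .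
  qed
  have tele: "(\<Sum>m<j. B m m) = 1 - L ^ j * K ^ j" for j
  proof (induction j)
    case (Suc j)
    have "B j j = L ^ j * K ^ j - L ^ Suc j * K ^ Suc j"
      by (simp add: B_def P_def right_diff_distrib left_diff_distrib mult.assoc power_commutes)
        (simp add: power_commutes flip: mult.assoc power_Suc2)
    then show ?case by (simp add: Suc)
  qed simp
  have A2: "(\<Sum>k<N. A k) = real N *\<^sub>R (1 - L ^ N * K ^ N)"
  proof -
    have "int N dvd int n - int m - int 0 \<longleftrightarrow> n = m" if "m < N" "n < N" for m n
    proof
      assume "int N dvd int n - int m - int 0"
      then have "int n mod int N = int m mod int N" by (simp add: mod_eq_dvd_iff)
      then show "n = m" using that by simp
    qed simp
    then have "(\<Sum>k<N. (cnj (w k) ^ 0) *\<^sub>C A k) = (\<Sum>m<N. \<Sum>n<N. if n = m then of_nat N *\<^sub>C B m n else 0)"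
      unfolding fourier by (intro sum.cong refl) auto
    then show ?thesis
      by (simp add: scaleC_one sum.delta flip: tele scaleC_sum_right) (simp add: scaleR_scaleC)
  qed
  have A3: "(\<Sum>k<N. cnj (w k) *\<^sub>C A k) = real N *\<^sub>R (K + L ^ M * (1 - L * K - K ^ Suc M))"
  proof -
    \<comment> \<open>The successor of \<open>m\<close> modulo \<open>N\<close>; its wrap-around at \<open>m = M\<close> produces the error term.\<close>
    define s where "s m = (if m = M then 0 else Suc m)" for m
    have "int N dvd int n - int m - int 1 \<longleftrightarrow> n = s m" if "m < N" "n < N" for m n
    proof -
      have "int N dvd int n - int m - int 1 \<longleftrightarrow> int n mod int N = int (Suc m) mod int N"
        by (simp add: mod_eq_dvd_iff algebra_simps)
      also have "\<dots> \<longleftrightarrow> n mod N = Suc m mod N" by (metis of_nat_eq_iff zmod_int)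
      also have "\<dots> \<longleftrightarrow> n = s m" using that N by (auto simp: s_def)
      finally show ?thesis .
    qed
    then have "(\<Sum>k<N. (cnj (w k) ^ 1) *\<^sub>C A k) = (\<Sum>m<N. \<Sum>n<N. if n = s m then of_nat N *\<^sub>C B m n else 0)"
      unfolding fourier by (intro sum.cong refl) auto
    also have "\<dots> = (\<Sum>m<N. of_nat N *\<^sub>C B m (s m))"
      using N by (intro sum.cong refl) (auto simp: s_def)
    also have "\<dots> = real N *\<^sub>R (\<Sum>m<N. B m (s m))" by (simp add: scaleR_scaleC flip: scaleC_sum_right)
    also have "(\<Sum>m<N. B m (s m)) = (\<Sum>m<M. B m m * K) + B M 0"
    proof -
      have "(\<Sum>m<M. B m (s m)) = (\<Sum>m<M. B m m * K)"
        by (intro sum.cong refl) (simp add: s_def B_def mult.assoc power_commutes)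
      then show ?thesis by (simp add: N s_def)
    qed
    also have "\<dots> = (1 - L ^ M * K ^ M) * K + L ^ M * P"
      by (simp add: B_def flip: sum_distrib_right tele)
    also have "\<dots> = K + L ^ M * (1 - L * K - K ^ Suc M)"
      by (simp add: P_def right_diff_distrib left_diff_distrib mult.assoc power_commutes)
    finally show ?thesis by simp
  qed
  show ?thesis
    by (rule that[of A "\<lambda>k. cnj (w k)"]) (use A1 A2 A3 in \<open>simp_all add: L_def w_def\<close>)
qed

text \<open>The inequality is linear in the off-diagonal entry. It holds for each \<open>w A\<close> with \<open>A\<close> positive and
  \<open>w\<close> unimodular, hence for the averages that the Poisson kernel provides; these tend to \<open>K\<close> because
  \<open>\<parallel>K\<parallel> < 1\<close>.\<close>

lemma positive_map_contraction:
  fixes \<Psi> :: "'a::cstar_algebra \<Rightarrow> 'h::complex_hilbert_space bounded_op"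
  assumes lin: "clinear \<Psi>" and pos: "positive_map \<Psi>" and K: "norm K < 1"
  shows "2 * inner (op_apply (\<Psi> K) x) y \<le> inner (op_apply (\<Psi> 1) x) x + inner (op_apply (\<Psi> 1) y) y"
proof -
  obtain C where C: "\<And>a. \<bar>inner (op_apply (\<Psi> a) x) y\<bar> \<le> C * norm a"
    using positive_map_coefficient_bounded[OF lin pos] by blast
  define E where "E M = star K ^ M * (1 - star K * K - K ^ Suc M)" for M
  have step: "2 * inner (op_apply (\<Psi> (K + E M)) x) y \<le> inner (op_apply (\<Psi> 1) x) x + inner (op_apply (\<Psi> 1) y) y" for M
  proof -
    define N where "N = Suc M"
    have N: "real N > 0" by (simp add: N_def)
    obtain A w where A: "\<And>k. cstar_positive (A k)" "\<And>k. cmod (w k) = 1"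
      "(\<Sum>k<N. A k) = real N *\<^sub>R (1 - star K ^ N * K ^ N)"
      "(\<Sum>k<N. w k *\<^sub>C A k) = real N *\<^sub>R (K + E M)"
      by (rule contraction_average[OF less_imp_le[OF K] N_def, folded E_def], rule that)
    have posA: "cstar_positive (\<Psi> (A k))" for k using pos A(1) by (simp add: positive_map_def)
    have "real N * (2 * inner (op_apply (\<Psi> (K + E M)) x) y) = 2 * inner (op_apply (\<Psi> (\<Sum>k<N. w k *\<^sub>C A k)) x) y"
      unfolding A(4) by (simp add: clinear_simps(3)[OF lin] op_apply_simps)
    also have "\<dots> = (\<Sum>k<N. 2 * inner (op_apply (w k *\<^sub>C \<Psi> (A k)) x) y)"
      by (simp add: clinear_sum[OF lin] clinear_simps(2)[OF lin] op_apply_sum inner_sum_left sum_distrib_left)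
    also have "\<dots> \<le> (\<Sum>k<N. inner (op_apply (\<Psi> (A k)) x) x + inner (op_apply (\<Psi> (A k)) y) y)"
      by (intro sum_mono inner_positive_AM_GM_unimodular posA A(2))
    also have "\<dots> = inner (op_apply (\<Psi> (\<Sum>k<N. A k)) x) x + inner (op_apply (\<Psi> (\<Sum>k<N. A k)) y) y"
      by (simp add: clinear_sum[OF lin] op_apply_sum inner_sum_left sum.distrib)
    also have "\<dots> = real N * (inner (op_apply (\<Psi> (1 - star K ^ N * K ^ N)) x) x
        + inner (op_apply (\<Psi> (1 - star K ^ N * K ^ N)) y) y)"
      unfolding A(3) by (simp add: clinear_simps(3)[OF lin] op_apply_simps distrib_left)
    also have "\<dots> \<le> real N * (inner (op_apply (\<Psi> 1) x) x + inner (op_apply (\<Psi> 1) y) y)"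
    proof -
      have "cstar_positive (\<Psi> (star K ^ N * K ^ N))"
        using pos cstar_positive_star_mult[of "K ^ N"] by (simp add: positive_map_def star_power)
      from inner_positive[OF this] show ?thesis
        using N by (intro mult_left_mono add_mono) (simp_all add: clinear_simps[OF lin] op_apply_simps inner_diff_left)
    qed
    finally show ?thesis using N by simp
  qed
  have bE: "norm (E M) \<le> norm K ^ M * 3" for M
  proof -
    have "norm (K ^ Suc M) \<le> 1" using norm_power_le[of K "Suc M"] K by (meson less_imp_le norm_ge_zero order_trans power_le_one)
    moreover have "norm (star K * K) \<le> 1" using K by (simp add: cstar_identity power_le_one)
    ultimately have "norm (1 - star K * K - K ^ Suc M) \<le> 3"
      using norm_triangle_ineq4[of "1 - star K * K" "K ^ Suc M"] norm_triangle_ineq4[of 1 "star K * K"]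
        norm_one_le[where 'a='a] by linarith
    moreover have "norm (star K ^ M) \<le> norm K ^ M" using norm_power_le[of "star K" M] by simp
    ultimately show ?thesis unfolding E_def
      using norm_mult_ineq order_trans mult_mono norm_ge_zero zero_le_power by meson
  qed
  have "(\<lambda>M. norm K ^ M * 3) \<longlonglongrightarrow> 0" using K by (auto intro!: tendsto_mult_left_zero LIMSEQ_power_zero)
  then have "(\<lambda>M. norm (E M)) \<longlonglongrightarrow> 0"
    by (rule tendsto_sandwich[OF _ _ tendsto_const, rotated 2]) (auto simp: bE)
  then have "(\<lambda>M. C * norm (E M)) \<longlonglongrightarrow> 0" by (rule tendsto_mult_right_zero)
  then have "(\<lambda>M. inner (op_apply (\<Psi> (E M)) x) y) \<longlonglongrightarrow> 0"
    by (rule Lim_null_comparison[rotated]) (simp add: C)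
  then have "(\<lambda>M. 2 * (inner (op_apply (\<Psi> K) x) y + inner (op_apply (\<Psi> (E M)) x) y)) \<longlonglongrightarrow> 2 * (inner (op_apply (\<Psi> K) x) y + 0)"
    by (intro tendsto_intros)
  then have "2 * (inner (op_apply (\<Psi> K) x) y + 0) \<le> inner (op_apply (\<Psi> 1) x) x + inner (op_apply (\<Psi> 1) y) y"
    by (rule LIMSEQ_le_const2) (use step in \<open>auto simp: clinear_simps[OF lin] op_apply_simps inner_add_left\<close>)
  then show ?thesis by simp
qed

text \<open>With \<open>s = (J + \<delta>)\<^bsup>1/2\<^esup>\<close> and \<open>K = s\<inverse> Z s\<inverse>\<close>, the previous lemma applies to the positive map
  \<open>X \<mapsto> \<Phi>(s X s)\<close> and the strict contraction \<open>(1 - \<delta>) K\<close>; this map sends \<open>1\<close> to \<open>\<Phi>(J + \<delta>)\<close> and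
  \<open>K\<close> to \<open>\<Phi>(Z)\<close>.\<close>

theorem positive_map_block_positive:
  fixes \<Phi> :: "'a::cstar_algebra \<Rightarrow> 'h::complex_hilbert_space bounded_op" and f g :: "real \<Rightarrow> real"
  assumes lin: "clinear \<Phi>" and pos: "positive_map \<Phi>" and J: "cstar_positive J"
    and f: "continuous_on {0..} f" "\<And>t. 0 \<le> t \<Longrightarrow> 0 \<le> f t"
    and g: "continuous_on {0..} g" "\<And>t. 0 \<le> t \<Longrightarrow> 0 \<le> g t"
    and fg: "\<And>t. 0 \<le> t \<Longrightarrow> f t * g t = t\<^sup>2"
    and fJ: "cfc f (cstar_abs Z) \<preceq> J" and gJ: "cfc g (cstar_abs (star Z)) \<preceq> J"
  shows "2 * inner (op_apply (\<Phi> Z) x) y \<le> inner (op_apply (\<Phi> J) x) x + inner (op_apply (\<Phi> J) y) y"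
proof -
  define c where "c = inner (op_apply (\<Phi> 1) x) x + inner (op_apply (\<Phi> 1) y) y"
  have approx: "(1 - d) * (2 * inner (op_apply (\<Phi> Z) x) y)
      \<le> inner (op_apply (\<Phi> J) x) x + inner (op_apply (\<Phi> J) y) y + d * c" if d: "0 < d" "d < 1" for d :: real
  proof -
    define J' where "J' = J + d *\<^sub>R 1"
    note J' = cstar_invertible_add_scaleR[OF J d(1), folded J'_def]
    define s where "s = cfc sqrt J'"
    define r where "r = cfc (\<lambda>t. 1 / sqrt t) J'"
    note r = inverse_sqrt_positive[OF J', folded s_def r_def]
    have s: "s * s = J'" "star s = s" using sqrt_positive[OF J'(1)] by (simp_all add: s_def)
    have "norm (r * Z * r) \<le> 1"
      by (rule norm_sandwich_le_one[OF f g fg fJ gJ d(1) r(3)]) (use r(5) in \<open>simp_all add: J'_def\<close>)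
    then have K: "norm ((1 - d) *\<^sub>R (r * Z * r)) < 1"
      using d by (simp add: mult_le_one) (smt (verit) mult_left_le norm_ge_zero)
    define \<Psi> where "\<Psi> X = \<Phi> (s * X * s)" for X
    have "clinear \<Psi>"
      by (simp add: clinear_def \<Psi>_def distrib_left distrib_right clinear_simps[OF lin]
          scaleC_mult_left scaleC_mult_right)
    moreover have "positive_map \<Psi>"
      using pos cstar_positive_conjugate[of _ s] by (simp add: positive_map_def \<Psi>_def s(2))
    ultimately have "2 * inner (op_apply (\<Psi> ((1 - d) *\<^sub>R (r * Z * r))) x) y
        \<le> inner (op_apply (\<Psi> 1) x) x + inner (op_apply (\<Psi> 1) y) y"
      using K by (rule positive_map_contraction)
    moreover have "s * (r * Z * r) * s = (s * r) * Z * (r * s)" by (simp add: mult.assoc)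
    then have "\<Psi> ((1 - d) *\<^sub>R (r * Z * r)) = (1 - d) *\<^sub>R \<Phi> Z"
      by (simp add: \<Psi>_def r(1,2) clinear_simps(3)[OF lin])
    moreover have "\<Psi> 1 = \<Phi> J + d *\<^sub>R \<Phi> 1" by (simp add: \<Psi>_def s J'_def clinear_simps[OF lin])
    ultimately have "2 * inner (op_apply ((1 - d) *\<^sub>R \<Phi> Z) x) y
        \<le> inner (op_apply (\<Phi> J + d *\<^sub>R \<Phi> 1) x) x + inner (op_apply (\<Phi> J + d *\<^sub>R \<Phi> 1) y) y"
      by (simp only:)
    then show ?thesis by (simp add: op_apply_simps(1,5) inner_add_left c_def distrib_left)
  qed
  define d where "d n = inverse (real (Suc (Suc n)))" for n
  have d: "d \<longlonglongrightarrow> 0" unfolding d_def[abs_def] using LIMSEQ_Suc[OF LIMSEQ_inverse_real_of_nat] .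
  have "(\<lambda>n. (1 - d n) * (2 * inner (op_apply (\<Phi> Z) x) y)) \<longlonglongrightarrow> (1 - 0) * (2 * inner (op_apply (\<Phi> Z) x) y)"
    by (intro tendsto_intros d)
  moreover have "(\<lambda>n. inner (op_apply (\<Phi> J) x) x + inner (op_apply (\<Phi> J) y) y + d n * c)
      \<longlonglongrightarrow> inner (op_apply (\<Phi> J) x) x + inner (op_apply (\<Phi> J) y) y + 0 * c"
    by (intro tendsto_intros d)
  moreover have "\<exists>N. \<forall>n\<ge>N. (1 - d n) * (2 * inner (op_apply (\<Phi> Z) x) y)
      \<le> inner (op_apply (\<Phi> J) x) x + inner (op_apply (\<Phi> J) y) y + d n * c"
    using approx by (simp add: d_def inverse_less_1_iff)
  ultimately have "(1 - 0) * (2 * inner (op_apply (\<Phi> Z) x) y)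
      \<le> inner (op_apply (\<Phi> J) x) x + inner (op_apply (\<Phi> J) y) y + 0 * c" by (rule LIMSEQ_le)
  then show ?thesis by simp
qed

section \<open>Order and strong limits of operators\<close>

lemma op_eq_0I: "(\<And>x. op_apply T x = 0) \<Longrightarrow> T = 0"
  by (rule op_eqI) (simp add: op_apply_simps)

lemma norm_op_apply_le: "norm (op_apply T x) \<le> norm T * norm x"
  by (simp add: norm_bounded_op.rep_eq norm_blinfun)

lemma norm_op_leI:
  assumes "0 \<le> s" "\<And>x. norm (op_apply T x) \<le> s * norm x" shows "norm T \<le> s"
  unfolding norm_bounded_op.rep_eq by (rule norm_blinfun_bound) (use assms in auto)

text \<open>If \<open>M\<close> is the negative part of \<open>T\<close>, then \<open>M T M = - M\<^sup>3\<close>, so nonnegativity of the form at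
  \<open>M x\<close> forces \<open>M\<^sup>3 = 0\<close>.\<close>

lemma cstar_positive_opI:
  fixes T :: "'h::complex_hilbert_space bounded_op"
  assumes sa: "star T = T" and form: "\<And>x. 0 \<le> inner (op_apply T x) x"
  shows "cstar_positive T"
proof (rule cstar_positive_if_negative_part_0[OF sa])
  define m :: "real \<Rightarrow> real" where "m t = max (- t) 0" for t
  define h where "h t = m t * sqrt (m t)" for t
  have cm: "continuous_on S m" for S unfolding m_def[abs_def] by (intro continuous_intros)
  have ch: "continuous_on S h" for S unfolding h_def[abs_def] by (intro continuous_intros cm)
  define M where "M = cfc m T"
  define H where "H = cfc h T"
  have sM: "star M = M" "star H = H" by (simp_all add: M_def H_def star_cfc[OF sa] cm ch)
  have cmt: "continuous_on S (\<lambda>t. m t * t)" for S by (intro continuous_intros cm)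
  have hh: "h t * h t = m t * m t * m t" for t
  proof -
    have "sqrt (m t) * sqrt (m t) = m t" by (simp add: m_def)
    then show ?thesis unfolding h_def by (metis mult.assoc mult.commute)
  qed
  have "M * T * M = cfc (\<lambda>t. m t * t * m t) T"
    using cfc_mult[OF sa cm, of "\<lambda>t. t"] cfc_mult[OF sa cmt cm]
    by (simp add: continuous_intros cfc_ident[OF sa] M_def)
  also have "\<dots> = cfc (\<lambda>t. (- 1) * (h t * h t)) T"
  proof (rule cfc_cong)
    fix t :: real
    show "m t * t * m t = (- 1) * (h t * h t)" unfolding hh by (simp add: m_def max_def)
  qed
  also have "\<dots> = - (H * H)"
    using cfc_scaleR[OF sa continuous_on_mult[OF ch ch], of "- 1"] cfc_mult[OF sa ch ch] by (simp add: H_def)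
  finally have MTM: "M * T * M = - (H * H)" .
  have "H = 0"
  proof (rule op_eq_0I)
    fix x
    have "0 \<le> inner (op_apply T (op_apply M x)) (op_apply M x)" by (rule form)
    also have "\<dots> = inner (op_apply (M * T * M) x) x"
      by (simp add: op_apply_simps inner_self_adjoint[OF sM(1)])
    also have "\<dots> = - inner (op_apply H x) (op_apply H x)"
      unfolding MTM by (simp add: op_apply_simps inner_self_adjoint[OF sM(2)])
    finally show "op_apply H x = 0" by (metis inner_gt_zero_iff neg_0_le_iff_le not_le)
  qed
  moreover have "M * M * (M * M) = M * (H * H)"
  proof -
    have cmm: "continuous_on S (\<lambda>t. m t * m t)" "continuous_on S (\<lambda>t. h t * h t)" for S
      by (intro continuous_intros cm ch)+
    have "M * M * (M * M) = cfc (\<lambda>t. (m t * m t) * (m t * m t)) T"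
      by (simp only: cfc_mult[OF sa cmm(1) cmm(1)] cfc_mult[OF sa cm cm] M_def)
    also have "\<dots> = cfc (\<lambda>t. m t * (h t * h t)) T"
    proof (rule cfc_cong)
      fix t :: real
      show "(m t * m t) * (m t * m t) = m t * (h t * h t)" unfolding hh by simp
    qed
    also have "\<dots> = M * (H * H)"
      by (simp only: cfc_mult[OF sa cm cmm(2)] cfc_mult[OF sa ch ch] M_def H_def)
    finally show ?thesis .
  qed
  ultimately have "M * M * (M * M) = 0" by simp
  then have "M * M = 0" by (rule self_adjoint_sq_eq_0[rotated]) (simp add: star_mult sM)
  then have "M = 0" by (rule self_adjoint_sq_eq_0[OF sM(1)])
  then show "cfc (\<lambda>t. max (- t) 0) T = 0" by (simp add: M_def m_def[abs_def])
qed

text \<open>With \<open>S = P\<^bsup>1/2\<^esup>\<close>: \<open>\<parallel>P x\<parallel> \<le> \<parallel>S\<parallel> \<parallel>S x\<parallel>\<close>, \<open>\<parallel>S\<parallel>\<^sup>2 = \<parallel>P\<parallel>\<close> and \<open>\<parallel>S x\<parallel>\<^sup>2 = \<langle>P x, x\<rangle>\<close>.\<close>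

lemma norm_positive_apply_le:
  fixes P :: "'h::complex_hilbert_space bounded_op"
  assumes P: "cstar_positive P" and s: "norm P \<le> s"
  shows "(norm (op_apply P x))\<^sup>2 \<le> s * inner (op_apply P x) x"
proof -
  define S where "S = cfc sqrt P"
  have S: "S * S = P" "star S = S" using sqrt_positive[OF P] by (simp_all add: S_def)
  have nS: "(norm S)\<^sup>2 = norm P" using norm_self_adjoint_sq[OF S(2)] S(1) by simp
  have "norm (op_apply P x) \<le> norm S * norm (op_apply S x)"
    unfolding S(1)[symmetric] using norm_op_apply_le by (simp add: op_apply_simps)
  then have "(norm (op_apply P x))\<^sup>2 \<le> (norm S * norm (op_apply S x))\<^sup>2"
    by (rule power_mono) simp
  also have "\<dots> = norm P * inner (op_apply P x) x"
    unfolding power_mult_distrib nS unfolding S(1)[symmetric]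
    by (simp add: op_apply_simps inner_self_adjoint[OF S(2)] power2_norm_eq_inner)
  also have "\<dots> \<le> s * inner (op_apply P x) x" by (intro mult_right_mono s inner_positive[OF P])
  finally show ?thesis .
qed

lemma strong_limit_exists:
  fixes T :: "nat \<Rightarrow> 'h::complex_hilbert_space bounded_op"
  assumes conv: "\<And>x. convergent (\<lambda>n. op_apply (T n) x)" and s: "\<And>n. norm (T n) \<le> s"
  obtains S where "\<And>x. (\<lambda>n. op_apply (T n) x) \<longlonglongrightarrow> op_apply S x"
proof -
  obtain L where L: "\<And>x. (\<lambda>n. op_apply (T n) x) \<longlonglongrightarrow> L x"
    using conv unfolding convergent_def by metis
  have add: "L (x + y) = L x + L y" for x y
    using tendsto_add[OF L[of x] L[of y]] L[of "x + y"] LIMSEQ_unique by (fastforce simp: op_apply_simps)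
  have scale: "L (c *\<^sub>C x) = c *\<^sub>C L x" for c x
    using bounded_linear.tendsto[OF bounded_linear_scaleC_hilbert L[of x], of c] L[of "c *\<^sub>C x"]
    unfolding op_apply_scaleC using LIMSEQ_unique by blast
  have "bounded_linear L"
  proof (rule bounded_linear_intro[where K = s])
    show "norm (L x) \<le> norm x * s" for x
    proof (rule LIMSEQ_le_const2[OF tendsto_norm[OF L]], intro exI allI impI)
      show "norm (op_apply (T n) x) \<le> norm x * s" for n
        using norm_op_apply_le[of "T n" x] mult_right_mono[OF s[of n] norm_ge_zero[of x]] by (simp add: mult.commute)
    qed
  qed (simp_all add: add scale scaleR_scaleC)
  then have "op_apply (Abs_bounded_op (Blinfun L)) = L"
    by (subst Abs_bounded_op_inverse) (simp_all add: bounded_linear_Blinfun_apply clinear_def add scale)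
  then show ?thesis using that[of "Abs_bounded_op (Blinfun L)"] L by simp
qed

text \<open>The numbers \<open>\<langle>T\<^sub>n x, x\<rangle>\<close> converge by monotonicity, and the estimate of \<open>\<parallel>P x\<parallel>\<^sup>2\<close> for the
  positive operator \<open>P = T\<^sub>n - T\<^sub>m\<close> makes \<open>T\<^sub>n x\<close> a Cauchy sequence.\<close>

lemma increasing_operators_converge:
  fixes T :: "nat \<Rightarrow> 'h::complex_hilbert_space bounded_op"
  assumes inc: "\<And>m n. m \<le> n \<Longrightarrow> cstar_positive (T n - T m)" and s: "\<And>n. norm (T n) \<le> s"
  obtains S where "\<And>x. (\<lambda>n. op_apply (T n) x) \<longlonglongrightarrow> op_apply S x"
proof (rule strong_limit_exists[OF _ s])
  fix x
  define q where "q n = inner (op_apply (T n) x) x" for n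
  have s0: "0 \<le> s" using s[of 0] norm_ge_zero order_trans by blast
  have diff: "(norm (op_apply (T n) x - op_apply (T m) x))\<^sup>2 \<le> 2 * s * (q n - q m)" if "m \<le> n" for m n
    using norm_positive_apply_le[OF inc[OF that], of "2 * s" x] norm_triangle_ineq4[of "T n" "T m"] s[of n] s[of m]
    by (simp add: op_apply_simps inner_diff_left q_def)
  have "incseq q"
    using inner_positive[OF inc] by (simp add: incseq_def q_def op_apply_simps inner_diff_left)
  moreover have "q n \<le> s * norm x * norm x" for n
  proof -
    have "q n \<le> norm (op_apply (T n) x) * norm x" unfolding q_def by (rule norm_cauchy_schwarz)
    also have "\<dots> \<le> s * norm x * norm x"
      using norm_op_apply_le[of "T n" x] mult_right_mono[OF s[of n] norm_ge_zero[of x]]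
      by (intro mult_right_mono) auto
    finally show ?thesis .
  qed
  ultimately have "convergent q" using incseq_convergent unfolding convergent_def by metis
  then have Cq: "Cauchy q" by (simp add: Cauchy_convergent_iff)
  have "Cauchy (\<lambda>n. op_apply (T n) x)"
  proof (rule metric_CauchyI)
    fix e :: real assume e: "e > 0"
    define e' where "e' = e\<^sup>2 / (2 * s + 1)"
    have e': "e' > 0" using e s0 by (simp add: e'_def)
    obtain N where N: "\<And>m n. m \<ge> N \<Longrightarrow> n \<ge> N \<Longrightarrow> dist (q m) (q n) < e'"
      using metric_CauchyD[OF Cq e'] by blast
    have "dist (op_apply (T m) x) (op_apply (T n) x) < e" if "N \<le> m" "m \<le> n" for m n
    proof -
      have "(norm (op_apply (T n) x - op_apply (T m) x))\<^sup>2 \<le> 2 * s * (q n - q m)" by (rule diff[OF that(2)])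
      also have "\<dots> \<le> 2 * s * e'"
        using N[of n m] that s0 by (intro mult_left_mono) (auto simp: dist_real_def)
      also have "\<dots> < e\<^sup>2" using s0 e by (simp add: e'_def divide_less_eq mult.commute)
      finally show ?thesis using e by (simp add: dist_norm norm_minus_commute power2_less_imp_less)
    qed
    then have "dist (op_apply (T m) x) (op_apply (T n) x) < e" if "N \<le> m" "N \<le> n" for m n
      using that by (metis dist_commute nle_le)
    then show "\<exists>N. \<forall>m\<ge>N. \<forall>n\<ge>N. dist (op_apply (T m) x) (op_apply (T n) x) < e" by blast
  qed
  then show "convergent (\<lambda>n. op_apply (T n) x)" by (simp add: Cauchy_convergent_iff)
qed (rule that)

lemma limitin_pullback_UNIV:
  "limitin (pullback_topology UNIV h T) f l F \<longleftrightarrow> limitin T (\<lambda>i. h (f i)) (h l) F"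
proof -
  have "(\<forall>U. openin (pullback_topology UNIV h T) U \<and> l \<in> U \<longrightarrow> (\<forall>\<^sub>F i in F. f i \<in> U))
      \<longleftrightarrow> (\<forall>V. openin T V \<and> h l \<in> V \<longrightarrow> (\<forall>\<^sub>F i in F. h (f i) \<in> V))"
    (is "?L \<longleftrightarrow> ?R")
  proof
    assume L: ?L
    show ?R
    proof (intro allI impI)
      fix V assume "openin T V \<and> h l \<in> V"
      then have "openin (pullback_topology UNIV h T) (h -` V) \<and> l \<in> h -` V"
        by (auto simp: openin_pullback_topology)
      then show "\<forall>\<^sub>F i in F. h (f i) \<in> V" using L by fastforce
    qed
  next
    assume R: ?R
    show ?L
    proof (intro allI impI)
      fix U assume U: "openin (pullback_topology UNIV h T) U \<and> l \<in> U"
      then obtain V where "openin T V" "U = h -` V" by (auto simp: openin_pullback_topology)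
      then show "\<forall>\<^sub>F i in F. f i \<in> U" using U R by simp
    qed
  qed
  then show ?thesis by (simp add: limitin_def topspace_pullback_topology)
qed

lemma limitin_op_sot:
  "limitin op_sot f S F \<longleftrightarrow> (\<forall>x. ((\<lambda>i. op_apply (f i) x) \<longlongrightarrow> op_apply S x) F)"
  unfolding op_sot_def strong_operator_topology_def limitin_pullback_UNIV
    euclidean_product_topology[symmetric] limitin_componentwise
  by simp

section \<open>Block positivity and the geometric mean\<close>

text \<open>Positivity of the operator matrix with diagonal \<open>A, B\<close> and off-diagonal entry \<open>- X\<close>, as a
  statement about quadratic forms. The real inner product suffices, and replacing \<open>y\<close> by \<open>- y\<close> shows
  that the sign of \<open>X\<close> does not matter.\<close>

definition block_positive ::
    "'h::complex_hilbert_space bounded_op \<Rightarrow> 'h bounded_op \<Rightarrow> 'h bounded_op \<Rightarrow> bool" where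
  "block_positive A X B \<longleftrightarrow>
     (\<forall>x y. 2 * inner (op_apply X x) y \<le> inner (op_apply A x) x + inner (op_apply B y) y)"

lemma block_positive_add:
  assumes "block_positive A X B" "cstar_positive A'" "cstar_positive B'"
  shows "block_positive (A + A') X (B + B')"
  unfolding block_positive_def
proof (intro allI)
  fix x y
  show "2 * inner (op_apply X x) y \<le> inner (op_apply (A + A') x) x + inner (op_apply (B + B') y) y"
    using assms(1)[unfolded block_positive_def, rule_format, of x y]
      inner_positive[OF assms(2), of x] inner_positive[OF assms(3), of y]
    by (simp add: op_apply_simps inner_add_left)
qed

text \<open>\<open>D\<close> is the square root \<open>(A\<^bsup>-1/2\<^esup> B A\<^bsup>-1/2\<^esup>)\<^bsup>1/2\<^esup>\<close>.\<close>

lemma geometric_mean_invertible_decompose: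
  fixes A B :: "'h::complex_hilbert_space bounded_op"
  assumes A: "cstar_positive A" "cstar_invertible A" and B: "cstar_positive B" "cstar_invertible B"
  obtains R R' D where "star R = R" "R * R = A" "star R' = R'" "R * R' = 1" "R' * R = 1" "R' * A * R' = 1"
    "cstar_positive D" "cstar_invertible D" "D * D = R' * B * R'"
    "geometric_mean_invertible A B = R * D * R"
proof -
  define R where "R = cfc sqrt A"
  define R' where "R' = cfc (\<lambda>t. 1 / sqrt t) A"
  define D where "D = cfc sqrt (R' * B * R')"
  note r = sqrt_positive[OF A(1), folded R_def] and r' = inverse_sqrt_positive[OF A, folded R_def R'_def]
  have p: "cstar_positive (R' * B * R')" using cstar_positive_conjugate[OF B(1), of R'] by (simp add: r'(3))
  have i: "cstar_invertible (R' * B * R')"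
    using cstar_invertibleI[OF r'(2,1)] B(2) by (intro cstar_invertible_mult)
  have "D * cfc (\<lambda>t. 1 / sqrt t) (R' * B * R') = 1" "cfc (\<lambda>t. 1 / sqrt t) (R' * B * R') * D = 1"
    using inverse_sqrt_positive(1,2)[OF p i] by (simp_all add: D_def)
  then have "cstar_invertible D" by (rule cstar_invertibleI)
  then show ?thesis
    using that[of R R' D] r r' sqrt_positive[OF p, folded D_def]
    by (simp add: geometric_mean_invertible_def R_def R'_def D_def Let_def)
qed

text \<open>Since \<open>\<langle>G x, y\<rangle> = \<langle>R x, D R y\<rangle>\<close>, \<open>\<parallel>R x\<parallel>\<^sup>2 = \<langle>A x, x\<rangle>\<close> and \<open>\<parallel>D R y\<parallel>\<^sup>2 = \<langle>B y, y\<rangle>\<close>, the claim is the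
  arithmetic-geometric mean inequality for two vectors.\<close>

lemma geometric_mean_invertible_block_positive:
  fixes A B :: "'h::complex_hilbert_space bounded_op"
  assumes A: "cstar_positive A" "cstar_invertible A" and B: "cstar_positive B" "cstar_invertible B"
  shows "cstar_positive (geometric_mean_invertible A B)"
    "block_positive A (geometric_mean_invertible A B) B"
proof -
  obtain R R' D where R: "star R = R" "R * R = A" "star R' = R'" "R * R' = 1" "R' * R = 1"
    and D: "cstar_positive D" "D * D = R' * B * R'" and G: "geometric_mean_invertible A B = R * D * R"
    by (rule geometric_mean_invertible_decompose[OF assms])
  show "cstar_positive (geometric_mean_invertible A B)"
    unfolding G using cstar_positive_conjugate[OF D(1), of R] by (simp add: R(1))
  note sD = cstar_positive_star[OF D(1)]
  have "R * D * (D * R) = (R * R') * B * (R' * R)" using D(2) by (simp add: mult.assoc) (simp flip: mult.assoc)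
  then have BD: "R * D * (D * R) = B" by (simp add: R)
  show "block_positive A (geometric_mean_invertible A B) B"
    unfolding block_positive_def
  proof (intro allI)
    fix x y
    define u where "u = op_apply R x"
    define v where "v = op_apply (D * R) y"
    have "2 * inner u v \<le> inner u u + inner v v"
      using inner_ge_zero[of "u - v"] by (simp add: inner_diff_left inner_diff_right inner_commute)
    moreover have "inner u u = inner (op_apply A x) x"
      by (simp add: u_def op_apply_simps inner_self_adjoint[OF R(1)] flip: R(2))
    moreover have "inner v v = inner (op_apply B y) y"
      by (subst BD[symmetric]) (simp add: v_def op_apply_simps inner_self_adjoint[OF R(1)] inner_self_adjoint[OF sD])
    moreover have "inner u v = inner (op_apply (geometric_mean_invertible A B) x) y"
      by (simp add: G u_def v_def op_apply_simps inner_self_adjoint[OF R(1)] inner_self_adjoint[OF sD])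
    ultimately show "2 * inner (op_apply (geometric_mean_invertible A B) x) y
        \<le> inner (op_apply A x) x + inner (op_apply B y) y" by simp
  qed
qed

text \<open>Operator monotonicity of the square root, in the form needed: \<open>Y\<^sup>2 \<le> D\<^sup>2\<close> means
  \<open>\<parallel>Y D\<inverse>\<parallel> \<le> 1\<close>, and \<open>D\<^bsup>-1/2\<^esup> Y D\<^bsup>-1/2\<^esup>\<close> is similar to \<open>Y D\<inverse>\<close>, so its norm, being its spectral
  radius, is at most \<open>1\<close> as well.\<close>

lemma self_adjoint_le_of_norm_le:
  fixes Y D :: "'h::complex_hilbert_space bounded_op"
  assumes Y: "star Y = Y" and D: "cstar_positive D" "cstar_invertible D"
    and le: "\<And>x. norm (op_apply Y x) \<le> norm (op_apply D x)"
  shows "Y \<preceq> D"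
proof -
  define H where "H = cfc sqrt D"
  define H' where "H' = cfc (\<lambda>t. 1 / sqrt t) D"
  note h = sqrt_positive[OF D(1), folded H_def] and h' = inverse_sqrt_positive[OF D, folded H_def H'_def]
  have DH: "D * (H' * H') = 1"
  proof -
    have "D * (H' * H') = H * (H * H') * H'" by (simp add: mult.assoc flip: h(1))
    then show ?thesis by (simp add: h'(1))
  qed
  define T where "T = H' * (Y * H')"
  have sT: "star T = T" by (simp add: T_def star_mult Y h'(3) mult.assoc)
  have n: "norm (Y * H' * H') \<le> 1"
  proof (rule norm_op_leI)
    fix x
    have "op_apply D (op_apply (H' * H') x) = x"
      using DH by (metis op_apply_simps(4,6))
    then show "norm (op_apply (Y * H' * H') x) \<le> 1 * norm x"
      using le[of "op_apply (H' * H') x"] by (simp add: op_apply_simps)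
  qed simp
  have "norm T \<le> 1"
  proof (rule norm_le_of_real_spectrum[OF sT])
    fix t assume t: "t \<in> real_spectrum T"
    show "\<bar>t\<bar> \<le> 1"
    proof (cases "t = 0")
      case False
      then have "t \<in> real_spectrum (Y * H' * H')"
        using t spectrum_mult_commute[of "complex_of_real t" H' "Y * H'"] by (simp add: real_spectrum_def T_def)
      then show ?thesis using abs_real_spectrum_le n by fastforce
    qed simp
  qed simp
  then have "cstar_positive (1 *\<^sub>R 1 - T)" by (rule cstar_positive_norm_diff[OF sT])
  then have "cstar_positive (star H * (1 *\<^sub>R 1 - T) * H)" by (rule cstar_positive_conjugate)
  also have "star H * (1 *\<^sub>R 1 - T) * H = D - (H * H') * Y * (H' * H)"
    by (simp add: h T_def right_diff_distrib left_diff_distrib mult.assoc)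
  finally show ?thesis by (simp add: cstar_le_def h'(1,2))
qed

text \<open>Put \<open>Y = A\<^bsup>-1/2\<^esup> X A\<^bsup>-1/2\<^esup>\<close>. Block positivity at \<open>x = A\<^bsup>-1/2\<^esup> Y v\<close> and \<open>y = A\<^bsup>-1/2\<^esup> v\<close> reads
  \<open>2 \<parallel>Y v\<parallel>\<^sup>2 \<le> \<parallel>Y v\<parallel>\<^sup>2 + \<parallel>D v\<parallel>\<^sup>2\<close>, so \<open>Y \<le> D\<close>, and conjugation by \<open>A\<^bsup>1/2\<^esup>\<close> gives the claim.\<close>

lemma geometric_mean_invertible_greatest:
  fixes A B X :: "'h::complex_hilbert_space bounded_op"
  assumes A: "cstar_positive A" "cstar_invertible A" and B: "cstar_positive B" "cstar_invertible B"
    and X: "star X = X" and block: "block_positive A X B"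
  shows "X \<preceq> geometric_mean_invertible A B"
proof -
  obtain R R' D where R: "star R = R" "R * R = A" "star R' = R'" "R * R' = 1" "R' * R = 1" "R' * A * R' = 1"
    and D: "cstar_positive D" "cstar_invertible D" "D * D = R' * B * R'"
    and G: "geometric_mean_invertible A B = R * D * R"
    by (rule geometric_mean_invertible_decompose[OF A B])
  define Y where "Y = R' * X * R'"
  have sY: "star Y = Y" by (simp add: Y_def star_mult R(3) X mult.assoc)
  have "norm (op_apply Y v) \<le> norm (op_apply D v)" for v
  proof -
    define x where "x = op_apply R' (op_apply Y v)"
    define y where "y = op_apply R' v"
    have "2 * inner (op_apply X x) y \<le> inner (op_apply A x) x + inner (op_apply B y) y"
      using block by (simp add: block_positive_def)
    moreover have "inner (op_apply X x) y = inner (op_apply Y v) (op_apply Y v)"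
    proof -
      have "inner (op_apply X x) y = inner (op_apply Y (op_apply Y v)) v"
        by (simp add: x_def y_def Y_def op_apply_simps inner_self_adjoint[OF R(3)])
      then show ?thesis by (simp add: inner_self_adjoint[OF sY])
    qed
    moreover have "inner (op_apply A x) x = inner (op_apply Y v) (op_apply Y v)"
    proof -
      have "inner (op_apply A x) x = inner (op_apply (R' * A * R') (op_apply Y v)) (op_apply Y v)"
        by (simp add: x_def op_apply_simps inner_self_adjoint[OF R(3)])
      then show ?thesis by (simp add: R(6) op_apply_simps)
    qed
    moreover have "inner (op_apply B y) y = inner (op_apply D v) (op_apply D v)"
    proof -
      have "inner (op_apply B y) y = inner (op_apply (D * D) v) v"
        by (simp add: y_def D(3) op_apply_simps inner_self_adjoint[OF R(3)])
      then show ?thesis by (simp add: op_apply_simps inner_self_adjoint[OF cstar_positive_star[OF D(1)]])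
    qed
    ultimately have "(norm (op_apply Y v))\<^sup>2 \<le> (norm (op_apply D v))\<^sup>2" by (simp add: power2_norm_eq_inner)
    then show ?thesis by (rule power2_le_imp_le) simp
  qed
  then have "cstar_positive (D - Y)"
    using self_adjoint_le_of_norm_le[OF sY D(1,2)] by (simp add: cstar_le_def)
  then have "cstar_positive (star R * (D - Y) * R)" by (rule cstar_positive_conjugate)
  also have "star R * (D - Y) * R = R * D * R - (R * R') * X * (R' * R)"
    by (simp add: R(1) Y_def right_diff_distrib left_diff_distrib mult.assoc)
  finally show ?thesis by (simp add: cstar_le_def G R(4,5))
qed

lemma norm_positive_mono:
  fixes P Q :: "'a::cstar_algebra"
  assumes P: "cstar_positive P" and le: "P \<preceq> Q" shows "norm P \<le> norm Q"
proof (rule norm_le_of_real_spectrum)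
  show "star P = P" using P by (rule cstar_positive_star)
  have Q: "cstar_positive Q" using cstar_positive_add[OF P le[unfolded cstar_le_def]] by simp
  have "cstar_positive ((norm Q *\<^sub>R 1 - Q) + (Q - P))"
    using le by (intro cstar_positive_add cstar_positive_norm_diff cstar_positive_star[OF Q]) (simp_all add: cstar_le_def)
  then have pos: "cstar_positive (norm Q *\<^sub>R 1 - P)" by simp
  fix t assume t: "t \<in> real_spectrum P"
  have "norm Q - t \<in> real_spectrum (norm Q *\<^sub>R 1 - P)" using t by (simp only: real_spectrum_reflect)
  then have "0 \<le> norm Q - t" using pos unfolding cstar_positive_iff by blast
  then show "\<bar>t\<bar> \<le> norm Q" using t P by (simp add: cstar_positive_iff)
qed simp

text \<open>The limit is found along \<open>1 / (n + 1)\<close>; monotonicity of the family, through the estimate of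
  \<open>\<parallel>(G\<^sub>d - G\<^sub>e) x\<parallel>\<^sup>2\<close> by the decrease of the quadratic form, carries the convergence over from the
  sequence to the whole family.\<close>

lemma decreasing_at_right_0_converges:
  fixes G :: "real \<Rightarrow> 'h::complex_hilbert_space bounded_op"
  assumes pos: "\<And>e. 0 < e \<Longrightarrow> cstar_positive (G e)"
    and mono: "\<And>e d. 0 < e \<Longrightarrow> e \<le> d \<Longrightarrow> G e \<preceq> G d"
  obtains L where "limitin op_sot G L (at_right 0)"
proof -
  define s where "s = norm (G 1)"
  define e where "e n = inverse (real (Suc n))" for n
  have e: "0 < e n" "e n \<le> 1" for n by (simp_all add: e_def inverse_le_1_iff)
  have edec: "e n \<le> e m" if "m \<le> n" for m n using that by (simp add: e_def le_imp_inverse_le)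
  have s: "norm (G d) \<le> s" if "0 < d" "d \<le> 1" for d
    unfolding s_def by (rule norm_positive_mono[OF pos mono]) (use that in auto)
  obtain L' where L': "\<And>x. (\<lambda>n. op_apply (- G (e n)) x) \<longlonglongrightarrow> op_apply L' x"
  proof (rule increasing_operators_converge[of "\<lambda>n. - G (e n)"])
    show "cstar_positive (- G (e n) - - G (e m))" if "m \<le> n" for m n
      using mono[OF e(1) edec[OF that]] by (simp add: cstar_le_def)
    show "norm (- G (e n)) \<le> s" for n using s e by simp
  qed (rule that)
  define L where "L = - L'"
  have L: "(\<lambda>n. op_apply (G (e n)) x) \<longlonglongrightarrow> op_apply L x" for x
    using tendsto_minus[OF L'[of x]] by (simp add: L_def op_apply_simps)
  have "((\<lambda>d. op_apply (G d) x) \<longlongrightarrow> op_apply L x) (at_right 0)" for x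
  proof -
    define q where "q d = inner (op_apply (G d) x) x" for d
    have q: "q d \<le> q d'" if "0 < d" "d \<le> d'" for d d'
      using inner_positive[OF mono[OF that, unfolded cstar_le_def], of x] by (simp add: q_def op_apply_simps inner_diff_left)
    have diff: "(norm (op_apply (G d') x - op_apply (G d) x))\<^sup>2 \<le> s * (q d' - q d)"
      if "0 < d" "d \<le> d'" "d' \<le> 1" for d d'
    proof -
      have "G d' - G d \<preceq> G d'" using pos[OF that(1)] by (simp add: cstar_le_def)
      then have "norm (G d' - G d) \<le> norm (G d')"
        using mono[OF that(1,2)] by (intro norm_positive_mono) (simp_all add: cstar_le_def)
      also have "\<dots> \<le> s" using that by (intro s) auto
      finally show ?thesis
        using norm_positive_apply_le[OF mono[OF that(1,2), unfolded cstar_le_def], of s x]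
        by (simp add: q_def op_apply_simps inner_diff_left)
    qed
    define ql where "ql = inner (op_apply L x) x"
    have ql: "(\<lambda>n. q (e n)) \<longlonglongrightarrow> ql" unfolding q_def ql_def by (intro tendsto_intros L)
    have e0: "e \<longlonglongrightarrow> 0" unfolding e_def[abs_def] by (rule LIMSEQ_inverse_real_of_nat)
    have near: "(norm (op_apply (G d) x - op_apply L x))\<^sup>2 \<le> s * (q d - ql)" if d: "0 < d" "d \<le> 1" for d
    proof (rule LIMSEQ_le)
      show "(\<lambda>n. (norm (op_apply (G d) x - op_apply (G (e n)) x))\<^sup>2) \<longlonglongrightarrow> (norm (op_apply (G d) x - op_apply L x))\<^sup>2"
        by (intro tendsto_intros L)
      show "(\<lambda>n. s * (q d - q (e n))) \<longlonglongrightarrow> s * (q d - ql)" by (intro tendsto_intros ql)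
      obtain N where "\<And>n. n \<ge> N \<Longrightarrow> e n < d"
        using order_tendstoD(2)[OF e0 d(1)] by (auto simp: eventually_sequentially)
      then show "\<exists>N. \<forall>n\<ge>N. (norm (op_apply (G d) x - op_apply (G (e n)) x))\<^sup>2 \<le> s * (q d - q (e n))"
        using diff[OF e(1) _ d(2)] less_imp_le by blast
    qed
    have s0: "0 \<le> s" by (simp add: s_def)
    show ?thesis
      unfolding tendsto_iff
    proof (intro allI impI)
      fix r :: real assume r: "r > 0"
      define r' where "r' = r\<^sup>2 / (s + 1)"
      have r': "r' > 0" using r s0 by (simp add: r'_def)
      obtain n where n: "dist (q (e n)) ql < r'"
        using metric_LIMSEQ_D[OF ql r'] by blast
      have "dist (op_apply (G d) x) (op_apply L x) < r" if d: "0 < d" "d < e n" for d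
      proof -
        have "(norm (op_apply (G d) x - op_apply L x))\<^sup>2 \<le> s * (q d - ql)"
          using d e(2)[of n] by (intro near) auto
        also have "\<dots> \<le> s * r'"
          using q[of d "e n"] d n s0 by (intro mult_left_mono) (auto simp: dist_real_def)
        also have "\<dots> < r\<^sup>2" using s0 r by (simp add: r'_def divide_less_eq mult.commute)
        finally show ?thesis using r by (simp add: dist_norm power2_less_imp_less)
      qed
      then show "\<forall>\<^sub>F d in at_right 0. dist (op_apply (G d) x) (op_apply L x) < r"
        using e(1)[of n] by (auto simp: eventually_at_right_field)
    qed
  qed
  then show ?thesis by (intro that[of L]) (simp add: limitin_op_sot)
qed

text \<open>The regularized means \<open>G\<^sub>e\<close> decrease with \<open>e\<close>, because \<open>G\<^sub>e\<close> is an admissible off-diagonal entry for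
  every \<open>d \<ge> e\<close> and \<open>G\<^sub>d\<close> is the largest one. So they have a strong limit, which is the geometric mean.
  The operator \<open>X\<close> is admissible for every \<open>e\<close>, hence lies below all \<open>G\<^sub>e\<close> and below their limit.\<close>

lemma geometric_mean_greatest:
  fixes A B X :: "'h::complex_hilbert_space bounded_op"
  assumes A: "cstar_positive A" and B: "cstar_positive B"
    and X: "star X = X" and block: "block_positive A X B"
  shows "X \<preceq> A #\<^sub>g B"
proof (cases "cstar_invertible A \<and> cstar_invertible B")
  case True
  then show ?thesis
    using geometric_mean_invertible_greatest[OF A _ B _ X block] by (simp add: geometric_mean_def)
next
  case False
  define G where "G e = geometric_mean_invertible (A + e *\<^sub>R 1) (B + e *\<^sub>R 1)" for e
  note Ae = cstar_invertible_add_scaleR[OF A] and Be = cstar_invertible_add_scaleR[OF B]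
  have posG: "cstar_positive (G e)" and blockG: "block_positive (A + e *\<^sub>R 1) (G e) (B + e *\<^sub>R 1)"
    if "0 < e" for e
    unfolding G_def by (intro geometric_mean_invertible_block_positive Ae Be that)+
  have mono: "G e \<preceq> G d" if "0 < e" "e \<le> d" for e d
  proof -
    have "cstar_positive ((d - e) *\<^sub>R (1::'h bounded_op))"
      using that by (intro cstar_positive_scaleR) auto
    from block_positive_add[OF blockG[OF that(1)] this this]
    have "block_positive (A + d *\<^sub>R 1) (G e) (B + d *\<^sub>R 1)"
      by (simp add: scaleR_diff_left)
    then show ?thesis
      unfolding G_def[of d] using that
      by (intro geometric_mean_invertible_greatest Ae Be cstar_positive_star[OF posG]) auto
  qed
  have le: "X \<preceq> G e" if "0 < e" for e
  proof -
    have "cstar_positive (e *\<^sub>R (1::'h bounded_op))" using that by (intro cstar_positive_scaleR) auto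
    then show ?thesis
      unfolding G_def using that
      by (intro geometric_mean_invertible_greatest Ae Be X block_positive_add[OF block]) auto
  qed
  obtain L where L: "limitin op_sot G L (at_right 0)"
    by (rule decreasing_at_right_0_converges[of G]) (use posG mono in auto)
  have lim: "((\<lambda>e. op_apply (G e) x) \<longlongrightarrow> op_apply L x) (at_right 0)" for x
    using L by (simp add: limitin_op_sot)
  have "A #\<^sub>g B = L"
    unfolding geometric_mean_def using False
  proof (simp only: if_False G_def[symmetric], intro the_equality L)
    fix L' assume "limitin op_sot G L' (at_right 0)"
    then show "L' = L"
      by (intro op_eqI tendsto_unique[OF trivial_limit_at_right_real _ lim]) (simp add: limitin_op_sot)
  qed
  moreover have "cstar_positive (L - X)"
  proof (rule cstar_positive_opI)
    have "inner (op_apply L x) y = inner x (op_apply L y)" for x y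
    proof (rule tendsto_unique[OF trivial_limit_at_right_real])
      show "((\<lambda>e. inner (op_apply (G e) x) y) \<longlongrightarrow> inner (op_apply L x) y) (at_right 0)"
        by (intro tendsto_intros lim)
      have "((\<lambda>e. inner x (op_apply (G e) y)) \<longlongrightarrow> inner x (op_apply L y)) (at_right 0)"
        by (intro tendsto_intros lim)
      moreover have "\<forall>\<^sub>F e in at_right 0. inner x (op_apply (G e) y) = inner (op_apply (G e) x) y"
        using eventually_at_right_less[of 0]
        by eventually_elim (simp add: inner_self_adjoint[OF cstar_positive_star[OF posG]])
      ultimately show "((\<lambda>e. inner (op_apply (G e) x) y) \<longlongrightarrow> inner x (op_apply L y)) (at_right 0)"
        using tendsto_cong by fast
    qed
    then have "star L = L" by (intro op_inner_eqI) (simp add: inner_star)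
    then show "star (L - X) = L - X" by (simp add: star_diff X)
    fix x
    have "((\<lambda>e. inner (op_apply (G e) x) x - inner (op_apply X x) x)
        \<longlongrightarrow> inner (op_apply L x) x - inner (op_apply X x) x) (at_right 0)"
      by (intro tendsto_intros lim)
    moreover have "\<forall>\<^sub>F e in at_right 0. 0 \<le> inner (op_apply (G e) x) x - inner (op_apply X x) x"
      using eventually_at_right_less[of 0]
      by eventually_elim
        (use inner_positive[OF le[unfolded cstar_le_def], of _ x] in \<open>simp add: op_apply_simps inner_diff_left\<close>)
    ultimately have "0 \<le> inner (op_apply L x) x - inner (op_apply X x) x"
      by (rule tendsto_lowerbound) (rule trivial_limit_at_right_real)
    then show "0 \<le> inner (op_apply (L - X) x) x" by (simp add: op_apply_simps inner_diff_left)
  qed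
  ultimately show ?thesis by (simp add: cstar_le_def)
qed

section \<open>Polar decomposition in a von Neumann algebra\<close>

lemma von_neumann_algebra_strong_limit:
  assumes M: "von_neumann_algebra M" and T: "\<And>n::nat. T n \<in> M"
    and S: "\<And>x. (\<lambda>n. op_apply (T n) x) \<longlonglongrightarrow> op_apply S x"
  shows "S \<in> M"
proof (rule limitin_closedin)
  show "limitin op_sot T S sequentially" using S by (simp add: limitin_op_sot)
  show "closedin op_sot M" using M by (simp add: von_neumann_algebra_def)
qed (use T in auto)

lemma von_neumann_algebra_cfc:
  fixes a :: "'h::complex_hilbert_space bounded_op"
  assumes M: "von_neumann_algebra M" and a: "a \<in> M" and sa: "star a = a"
    and f: "continuous_on (real_spectrum a) f"
  shows "cfc f a \<in> M"
proof -
  have cl: "1 \<in> M" "\<And>S T. S \<in> M \<Longrightarrow> T \<in> M \<Longrightarrow> S + T \<in> M" "\<And>S T. S \<in> M \<Longrightarrow> T \<in> M \<Longrightarrow> S * T \<in> M"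
    "\<And>c T. T \<in> M \<Longrightarrow> c *\<^sub>C T \<in> M"
    using M by (auto simp: von_neumann_algebra_def)
  have poly: "cstar_poly p a \<in> M" for p
  proof (induction p)
    case 0
    then show ?case using cl(4)[OF a, of 0] by simp
  next
    case (pCons c p)
    then show ?case unfolding cstar_poly_pCons scaleR_scaleC by (intro cl a)
  qed
  obtain p where p: "(\<lambda>n. cstar_poly (p n) a) \<longlonglongrightarrow> cfc f a" using cfc_approx[OF sa f] by blast
  have "(\<lambda>n. op_apply (cstar_poly (p n) a) x) \<longlonglongrightarrow> op_apply (cfc f a) x" for x
  proof -
    have "(\<lambda>n. norm (cstar_poly (p n) a - cfc f a) * norm x) \<longlonglongrightarrow> 0"
      using p by (intro tendsto_mult_left_zero) (simp add: LIM_zero tendsto_norm_zero)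
    then have "(\<lambda>n. op_apply (cstar_poly (p n) a - cfc f a) x) \<longlonglongrightarrow> 0"
      by (rule Lim_null_comparison[rotated]) (simp add: norm_op_apply_le)
    then show ?thesis by (simp add: op_apply_simps LIM_zero_iff)
  qed
  then show ?thesis using von_neumann_algebra_strong_limit[OF M poly] by blast
qed

text \<open>With \<open>P = |W|\<close> and \<open>e\<^sub>n = P (P + c\<^sub>n)\<inverse>\<close>, \<open>c\<^sub>n \<rightarrow> 0\<close>, the operators \<open>e\<^sub>n\<close> increase strongly to
  the range projection \<open>E\<close> of \<open>P\<close>. Because \<open>\<parallel>W y\<parallel> = \<parallel>P y\<parallel>\<close>, the operators \<open>W (P + c\<^sub>n)\<inverse>\<close> converge
  along with them, and their limit is the partial isometry \<open>U\<close>.\<close>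

theorem von_neumann_polar_decomposition:
  fixes W :: "'h::complex_hilbert_space bounded_op"
  assumes M: "von_neumann_algebra M" and W: "W \<in> M"
  obtains U where "U \<in> M" "partial_isometry (star U)" "star U * W = cstar_abs W"
proof -
  define P where "P = cstar_abs W"
  note P = cstar_abs_props[of W, folded P_def]
  have Pt: "0 \<le> t" if "t \<in> real_spectrum P" for t using P(1) that by (simp add: cstar_positive_iff)
  have clM: "S * T \<in> M" if "S \<in> M" "T \<in> M" for S T using M that by (simp add: von_neumann_algebra_def)
  have stM: "star T \<in> M" if "T \<in> M" for T using M that by (simp add: von_neumann_algebra_def)
  have PM: "P \<in> M"
    unfolding P_def cstar_abs_def
    by (rule von_neumann_algebra_cfc[OF M]) (auto simp: clM stM W star_mult star_star intro: continuous_intros)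
  have normP: "norm (op_apply W y) = norm (op_apply P y)" for y
  proof -
    have "(norm (op_apply W y))\<^sup>2 = inner (op_apply (star W * W) y) y"
      by (simp add: power2_norm_eq_inner op_apply_simps inner_star)
    also have "\<dots> = (norm (op_apply P y))\<^sup>2"
      by (simp add: power2_norm_eq_inner op_apply_simps inner_self_adjoint[OF P(2)] flip: P(3))
    finally show ?thesis by simp
  qed
  define c where "c n = inverse (real (Suc n))" for n
  have c: "0 < c n" for n by (simp add: c_def)
  have c0: "c \<longlonglongrightarrow> 0" unfolding c_def[abs_def] by (rule LIMSEQ_inverse_real_of_nat)
  have cdec: "c n \<le> c m" if "m \<le> n" for m n using that by (simp add: c_def le_imp_inverse_le)
  have tc: "t + c n > 0" if "t \<in> real_spectrum P" for t n using Pt[OF that] c[of n] by simp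
  define r where "r n = cfc (\<lambda>t. 1 / (t + c n)) P" for n
  define e where "e n = cfc (\<lambda>t. t * (1 / (t + c n))) P" for n
  have cont_r: "continuous_on (real_spectrum P) (\<lambda>t. 1 / (t + c n))" for n
    using tc by (intro continuous_intros) (metis less_irrefl)
  have cont_e: "continuous_on (real_spectrum P) (\<lambda>t. t * (1 / (t + c n)))" for n
    by (intro continuous_on_mult continuous_on_id cont_r)
  have se: "star (e n) = e n" for n unfolding e_def by (rule star_cfc[OF P(2) cont_e])
  have Pr: "P * r n = e n" for n
    using cfc_mult[OF P(2) continuous_on_id cont_r] by (simp add: e_def r_def cfc_ident[OF P(2)])
  have rP: "r n * P = e n" for n
    using cfc_mult[OF P(2) cont_r continuous_on_id] by (simp add: e_def r_def cfc_ident[OF P(2)] mult.commute)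
  have ne: "norm (e n) \<le> 1" for n
    unfolding e_def
  proof (rule norm_cfc_le[OF P(2) cont_e])
    fix t assume "t \<in> real_spectrum P"
    then show "\<bar>t * (1 / (t + c n))\<bar> \<le> 1" using Pt[of t] tc[of t n] c[of n] by (simp add: divide_le_eq)
  qed simp
  have einc: "cstar_positive (e n - e m)" if "m \<le> n" for m n
    unfolding e_def cfc_diff[OF P(2) cont_e cont_e, symmetric]
  proof (rule cfc_positive[OF P(2) continuous_on_diff[OF cont_e cont_e]])
    fix t assume t: "t \<in> real_spectrum P"
    have "1 / (t + c m) \<le> 1 / (t + c n)"
      using tc[OF t, of n] cdec[OF that] by (intro divide_left_mono) (auto simp: tc[OF t])
    then show "0 \<le> t * (1 / (t + c n)) - t * (1 / (t + c m))" using Pt[OF t] by (simp only: diff_ge_0_iff_ge mult_left_mono)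
  qed
  have ePn: "norm (e n * P - P) \<le> c n" for n
  proof -
    have "e n * P - P = cfc (\<lambda>t. t * (1 / (t + c n)) * t - t) P"
      using cfc_mult[OF P(2) cont_e continuous_on_id]
        cfc_diff[OF P(2) continuous_on_mult[OF cont_e continuous_on_id] continuous_on_id]
      by (simp add: e_def cfc_ident[OF P(2)])
    also have "norm \<dots> \<le> c n"
    proof (rule norm_cfc_le[OF P(2)])
      show "continuous_on (real_spectrum P) (\<lambda>t. t * (1 / (t + c n)) * t - t)"
        by (intro continuous_on_diff continuous_on_mult cont_r continuous_on_id)
      fix t assume t: "t \<in> real_spectrum P"
      have "t * (1 / (t + c n)) * t - t = - (c n * (t / (t + c n)))"
        using tc[OF t, of n] by (simp add: field_simps)
      moreover have "t / (t + c n) \<le> 1" "0 \<le> t / (t + c n)" using Pt[OF t] tc[OF t, of n] c[of n] by auto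
      then have "c n * (t / (t + c n)) \<le> c n" "0 \<le> c n * (t / (t + c n))"
        using c[of n] by (simp_all only: mult_left_le mult_nonneg_nonneg less_imp_le)
      ultimately show "\<bar>t * (1 / (t + c n)) * t - t\<bar> \<le> c n"
        by (simp only: abs_minus_cancel abs_of_nonneg)
    qed (use c in \<open>simp add: less_imp_le\<close>)
    finally show ?thesis .
  qed
  have Pe: "P * e n = e n * P" for n
  proof -
    have "P * e n = P * r n * P" by (simp add: mult.assoc rP)
    then show ?thesis by (simp add: Pr)
  qed
  obtain E where E: "\<And>x. (\<lambda>n. op_apply (e n) x) \<longlonglongrightarrow> op_apply E x"
    using increasing_operators_converge[of e 1, OF einc ne] by blast
  define u where "u n = W * r n" for n
  have nu: "norm (op_apply (u n) x) = norm (op_apply (e n) x)" for n x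
    by (simp add: u_def op_apply_simps normP flip: Pr)
  have nu_diff: "norm (op_apply (u n) x - op_apply (u m) x) = norm (op_apply (e n) x - op_apply (e m) x)" for m n x
  proof -
    have "op_apply (u n) x - op_apply (u m) x = op_apply W (op_apply (r n) x - op_apply (r m) x)"
      by (simp add: u_def op_apply_simps)
    then have "norm (op_apply (u n) x - op_apply (u m) x) = norm (op_apply P (op_apply (r n) x - op_apply (r m) x))"
      by (simp only: normP)
    then show ?thesis by (simp add: op_apply_simps flip: Pr)
  qed
  have conv: "convergent (\<lambda>n. op_apply (u n) x)" for x
  proof -
    have "Cauchy (\<lambda>n. op_apply (e n) x)" using E by (rule LIMSEQ_imp_Cauchy)
    then have "Cauchy (\<lambda>n. op_apply (u n) x)" by (simp add: Cauchy_def dist_norm nu_diff)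
    then show ?thesis by (simp add: Cauchy_convergent_iff)
  qed
  have "norm (u n) \<le> 1" for n
  proof (rule norm_op_leI)
    show "norm (op_apply (u n) x) \<le> 1 * norm x" for x
      using norm_op_apply_le[of "e n" x] mult_right_mono[OF ne[of n] norm_ge_zero[of x]] by (simp add: nu)
  qed simp
  then obtain U where U: "\<And>x. (\<lambda>n. op_apply (u n) x) \<longlonglongrightarrow> op_apply U x"
    using strong_limit_exists[of u 1, OF conv] by blast
  have "u n \<in> M" for n
    unfolding u_def r_def by (intro clM W von_neumann_algebra_cfc[OF M PM P(2) cont_r])
  then have UM: "U \<in> M" using von_neumann_algebra_strong_limit[OF M _ U] by blast
  have small: "(\<lambda>n. op_apply (T n) x) \<longlonglongrightarrow> op_apply S x"
    if "\<And>n. norm (op_apply (T n) x - op_apply S x) \<le> c n * norm x" for T S and x :: 'h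
  proof -
    have "(\<lambda>n. op_apply (T n) x - op_apply S x) \<longlonglongrightarrow> 0"
      by (rule Lim_null_comparison[OF always_eventually[OF allI[OF that]] tendsto_mult_left_zero[OF c0]])
    then show ?thesis by (simp add: LIM_zero_iff)
  qed
  have ePx: "norm (op_apply (e n) (op_apply P x) - op_apply P x) \<le> c n * norm x" for n x
    using norm_op_apply_le[of "e n * P - P" x] mult_right_mono[OF ePn[of n] norm_ge_zero[of x]]
    by (simp add: op_apply_simps)
  have EP: "E * P = P"
  proof (rule op_eqI)
    fix x
    have "(\<lambda>n. op_apply (e n * P) x) \<longlonglongrightarrow> op_apply P x"
      by (rule small) (simp add: op_apply_simps ePx)
    then show "op_apply (E * P) x = op_apply P x"
      using E[of "op_apply P x"] LIMSEQ_unique by (simp add: op_apply_simps) blast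
  qed
  have UP: "U * P = W"
  proof (rule op_eqI)
    fix x
    have "(\<lambda>n. op_apply (u n * P) x) \<longlonglongrightarrow> op_apply W x"
    proof (rule small)
      fix n
      have "op_apply (u n * P) x - op_apply W x = op_apply W (op_apply (e n) x - x)"
        by (simp add: u_def op_apply_simps flip: rP)
      also have "norm \<dots> = norm (op_apply (P * e n) x - op_apply P x)"
        by (simp only: normP) (simp add: op_apply_simps)
      also have "\<dots> \<le> c n * norm x" unfolding Pe by (simp add: op_apply_simps ePx)
      finally show "norm (op_apply (u n * P) x - op_apply W x) \<le> c n * norm x" .
    qed
    then show "op_apply (U * P) x = op_apply W x"
      using U[of "op_apply P x"] LIMSEQ_unique by (simp add: op_apply_simps) blast
  qed
  have Ee: "E * e n = e n" for n by (metis EP Pr mult.assoc)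
  have EE: "op_apply E (op_apply E x) = op_apply E x" for x
  proof -
    have "(\<lambda>n. op_apply E (op_apply (e n) x)) \<longlonglongrightarrow> op_apply E (op_apply E x)"
      by (rule blinfun.tendsto[OF tendsto_const E])
    moreover have "op_apply E (op_apply (e n) x) = op_apply (e n) x" for n
      by (simp only: Ee flip: op_apply_simps(4))
    ultimately have "(\<lambda>n. op_apply (e n) x) \<longlonglongrightarrow> op_apply E (op_apply E x)" by (simp only:)
    then show ?thesis using E by (rule LIMSEQ_unique)
  qed
  have sE: "inner (op_apply E x) y = inner x (op_apply E y)" for x y
  proof -
    have "(\<lambda>n. inner (op_apply (e n) x) y) \<longlonglongrightarrow> inner (op_apply E x) y"
      "(\<lambda>n. inner x (op_apply (e n) y)) \<longlonglongrightarrow> inner x (op_apply E y)"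
      by (intro tendsto_intros E)+
    then show ?thesis unfolding inner_self_adjoint[OF se] by (rule LIMSEQ_unique)
  qed
  have inner_W: "inner (op_apply W x) (op_apply W y) = inner (op_apply P x) (op_apply P y)" for x y
  proof -
    have "inner (op_apply W x) (op_apply W y) = inner (op_apply (star W * W) x) y"
      by (simp add: op_apply_simps inner_star)
    then show ?thesis by (simp add: op_apply_simps inner_self_adjoint[OF P(2)] flip: P(3))
  qed
  have UU: "star U * U = E"
  proof (rule op_inner_eqI)
    fix x y
    have "(\<lambda>n. inner (op_apply (u n) x) (op_apply (u n) y)) \<longlonglongrightarrow> inner (op_apply U x) (op_apply U y)"
      by (intro tendsto_intros U)
    moreover have "inner (op_apply (u n) x) (op_apply (u n) y) = inner (op_apply (e n) x) (op_apply (e n) y)" for n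
      by (simp add: u_def op_apply_simps inner_W flip: Pr)
    moreover have "(\<lambda>n. inner (op_apply (e n) x) (op_apply (e n) y)) \<longlonglongrightarrow> inner (op_apply E x) (op_apply E y)"
      by (intro tendsto_intros E)
    ultimately have "inner (op_apply U x) (op_apply U y) = inner (op_apply E x) (op_apply E y)"
      using LIMSEQ_unique by force
    then show "inner (op_apply (star U * U) x) y = inner (op_apply E x) y"
      by (simp add: op_apply_simps inner_star sE EE)
  qed
  have UE: "U * E = U"
  proof (rule op_eqI)
    fix x
    define z where "z = op_apply E x - x"
    have "op_apply E z = 0" by (simp add: z_def op_apply_simps EE)
    then have "inner (op_apply (star U * U) z) z = 0" by (simp add: UU)
    then have "op_apply U z = 0" by (simp add: op_apply_simps inner_star)
    then show "op_apply (U * E) x = op_apply U x" by (simp add: z_def op_apply_simps)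
  qed
  have "U * star U * (U * star U) = U * (star U * U) * star U" by (simp add: mult.assoc)
  then have "partial_isometry (star U)"
    by (simp add: partial_isometry_def projection_def star_mult star_star UU UE)
  moreover have "star U * W = P"
    by (simp add: UU EP flip: UP mult.assoc)
  ultimately show ?thesis using that UM by (simp add: P_def)
qed

theorem theorem4p1:
  fixes \<B> :: "'h::complex_hilbert_space bounded_op set"
    and Z J :: "'a::cstar_algebra"
    and \<Phi> :: "'a \<Rightarrow> 'h bounded_op"
  assumes "von_neumann_algebra \<B>"
    and "cstar_positive J"
    and "range \<Phi> \<subseteq> \<B>"
    and "clinear \<Phi>"
    and "positive_map \<Phi>"
    and "\<exists>f g :: real \<Rightarrow> real.
           continuous_on {0..} f \<and> continuous_on {0..} g \<and>
           (\<forall>t\<ge>0. 0 \<le> f t) \<and> (\<forall>t\<ge>0. 0 \<le> g t) \<and>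
           (\<forall>t\<ge>0. f t * g t = t\<^sup>2) \<and>
           cfc f (cstar_abs Z) \<preceq> J \<and> cfc g (cstar_abs (star Z)) \<preceq> J"
  shows "\<exists>V\<in>\<B>. partial_isometry V \<and>
           cstar_abs (\<Phi> Z) \<preceq> \<Phi> J #\<^sub>g (V * \<Phi> J * star V)"
proof -
  obtain f g :: "real \<Rightarrow> real" where fg: "continuous_on {0..} f" "\<And>t. 0 \<le> t \<Longrightarrow> 0 \<le> f t"
      "continuous_on {0..} g" "\<And>t. 0 \<le> t \<Longrightarrow> 0 \<le> g t" "\<And>t. 0 \<le> t \<Longrightarrow> f t * g t = t\<^sup>2"
      "cfc f (cstar_abs Z) \<preceq> J" "cfc g (cstar_abs (star Z)) \<preceq> J"
    using assms(6) by blast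
  note block = positive_map_block_positive[OF assms(4,5,2) fg]
  have "\<Phi> Z \<in> \<B>" using assms(3) by blast
  then obtain U where U: "U \<in> \<B>" "partial_isometry (star U)" "star U * \<Phi> Z = cstar_abs (\<Phi> Z)"
    by (rule von_neumann_polar_decomposition[OF assms(1)])
  have A: "cstar_positive (\<Phi> J)" using assms(2,5) by (simp add: positive_map_def)
  have "block_positive (\<Phi> J) (cstar_abs (\<Phi> Z)) (star U * \<Phi> J * U)"
    unfolding block_positive_def
  proof (intro allI)
    fix x y
    show "2 * inner (op_apply (cstar_abs (\<Phi> Z)) x) y
        \<le> inner (op_apply (\<Phi> J) x) x + inner (op_apply (star U * \<Phi> J * U) y) y"
      using block[of x "op_apply U y"] by (simp add: op_apply_simps inner_star flip: U(3))
  qed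
  then have "cstar_abs (\<Phi> Z) \<preceq> \<Phi> J #\<^sub>g (star U * \<Phi> J * U)"
    by (intro geometric_mean_greatest A cstar_positive_conjugate cstar_abs_props(2))
  moreover have "star U \<in> \<B>" using assms(1) U(1) by (simp add: von_neumann_algebra_def)
  ultimately show ?thesis using U(2) by (metis star_star)
qed

end
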